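(* Let $R$ be a (commutative) principal ideal domain, $\sigma\in\mathrm{Aut}(R)$, $0\ne a\in R$, and $A=R(\sigma,a)$ the corresponding generalized Weyl algebra. Suppose that $R$ is not a field and that all $\mathcal G$-orbits in $\mathrm{Irr}(R)$ are infinite. Then the following hold: (a) For every divisor $\mathsf p$ of $a$, all composition factors of the $A$-module $V_{\mathsf p}$ are simple weight modules with finite support, except for the (simple) socle $\mathrm{Soc}(V_{\mathsf p})$, which is isomorphic to $V_{\hat{\mathsf p}}$ for some divisor $\hat{\mathsf p}$ of $a$. (b) Any simple weight $A$-module with finite support appears as a composition factor of $V_{\mathsf p}$ for some divisor $\mathsf p$ of $a$.
   Context: Modules are left and unital. The generalized Weyl algebra $R(\sigma,a)$ is the ring generated by $R$, $x$, $y$ subject to $x\sigma(r)=rx$, $yr=\sigma(r)y$ for all $r\in R$, $xy=a$, $yx=\sigma(a)$. For a divisor $\mathsf p$ of $a$ and $\mathsf q=\sigma(a/\mathsf p)$, the $A$-module $V_{\mathsf p}$ is $R$ as an abelian group, with $r'\cdot r=r'r$, $x\cdot r=\sigma^{-1}(r)\mathsf p$, $y\cdot r=\sigma(r)\mathsf q$. $\mathrm{Irr}(R)$ is the set of classes, up to associates, of irreducible elements of $R$, on which $\mathcal G=\langle\sigma\rangle\le\mathrm{Aut}(R)$ acts. (When all these orbits are infinite, every $V_{\mathsf p}$ has finite length and a unique simple submodule, its socle.) An $A$-module $M$ is a weight module if $M=\bigoplus_{\mathfrak m\in\mathrm{Max}(R)}M_{\mathfrak m}$, where $\mathrm{Max}(R)$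 is the set of maximal ideals of $R$ and $M_{\mathfrak m}=\{v\in M\mid\mathfrak m\cdot v=0\}$. The support of $M$ is $\{\mathfrak m\in\mathrm{Max}(R)\mid M_{\mathfrak m}\ne0\}$. *)

theory Defs
  imports "HOL-Algebra.Algebra"
begin

section \<open>Generalized Weyl algebras by generators and relations\<close>

text \<open>Ring expressions in the elements of the base ring and two further generators.\<close>

datatype 'r gwa_term =
    GCoef 'r
  | GX
  | GY
  | GAdd "'r gwa_term" "'r gwa_term"
  | GNeg "'r gwa_term"
  | GMul "'r gwa_term" "'r gwa_term"

definition gwa_terms :: "('r, 'm) ring_scheme \<Rightarrow> 'r gwa_term set"
  where "gwa_terms R = {t. set_gwa_term t \<subseteq> carrier R}"

text \<open>
  The least congruence that makes the expressions a ring, makes \<open>GCoef\<close> a unital ring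
  homomorphism, and contains the four families of defining relations.
\<close>

inductive gwa_cong ::
    "('r, 'm) ring_scheme \<Rightarrow> ('r \<Rightarrow> 'r) \<Rightarrow> 'r \<Rightarrow> 'r gwa_term \<Rightarrow> 'r gwa_term \<Rightarrow> bool"
  for R (structure) and \<sigma> and a
where
  refl: "t \<in> gwa_terms R \<Longrightarrow> gwa_cong R \<sigma> a t t"
| sym: "gwa_cong R \<sigma> a s t \<Longrightarrow> gwa_cong R \<sigma> a t s"
| trans: "\<lbrakk>gwa_cong R \<sigma> a s t; gwa_cong R \<sigma> a t u\<rbrakk> \<Longrightarrow> gwa_cong R \<sigma> a s u"
| Add_cong: "\<lbrakk>gwa_cong R \<sigma> a s s'; gwa_cong R \<sigma> a t t'\<rbrakk> \<Longrightarrow> gwa_cong R \<sigma> a (GAdd s t) (GAdd s' t')"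
| Neg_cong: "gwa_cong R \<sigma> a s s' \<Longrightarrow> gwa_cong R \<sigma> a (GNeg s) (GNeg s')"
| Mul_cong: "\<lbrakk>gwa_cong R \<sigma> a s s'; gwa_cong R \<sigma> a t t'\<rbrakk> \<Longrightarrow> gwa_cong R \<sigma> a (GMul s t) (GMul s' t')"
| Add_assoc: "\<lbrakk>s \<in> gwa_terms R; t \<in> gwa_terms R; u \<in> gwa_terms R\<rbrakk>
    \<Longrightarrow> gwa_cong R \<sigma> a (GAdd (GAdd s t) u) (GAdd s (GAdd t u))"
| Add_comm: "\<lbrakk>s \<in> gwa_terms R; t \<in> gwa_terms R\<rbrakk> \<Longrightarrow> gwa_cong R \<sigma> a (GAdd s t) (GAdd t s)"
| Add_zero: "t \<in> gwa_terms R \<Longrightarrow> gwa_cong R \<sigma> a (GAdd (GCoef \<zero>) t) t"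
| Add_Neg: "t \<in> gwa_terms R \<Longrightarrow> gwa_cong R \<sigma> a (GAdd (GNeg t) t) (GCoef \<zero>)"
| Mul_assoc: "\<lbrakk>s \<in> gwa_terms R; t \<in> gwa_terms R; u \<in> gwa_terms R\<rbrakk>
    \<Longrightarrow> gwa_cong R \<sigma> a (GMul (GMul s t) u) (GMul s (GMul t u))"
| one_Mul: "t \<in> gwa_terms R \<Longrightarrow> gwa_cong R \<sigma> a (GMul (GCoef \<one>) t) t"
| Mul_one: "t \<in> gwa_terms R \<Longrightarrow> gwa_cong R \<sigma> a (GMul t (GCoef \<one>)) t"
| distrib_right: "\<lbrakk>s \<in> gwa_terms R; t \<in> gwa_terms R; u \<in> gwa_terms R\<rbrakk>
    \<Longrightarrow> gwa_cong R \<sigma> a (GMul (GAdd s t) u) (GAdd (GMul s u) (GMul t u))"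
| distrib_left: "\<lbrakk>s \<in> gwa_terms R; t \<in> gwa_terms R; u \<in> gwa_terms R\<rbrakk>
    \<Longrightarrow> gwa_cong R \<sigma> a (GMul u (GAdd s t)) (GAdd (GMul u s) (GMul u t))"
| Coef_add: "\<lbrakk>r \<in> carrier R; r' \<in> carrier R\<rbrakk>
    \<Longrightarrow> gwa_cong R \<sigma> a (GCoef (r \<oplus> r')) (GAdd (GCoef r) (GCoef r'))"
| Coef_mult: "\<lbrakk>r \<in> carrier R; r' \<in> carrier R\<rbrakk>
    \<Longrightarrow> gwa_cong R \<sigma> a (GCoef (r \<otimes> r')) (GMul (GCoef r) (GCoef r'))"
| X_Coef: "r \<in> carrier R \<Longrightarrow> gwa_cong R \<sigma> a (GMul GX (GCoef (\<sigma> r))) (GMul (GCoef r) GX)"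
| Y_Coef: "r \<in> carrier R \<Longrightarrow> gwa_cong R \<sigma> a (GMul GY (GCoef r)) (GMul (GCoef (\<sigma> r)) GY)"
| X_Y: "gwa_cong R \<sigma> a (GMul GX GY) (GCoef a)"
| Y_X: "gwa_cong R \<sigma> a (GMul GY GX) (GCoef (\<sigma> a))"

definition gwa_class ::
    "('r, 'm) ring_scheme \<Rightarrow> ('r \<Rightarrow> 'r) \<Rightarrow> 'r \<Rightarrow> 'r gwa_term \<Rightarrow> 'r gwa_term set"
  where "gwa_class R \<sigma> a t = {s. gwa_cong R \<sigma> a t s}"

definition gwa :: "('r, 'm) ring_scheme \<Rightarrow> ('r \<Rightarrow> 'r) \<Rightarrow> 'r \<Rightarrow> 'r gwa_term set ring"
  where "gwa R \<sigma> a =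
    \<lparr>carrier = gwa_class R \<sigma> a ` gwa_terms R,
     monoid.mult = (\<lambda>C D. \<Union>s\<in>C. \<Union>t\<in>D. gwa_class R \<sigma> a (GMul s t)),
     one = gwa_class R \<sigma> a (GCoef \<one>\<^bsub>R\<^esub>),
     ring.zero = gwa_class R \<sigma> a (GCoef \<zero>\<^bsub>R\<^esub>),
     add = (\<lambda>C D. \<Union>s\<in>C. \<Union>t\<in>D. gwa_class R \<sigma> a (GAdd s t))\<rparr>"


section \<open>Modules over a not necessarily commutative ring\<close>

text \<open>
  The locale \<^locale>\<open>module\<close> of the library requires a commutative base ring. Of a record of
  type \<^typ>\<open>('a, 'b) module\<close> only the additive structure and the scalar multiplication matter.
\<close>

locale left_module = R?: ring R + M?: abelian_group M
    for R :: "('a, 'k) ring_scheme" (structure) and M :: "('a, 'b, 'm) module_scheme" (structure) +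
  assumes smult_closed [simp, intro]:
      "\<lbrakk>r \<in> carrier R; v \<in> carrier M\<rbrakk> \<Longrightarrow> r \<odot>\<^bsub>M\<^esub> v \<in> carrier M"
    and smult_l_distr:
      "\<lbrakk>r \<in> carrier R; s \<in> carrier R; v \<in> carrier M\<rbrakk>
        \<Longrightarrow> (r \<oplus> s) \<odot>\<^bsub>M\<^esub> v = r \<odot>\<^bsub>M\<^esub> v \<oplus>\<^bsub>M\<^esub> s \<odot>\<^bsub>M\<^esub> v"
    and smult_r_distr:
      "\<lbrakk>r \<in> carrier R; v \<in> carrier M; w \<in> carrier M\<rbrakk>
        \<Longrightarrow> r \<odot>\<^bsub>M\<^esub> (v \<oplus>\<^bsub>M\<^esub> w) = r \<odot>\<^bsub>M\<^esub> v \<oplus>\<^bsub>M\<^esub> r \<odot>\<^bsub>M\<^esub> w"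
    and smult_assoc1:
      "\<lbrakk>r \<in> carrier R; s \<in> carrier R; v \<in> carrier M\<rbrakk>
        \<Longrightarrow> (r \<otimes> s) \<odot>\<^bsub>M\<^esub> v = r \<odot>\<^bsub>M\<^esub> (s \<odot>\<^bsub>M\<^esub> v)"
    and smult_one [simp]: "v \<in> carrier M \<Longrightarrow> \<one> \<odot>\<^bsub>M\<^esub> v = v"

definition module_iso ::
    "('a, 'k) ring_scheme \<Rightarrow> ('a, 'b, 'm) module_scheme \<Rightarrow> ('a, 'c, 'n) module_scheme \<Rightarrow> bool"
  where "module_iso A M N \<longleftrightarrow> (\<exists>f. bij_betw f (carrier M) (carrier N)
    \<and> (\<forall>v\<in>carrier M. \<forall>w\<in>carrier M. f (v \<oplus>\<^bsub>M\<^esub> w) = f v \<oplus>\<^bsub>N\<^esub> f w)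
    \<and> (\<forall>r\<in>carrier A. \<forall>v\<in>carrier M. f (r \<odot>\<^bsub>M\<^esub> v) = r \<odot>\<^bsub>N\<^esub> f v))"

definition simple_module :: "('a, 'k) ring_scheme \<Rightarrow> ('a, 'b, 'm) module_scheme \<Rightarrow> bool"
  where "simple_module A M \<longleftrightarrow> left_module A M \<and> carrier M \<noteq> {\<zero>\<^bsub>M\<^esub>}
    \<and> (\<forall>N. submodule N A M \<longrightarrow> N = {\<zero>\<^bsub>M\<^esub>} \<or> N = carrier M)"

text \<open>
  The quotient of \<open>M\<close> by a submodule \<open>N\<close>, on additive cosets. The fields
  \<^const>\<open>monoid.mult\<close> and \<^const>\<open>one\<close> carry no meaning here.
\<close>

definition quot_module :: "('a, 'b) module \<Rightarrow> 'b set \<Rightarrow> ('a, 'b set) module"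
  where "quot_module M N =
    \<lparr>carrier = a_rcosets\<^bsub>M\<^esub> N,
     monoid.mult = rcoset_mult M N,
     one = N +>\<^bsub>M\<^esub> \<one>\<^bsub>M\<^esub>,
     ring.zero = N,
     add = (<+>\<^bsub>M\<^esub>),
     smult = (\<lambda>r C. \<Union>v\<in>C. N +>\<^bsub>M\<^esub> (r \<odot>\<^bsub>M\<^esub> v))\<rparr>"

definition series_factor :: "('a, 'b) module \<Rightarrow> 'b set list \<Rightarrow> nat \<Rightarrow> ('a, 'b set) module"
  where "series_factor M Ns i = quot_module (M\<lparr>carrier := Ns ! Suc i\<rparr>) (Ns ! i)"

definition composition_series :: "('a, 'k) ring_scheme \<Rightarrow> ('a, 'b) module \<Rightarrow> 'b set list \<Rightarrow> bool"
  where "composition_series A M Ns \<longleftrightarrow>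
    Ns \<noteq> [] \<and> hd Ns = {\<zero>\<^bsub>M\<^esub>} \<and> last Ns = carrier M \<and> (\<forall>N\<in>set Ns. submodule N A M)
    \<and> (\<forall>i. Suc i < length Ns \<longrightarrow>
          Ns ! i \<subseteq> Ns ! Suc i \<and> simple_module A (series_factor M Ns i))"

definition composition_factor ::
    "('a, 'k) ring_scheme \<Rightarrow> ('a, 'b) module \<Rightarrow> ('a, 'c) module \<Rightarrow> bool"
  where "composition_factor A M L \<longleftrightarrow>
    (\<exists>Ns. composition_series A M Ns
      \<and> (\<exists>i. Suc i < length Ns \<and> module_iso A L (series_factor M Ns i)))"

text \<open>
  The sum of all simple submodules; as an additive group it is generated by their union.
\<close>

definition socle :: "('a, 'k) ring_scheme \<Rightarrow> ('a, 'b) module \<Rightarrow> ('a, 'b) module"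
  where "socle A M = M\<lparr>carrier := generate (add_monoid M)
    (\<Union>{N. submodule N A M \<and> simple_module A (M\<lparr>carrier := N\<rparr>)})\<rparr>"


section \<open>Weight modules\<close>

definition Max_ideals :: "('r, 'm) ring_scheme \<Rightarrow> 'r set set"
  where "Max_ideals R = {\<mm>. maximalideal \<mm> R}"

definition weight_space :: "('r, 'm) ring_scheme \<Rightarrow> ('r \<Rightarrow> 'r) \<Rightarrow> 'r
    \<Rightarrow> ('r gwa_term set, 'v) module \<Rightarrow> 'r set \<Rightarrow> 'v set"
  where "weight_space R \<sigma> a M \<mm> =
    {v \<in> carrier M. \<forall>r\<in>\<mm>. gwa_class R \<sigma> a (GCoef r) \<odot>\<^bsub>M\<^esub> v = \<zero>\<^bsub>M\<^esub>}"

definition weight_support :: "('r, 'm) ring_scheme \<Rightarrow> ('r \<Rightarrow> 'r) \<Rightarrow> 'r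
    \<Rightarrow> ('r gwa_term set, 'v) module \<Rightarrow> 'r set set"
  where "weight_support R \<sigma> a M = {\<mm> \<in> Max_ideals R. weight_space R \<sigma> a M \<mm> \<noteq> {\<zero>\<^bsub>M\<^esub>}}"

text \<open>
  Internal direct sum decomposition: every vector is, in exactly one way, the sum of a finitely
  supported family of weight vectors indexed by the maximal ideals.
\<close>

definition weight_module :: "('r, 'm) ring_scheme \<Rightarrow> ('r \<Rightarrow> 'r) \<Rightarrow> 'r
    \<Rightarrow> ('r gwa_term set, 'v) module \<Rightarrow> bool"
  where "weight_module R \<sigma> a M \<longleftrightarrow> left_module (gwa R \<sigma> a) M \<and>
    (\<forall>v\<in>carrier M. \<exists>!w. w \<in> (\<Pi>\<^sub>E \<mm>\<in>Max_ideals R. weight_space R \<sigma> a M \<mm>)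
      \<and> finite {\<mm> \<in> Max_ideals R. w \<mm> \<noteq> \<zero>\<^bsub>M\<^esub>}
      \<and> v = finsum M w {\<mm> \<in> Max_ideals R. w \<mm> \<noteq> \<zero>\<^bsub>M\<^esub>})"


section \<open>The modules attached to divisors and the action on irreducible elements\<close>

definition cofactor :: "('r, 'm) ring_scheme \<Rightarrow> 'r \<Rightarrow> 'r \<Rightarrow> 'r"
  where "cofactor R a p = (THE c. c \<in> carrier R \<and> a = p \<otimes>\<^bsub>R\<^esub> c)"

primrec div_act :: "('r, 'm) ring_scheme \<Rightarrow> ('r \<Rightarrow> 'r) \<Rightarrow> 'r \<Rightarrow> 'r \<Rightarrow> 'r gwa_term \<Rightarrow> 'r \<Rightarrow> 'r"
where
  "div_act R \<sigma> p q (GCoef r') r = r' \<otimes>\<^bsub>R\<^esub> r"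
| "div_act R \<sigma> p q GX r = inv_into (carrier R) \<sigma> r \<otimes>\<^bsub>R\<^esub> p"
| "div_act R \<sigma> p q GY r = \<sigma> r \<otimes>\<^bsub>R\<^esub> q"
| "div_act R \<sigma> p q (GAdd s t) r = div_act R \<sigma> p q s r \<oplus>\<^bsub>R\<^esub> div_act R \<sigma> p q t r"
| "div_act R \<sigma> p q (GNeg s) r = \<ominus>\<^bsub>R\<^esub> div_act R \<sigma> p q s r"
| "div_act R \<sigma> p q (GMul s t) r = div_act R \<sigma> p q s (div_act R \<sigma> p q t r)"

text \<open>
  The module $V_p$. The image under \<^const>\<open>the_elem\<close> is a singleton, because congruent
  expressions act equally (shown in the last section).
\<close>

definition div_module :: "('r, 'm) ring_scheme \<Rightarrow> ('r \<Rightarrow> 'r) \<Rightarrow> 'r \<Rightarrow> 'r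
    \<Rightarrow> ('r gwa_term set, 'r) module"
  where "div_module R \<sigma> a p =
    \<lparr>carrier = carrier R,
     monoid.mult = monoid.mult R,
     one = \<one>\<^bsub>R\<^esub>,
     ring.zero = \<zero>\<^bsub>R\<^esub>,
     add = add R,
     smult = (\<lambda>C r. the_elem ((\<lambda>t. div_act R \<sigma> p (\<sigma> (cofactor R a p)) t r) ` C))\<rparr>"

definition Irr :: "('r, 'm) ring_scheme \<Rightarrow> 'r set set"
  where "Irr R = {assocs R r | r. r \<in> carrier R \<and> ring_irreducible\<^bsub>R\<^esub> r}"

text \<open>
  The cyclic group generated by an automorphism, as a subgroup of the group of bijections of the
  carrier. Elements of \<^const>\<open>BijGroup\<close> are extensional, hence the restriction.
\<close>

definition aut_group :: "('r, 'm) ring_scheme \<Rightarrow> ('r \<Rightarrow> 'r) \<Rightarrow> ('r \<Rightarrow> 'r) monoid"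
  where "aut_group R \<sigma> = (BijGroup (carrier R))
    \<lparr>carrier := generate (BijGroup (carrier R)) {restrict \<sigma> (carrier R)}\<rparr>"

definition Irr_orbit :: "('r, 'm) ring_scheme \<Rightarrow> ('r \<Rightarrow> 'r) \<Rightarrow> 'r set \<Rightarrow> 'r set set"
  where "Irr_orbit R \<sigma> C = Group_Action.orbit (aut_group R \<sigma>) (\<lambda>g D. g ` D) C"


section \<open>Well-definedness of the algebra and of the modules attached to divisors\<close>

lemma gwa_cong_in_terms:
  fixes R (structure)
  assumes "ring R" "\<sigma> \<in> carrier R \<rightarrow> carrier R" "a \<in> carrier R" "gwa_cong R \<sigma> a s t"
  shows "s \<in> gwa_terms R \<and> t \<in> gwa_terms R"
proof -
  interpret ring R by fact
  show ?thesis using assms(4)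
    by (induction rule: gwa_cong.induct) (use assms(2,3) in \<open>auto simp: gwa_terms_def\<close>)
qed

lemma gwa_class_eqI: "gwa_cong R \<sigma> a s t \<Longrightarrow> gwa_class R \<sigma> a s = gwa_class R \<sigma> a t"
  unfolding gwa_class_def by (blast intro: gwa_cong.sym gwa_cong.trans)

lemma gwa_class_eq_iff:
  assumes "t \<in> gwa_terms R"
  shows "gwa_class R \<sigma> a s = gwa_class R \<sigma> a t \<longleftrightarrow> gwa_cong R \<sigma> a s t"
proof
  assume "gwa_class R \<sigma> a s = gwa_class R \<sigma> a t"
  moreover have "t \<in> gwa_class R \<sigma> a t"
    using gwa_cong.refl[OF assms] by (simp add: gwa_class_def)
  ultimately show "gwa_cong R \<sigma> a s t" by (simp add: gwa_class_def set_eq_iff)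
qed (rule gwa_class_eqI)

lemma gwa_add_class:
  assumes "s \<in> gwa_terms R" "t \<in> gwa_terms R"
  shows "gwa_class R \<sigma> a s \<oplus>\<^bsub>gwa R \<sigma> a\<^esub> gwa_class R \<sigma> a t = gwa_class R \<sigma> a (GAdd s t)"
proof -
  have "gwa_class R \<sigma> a (GAdd s' t') = gwa_class R \<sigma> a (GAdd s t)"
    if "s' \<in> gwa_class R \<sigma> a s" "t' \<in> gwa_class R \<sigma> a t" for s' t'
    using that gwa_class_eqI[OF gwa_cong.Add_cong, of R \<sigma> a s s' t t'] by (simp add: gwa_class_def)
  moreover have "s \<in> gwa_class R \<sigma> a s" "t \<in> gwa_class R \<sigma> a t"
    using assms by (simp_all add: gwa_class_def gwa_cong.refl)
  ultimately have "(\<Union>s'\<in>gwa_class R \<sigma> a s. \<Union>t'\<in>gwa_class R \<sigma> a t. gwa_class R \<sigma> a (GAdd s' t'))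
    = gwa_class R \<sigma> a (GAdd s t)"
    by blast
  then show ?thesis by (simp add: gwa_def)
qed

lemma gwa_mult_class:
  assumes "s \<in> gwa_terms R" "t \<in> gwa_terms R"
  shows "gwa_class R \<sigma> a s \<otimes>\<^bsub>gwa R \<sigma> a\<^esub> gwa_class R \<sigma> a t = gwa_class R \<sigma> a (GMul s t)"
proof -
  have "gwa_class R \<sigma> a (GMul s' t') = gwa_class R \<sigma> a (GMul s t)"
    if "s' \<in> gwa_class R \<sigma> a s" "t' \<in> gwa_class R \<sigma> a t" for s' t'
    using that gwa_class_eqI[OF gwa_cong.Mul_cong, of R \<sigma> a s s' t t'] by (simp add: gwa_class_def)
  moreover have "s \<in> gwa_class R \<sigma> a s" "t \<in> gwa_class R \<sigma> a t"
    using assms by (simp_all add: gwa_class_def gwa_cong.refl)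
  ultimately have "(\<Union>s'\<in>gwa_class R \<sigma> a s. \<Union>t'\<in>gwa_class R \<sigma> a t. gwa_class R \<sigma> a (GMul s' t'))
    = gwa_class R \<sigma> a (GMul s t)"
    by blast
  then show ?thesis by (simp add: gwa_def)
qed

lemma gwa_terms_intros:
  "r \<in> carrier R \<Longrightarrow> GCoef r \<in> gwa_terms R" "GX \<in> gwa_terms R" "GY \<in> gwa_terms R"
  "s \<in> gwa_terms R \<Longrightarrow> t \<in> gwa_terms R \<Longrightarrow> GAdd s t \<in> gwa_terms R"
  "s \<in> gwa_terms R \<Longrightarrow> t \<in> gwa_terms R \<Longrightarrow> GMul s t \<in> gwa_terms R"
  "s \<in> gwa_terms R \<Longrightarrow> GNeg s \<in> gwa_terms R"
  by (auto simp: gwa_terms_def)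

lemmas gwa_cong_axioms =
  gwa_cong.refl gwa_cong.Add_assoc gwa_cong.Add_comm gwa_cong.Add_zero gwa_cong.Add_Neg
  gwa_cong.Mul_assoc gwa_cong.one_Mul gwa_cong.Mul_one gwa_cong.distrib_right gwa_cong.distrib_left
  gwa_cong.Coef_add gwa_cong.Coef_mult gwa_cong.X_Coef gwa_cong.Y_Coef gwa_cong.X_Y gwa_cong.Y_X

lemma gwa_ring:
  fixes R (structure)
  assumes "ring R"
  shows "ring (gwa R \<sigma> a)"
proof -
  interpret ring R by fact
  let ?A = "gwa R \<sigma> a" and ?c = "gwa_class R \<sigma> a"
  have A: "carrier ?A = ?c ` gwa_terms R" "\<one>\<^bsub>?A\<^esub> = ?c (GCoef \<one>)" "\<zero>\<^bsub>?A\<^esub> = ?c (GCoef \<zero>)"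
    by (auto simp: gwa_def)
  note simps = A gwa_terms_intros gwa_add_class gwa_mult_class
  note axs = gwa_cong_axioms[THEN gwa_class_eqI]
  have elim: "\<exists>t\<in>gwa_terms R. x = ?c t" if "x \<in> carrier ?A" for x
    using that A by auto
  show ?thesis
  proof (rule ringI)
    show "abelian_group ?A"
    proof (rule abelian_groupI)
      fix x assume "x \<in> carrier ?A"
      then obtain t where t: "t \<in> gwa_terms R" "x = ?c t" using elim by blast
      then have "?c (GNeg t) \<oplus>\<^bsub>?A\<^esub> x = \<zero>\<^bsub>?A\<^esub>"
        by (simp add: simps axs(5))
      then show "\<exists>y\<in>carrier ?A. y \<oplus>\<^bsub>?A\<^esub> x = \<zero>\<^bsub>?A\<^esub>"
        using t by (intro bexI[of _ "?c (GNeg t)"]) (simp_all add: simps)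
    next
      fix x y assume "x \<in> carrier ?A" "y \<in> carrier ?A"
      then obtain s t where st: "s \<in> gwa_terms R" "x = ?c s" "t \<in> gwa_terms R" "y = ?c t"
        using elim by blast
      then show "x \<oplus>\<^bsub>?A\<^esub> y \<in> carrier ?A" by (simp add: simps)
      show "x \<oplus>\<^bsub>?A\<^esub> y = y \<oplus>\<^bsub>?A\<^esub> x"
        using st axs(3)[of s R t] by (simp add: simps)
    next
      fix x y z assume "x \<in> carrier ?A" "y \<in> carrier ?A" "z \<in> carrier ?A"
      then obtain s t u where "s \<in> gwa_terms R" "x = ?c s" "t \<in> gwa_terms R" "y = ?c t"
        "u \<in> gwa_terms R" "z = ?c u"
        using elim by meson
      then show "x \<oplus>\<^bsub>?A\<^esub> y \<oplus>\<^bsub>?A\<^esub> z = x \<oplus>\<^bsub>?A\<^esub> (y \<oplus>\<^bsub>?A\<^esub> z)"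
        by (simp add: simps axs(2))
    next
      fix x assume "x \<in> carrier ?A"
      then obtain t where "t \<in> gwa_terms R" "x = ?c t" using elim by blast
      then show "\<zero>\<^bsub>?A\<^esub> \<oplus>\<^bsub>?A\<^esub> x = x" by (simp add: simps axs(4))
    qed (simp add: simps)
    show "Group.monoid ?A"
    proof (rule monoidI)
      fix x y assume "x \<in> carrier ?A" "y \<in> carrier ?A"
      then obtain s t where "s \<in> gwa_terms R" "x = ?c s" "t \<in> gwa_terms R" "y = ?c t"
        using elim by blast
      then show "x \<otimes>\<^bsub>?A\<^esub> y \<in> carrier ?A" by (simp add: simps)
    next
      fix x y z assume "x \<in> carrier ?A" "y \<in> carrier ?A" "z \<in> carrier ?A"
      then obtain s t u where "s \<in> gwa_terms R" "x = ?c s" "t \<in> gwa_terms R" "y = ?c t"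
        "u \<in> gwa_terms R" "z = ?c u"
        using elim by meson
      then show "x \<otimes>\<^bsub>?A\<^esub> y \<otimes>\<^bsub>?A\<^esub> z = x \<otimes>\<^bsub>?A\<^esub> (y \<otimes>\<^bsub>?A\<^esub> z)"
        by (simp add: simps axs(6))
    next
      fix x assume "x \<in> carrier ?A"
      then obtain t where "t \<in> gwa_terms R" "x = ?c t" using elim by blast
      then show "\<one>\<^bsub>?A\<^esub> \<otimes>\<^bsub>?A\<^esub> x = x" "x \<otimes>\<^bsub>?A\<^esub> \<one>\<^bsub>?A\<^esub> = x"
        by (simp_all add: simps axs(7,8))
    qed (simp add: simps)
  next
    fix x y z assume "x \<in> carrier ?A" "y \<in> carrier ?A" "z \<in> carrier ?A"
    then obtain s t u where "s \<in> gwa_terms R" "x = ?c s" "t \<in> gwa_terms R" "y = ?c t"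
      "u \<in> gwa_terms R" "z = ?c u"
      using elim by meson
    then show "(x \<oplus>\<^bsub>?A\<^esub> y) \<otimes>\<^bsub>?A\<^esub> z = x \<otimes>\<^bsub>?A\<^esub> z \<oplus>\<^bsub>?A\<^esub> y \<otimes>\<^bsub>?A\<^esub> z"
      and "z \<otimes>\<^bsub>?A\<^esub> (x \<oplus>\<^bsub>?A\<^esub> y) = z \<otimes>\<^bsub>?A\<^esub> x \<oplus>\<^bsub>?A\<^esub> z \<otimes>\<^bsub>?A\<^esub> y"
      by (simp_all add: simps axs(9,10))
  qed
qed

lemma gwa_relations:
  fixes a :: 'r
  assumes "\<sigma> \<in> carrier R \<rightarrow> carrier R" "r \<in> carrier R"
  defines "c \<equiv> gwa_class R \<sigma> a"
  shows "c GX \<otimes>\<^bsub>gwa R \<sigma> a\<^esub> c (GCoef (\<sigma> r)) = c (GCoef r) \<otimes>\<^bsub>gwa R \<sigma> a\<^esub> c GX"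
    and "c GY \<otimes>\<^bsub>gwa R \<sigma> a\<^esub> c (GCoef r) = c (GCoef (\<sigma> r)) \<otimes>\<^bsub>gwa R \<sigma> a\<^esub> c GY"
    and "c GX \<otimes>\<^bsub>gwa R \<sigma> a\<^esub> c GY = c (GCoef a)"
    and "c GY \<otimes>\<^bsub>gwa R \<sigma> a\<^esub> c GX = c (GCoef (\<sigma> a))"
proof -
  have "\<sigma> r \<in> carrier R" using assms by auto
  note [simp] = this assms(2) c_def gwa_terms_intros gwa_mult_class
  show "c GX \<otimes>\<^bsub>gwa R \<sigma> a\<^esub> c (GCoef (\<sigma> r)) = c (GCoef r) \<otimes>\<^bsub>gwa R \<sigma> a\<^esub> c GX"
    by simp (intro gwa_class_eqI gwa_cong.X_Coef assms)
  show "c GY \<otimes>\<^bsub>gwa R \<sigma> a\<^esub> c (GCoef r) = c (GCoef (\<sigma> r)) \<otimes>\<^bsub>gwa R \<sigma> a\<^esub> c GY"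
    by simp (intro gwa_class_eqI gwa_cong.Y_Coef assms)
  show "c GX \<otimes>\<^bsub>gwa R \<sigma> a\<^esub> c GY = c (GCoef a)"
    by simp (intro gwa_class_eqI gwa_cong.X_Y)
  show "c GY \<otimes>\<^bsub>gwa R \<sigma> a\<^esub> c GX = c (GCoef (\<sigma> a))"
    by simp (intro gwa_class_eqI gwa_cong.Y_X)
qed

lemma div_act_facts:
  fixes R (structure)
  assumes "domain R" "\<sigma> \<in> ring_iso R R" "p \<in> carrier R" "c \<in> carrier R" "a = p \<otimes>\<^bsub>R\<^esub> c"
  shows "t \<in> gwa_terms R \<Longrightarrow> r \<in> carrier R \<Longrightarrow> div_act R \<sigma> p (\<sigma> c) t r \<in> carrier R"
   "t \<in> gwa_terms R \<Longrightarrow> r \<in> carrier R \<Longrightarrow> r' \<in> carrier R \<Longrightarrow> div_act R \<sigma> p (\<sigma> c) t (r \<oplus>\<^bsub>R\<^esub> r') = 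
     div_act R \<sigma> p (\<sigma> c) t r \<oplus>\<^bsub>R\<^esub> div_act R \<sigma> p (\<sigma> c) t r'"
   "gwa_cong R \<sigma> a s t \<Longrightarrow> r \<in> carrier R \<Longrightarrow> div_act R \<sigma> p (\<sigma> c) s r = div_act R \<sigma> p (\<sigma> c) t r"
proof -
  interpret domain R by fact
  define \<tau> where "\<tau> = inv_into (carrier R) \<sigma>"
  have bij: "bij_betw \<sigma> (carrier R) (carrier R)" and hom: "\<sigma> \<in> ring_hom R R"
    using assms(2) by (auto simp: ring_iso_def)
  have \<sigma>c[simp]: "\<sigma> x \<in> carrier R" if "x \<in> carrier R" for x using hom that by (rule ring_hom_closed)
  have \<tau>c[simp]: "\<tau> x \<in> carrier R" if "x \<in> carrier R" for x
    using bij that unfolding \<tau>_def by (metis bij_betw_def inv_into_into)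
  have \<sigma>\<tau>[simp]: "\<sigma> (\<tau> x) = x" if "x \<in> carrier R" for x
    using bij that unfolding \<tau>_def by (metis bij_betw_inv_into_right)
  have \<tau>\<sigma>[simp]: "\<tau> (\<sigma> x) = x" if "x \<in> carrier R" for x
    using bij that unfolding \<tau>_def by (metis bij_betw_inv_into_left)
  have \<sigma>a[simp]: "\<sigma> (x \<oplus> y) = \<sigma> x \<oplus> \<sigma> y" "\<sigma> (x \<otimes> y) = \<sigma> x \<otimes> \<sigma> y"
    if "x \<in> carrier R" "y \<in> carrier R" for x y using hom that by (auto simp: ring_hom_def)
  have \<tau>a[simp]: "\<tau> (x \<oplus> y) = \<tau> x \<oplus> \<tau> y" "\<tau> (x \<otimes> y) = \<tau> x \<otimes> \<tau> y"
    if "x \<in> carrier R" "y \<in> carrier R" for x y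
  proof -
    have "\<sigma> (\<tau> x \<oplus> \<tau> y) = x \<oplus> y" "\<sigma> (\<tau> x \<otimes> \<tau> y) = x \<otimes> y"
      using that by simp_all
    moreover have "\<tau> x \<oplus> \<tau> y \<in> carrier R" "\<tau> x \<otimes> \<tau> y \<in> carrier R"
      using that by simp_all
    ultimately show "\<tau> (x \<oplus> y) = \<tau> x \<oplus> \<tau> y" "\<tau> (x \<otimes> y) = \<tau> x \<otimes> \<tau> y"
      using \<tau>\<sigma> by metis+
  qed
  let ?d = "div_act R \<sigma> p (\<sigma> c)"
  note [simp] = \<tau>_def[symmetric] assms(3,4)
  show cl: "t \<in> gwa_terms R \<Longrightarrow> r \<in> carrier R \<Longrightarrow> ?d t r \<in> carrier R" for t r
    by (induction t arbitrary: r) (auto simp: gwa_terms_def)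
  show ad: "t \<in> gwa_terms R \<Longrightarrow> r \<in> carrier R \<Longrightarrow> r' \<in> carrier R \<Longrightarrow> ?d t (r \<oplus> r') = ?d t r \<oplus> ?d t r'" for t r r'
  proof (induction t arbitrary: r r')
    case (GAdd s t)
    then have "s \<in> gwa_terms R" "t \<in> gwa_terms R" by (auto simp: gwa_terms_def)
    with GAdd cl show ?case by (simp add: a_ac)
  next
    case (GNeg t)
    then have "t \<in> gwa_terms R" by (auto simp: gwa_terms_def)
    with GNeg cl show ?case by (simp add: minus_add)
  next
    case (GMul s t)
    then have "s \<in> gwa_terms R" "t \<in> gwa_terms R" by (auto simp: gwa_terms_def)
    with GMul cl show ?case by simp
  qed (simp_all add: gwa_terms_def l_distr r_distr)
  have \<sigma>f: "\<sigma> \<in> carrier R \<rightarrow> carrier R" and ac: "a \<in> carrier R" using assms by auto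
  show "gwa_cong R \<sigma> a s t \<Longrightarrow> r \<in> carrier R \<Longrightarrow> ?d s r = ?d t r" for s t r
  proof (induction arbitrary: r rule: gwa_cong.induct)
    case (Mul_cong s s' t t')
    then have "t' \<in> gwa_terms R"
      using gwa_cong_in_terms[OF ring_axioms \<sigma>f ac] by blast
    with Mul_cong show ?case by (simp add: cl)
  next
    case (trans s t u)
    then show ?case by simp
  next
    case (distrib_left s t u)
    then show ?case by (simp add: cl ad)
  next
    case (Coef_add s t)
    then show ?case by (simp add: l_distr)
  next
    case (Coef_mult s t)
    then show ?case by (simp add: m_assoc)
  next
    case (X_Coef s)
    then show ?case by (simp add: m_assoc)
  next
    case (Y_Coef s)
    then show ?case by (simp add: m_assoc)
  next
    case X_Y
    then show ?case unfolding assms(5) by (simp add: m_ac)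
  next
    case Y_X
    then show ?case unfolding assms(5) by (simp add: m_ac)
  qed (simp_all add: cl a_ac r_neg)
qed

lemma div_module_left_module:
  fixes R (structure)
  assumes "domain R" "\<sigma> \<in> ring_iso R R" "a \<in> carrier R" "a \<noteq> \<zero>\<^bsub>R\<^esub>"
    "p \<in> carrier R" "c \<in> carrier R" "a = p \<otimes>\<^bsub>R\<^esub> c"
  shows "cofactor R a p = c"
    "t \<in> gwa_terms R \<Longrightarrow> r \<in> carrier R \<Longrightarrow>
      gwa_class R \<sigma> a t \<odot>\<^bsub>div_module R \<sigma> a p\<^esub> r = div_act R \<sigma> p (\<sigma> c) t r"
    "left_module (gwa R \<sigma> a) (div_module R \<sigma> a p)"
proof -
  interpret domain R by fact
  have "p \<noteq> \<zero>" using assms by auto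
  then show cof: "cofactor R a p = c"
    unfolding cofactor_def using assms(5-) by (intro the_equality) (auto simp: m_lcancel)
  note df = div_act_facts[OF assms(1,2,5,6,7)]
  show act: "gwa_class R \<sigma> a t \<odot>\<^bsub>div_module R \<sigma> a p\<^esub> r = div_act R \<sigma> p (\<sigma> c) t r"
    if "t \<in> gwa_terms R" "r \<in> carrier R" for t r
  proof -
    have "(\<lambda>t. div_act R \<sigma> p (\<sigma> c) t r) ` gwa_class R \<sigma> a t = {div_act R \<sigma> p (\<sigma> c) t r}"
      using that df(3)[of t] gwa_cong.refl[OF that(1)] by (force simp: gwa_class_def)
    then show ?thesis by (simp add: div_module_def cof)
  qed
  have gc: "carrier (gwa R \<sigma> a) = gwa_class R \<sigma> a ` gwa_terms R" "\<one>\<^bsub>gwa R \<sigma> a\<^esub> = gwa_class R \<sigma> a (GCoef \<one>)"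
    by (auto simp: gwa_def)
  have vc: "carrier (div_module R \<sigma> a p) = carrier R" "add (div_module R \<sigma> a p) = add R" 
    "\<zero>\<^bsub>div_module R \<sigma> a p\<^esub> = \<zero>"
    by (auto simp: div_module_def)
  have ag: "abelian_group (div_module R \<sigma> a p)"
  proof (rule abelian_groupI)
    fix x assume "x \<in> carrier (div_module R \<sigma> a p)"
    then show "\<exists>y\<in>carrier (div_module R \<sigma> a p).
        y \<oplus>\<^bsub>div_module R \<sigma> a p\<^esub> x = \<zero>\<^bsub>div_module R \<sigma> a p\<^esub>"
      using l_neg a_inv_closed unfolding vc by blast
  qed (simp_all add: vc a_ac)
  show "left_module (gwa R \<sigma> a) (div_module R \<sigma> a p)"
    by (intro left_module.intro gwa_ring[OF ring_axioms] ag left_module_axioms.intro)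
       (auto simp: gc vc act df gwa_add_class gwa_mult_class gwa_terms_intros)
qed

end

theory Submission
  imports Defs
begin

text \<open>
  A nonzero submodule of $V_p$ is a principal ideal $(s)$ with $s \mid \sigma^{-1}(s) p$ and
  $s \mid \sigma(s) q$. Since all orbits of irreducibles are infinite, $s$ is coprime to its far
  translates, and iterating these divisibilities shows that $s$ divides a nonzero $d$ that does not
  depend on $s$. Hence the intersection of all nonzero submodules is nonzero and is the socle, $V_p$
  has finite length, and every composition factor above the socle is killed by $d$. A simple module
  killed by a nonzero element of $R$ has a weight vector, so it is the sum of its weight spaces, which
  live at the finitely many maximal ideals containing that element. The socle $(s)$ is isomorphic to
  $V_{p'}$ with $p' s = \sigma^{-1}(s) p$, and has no weight vectors as $R$ is a domain.

  Conversely, a simple weight module with finite support contains a weight vector killed by $y$, of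
  weight $(p)$ say. Then $p$ divides $a$, and suitable multiples of the images of this vector under
  powers of $x$ add up to a vector $w \neq 0$ with $x w = p w$ and $y w = q w$, so that
  $r \mapsto r w$ maps $V_p$ onto the module.
\<close>

section \<open>Left modules: submodules, quotients and composition series\<close>

text \<open>The delicate point is uniformity. The index from which the translates of s are coprime
  to s depends on s, whereas d has to serve every submodule at once. Only p and q are fixed, so d is
  taken as the product of the first N translates of q, starting with q itself, where N is an index
  from which all \<sigma>^k(q) are coprime to p. Infinite orbits enter only through the fact that no
  positive power of \<sigma> maps an irreducible element to an associate of itself. Coprimality is
  used in Bezout form, u r + v s = 1: automorphisms carry it along, and it acts on any module, where
  a vector killed by both r and s is zero and r acts injectively on the vectors killed by s. In part
  (a) any given composition series is analysed where it stands: its first nonzero term is always the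
  intersection of all nonzero submodules, so the socle is the factor at index 0, and every later
  term contains d. In part (b) the irreducible generator p of the weight divides a because a v = x y
  v = 0.\<close>

context left_module
begin

lemma smult_zero_right [simp]: "r \<in> carrier R \<Longrightarrow> r \<odot>\<^bsub>M\<^esub> \<zero>\<^bsub>M\<^esub> = \<zero>\<^bsub>M\<^esub>"
  using smult_r_distr[of r "\<zero>\<^bsub>M\<^esub>" "\<zero>\<^bsub>M\<^esub>"] by (simp add: M.add.l_cancel_one')

lemma smult_zero_left [simp]: "v \<in> carrier M \<Longrightarrow> \<zero> \<odot>\<^bsub>M\<^esub> v = \<zero>\<^bsub>M\<^esub>"
  using smult_l_distr[of "\<zero>" "\<zero>" v] by (simp add: M.add.l_cancel_one')

lemma smult_minus_right:
  assumes "r \<in> carrier R" "v \<in> carrier M"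
  shows "r \<odot>\<^bsub>M\<^esub> (\<ominus>\<^bsub>M\<^esub> v) = \<ominus>\<^bsub>M\<^esub> (r \<odot>\<^bsub>M\<^esub> v)"
proof -
  have "r \<odot>\<^bsub>M\<^esub> (\<ominus>\<^bsub>M\<^esub> v) \<oplus>\<^bsub>M\<^esub> r \<odot>\<^bsub>M\<^esub> v = \<zero>\<^bsub>M\<^esub>"
    using assms by (simp add: smult_r_distr[symmetric] M.l_neg)
  then show ?thesis using assms by (simp add: M.minus_equality)
qed

lemma smult_minus_left:
  assumes "r \<in> carrier R" "v \<in> carrier M"
  shows "(\<ominus> r) \<odot>\<^bsub>M\<^esub> v = \<ominus>\<^bsub>M\<^esub> (r \<odot>\<^bsub>M\<^esub> v)"
proof -
  have "(\<ominus> r) \<odot>\<^bsub>M\<^esub> v \<oplus>\<^bsub>M\<^esub> r \<odot>\<^bsub>M\<^esub> v = \<zero>\<^bsub>M\<^esub>"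
    using assms by (simp add: smult_l_distr[symmetric] R.l_neg)
  then show ?thesis using assms by (simp add: M.minus_equality)
qed

lemma submodule_criterion:
  assumes "N \<subseteq> carrier M" "\<zero>\<^bsub>M\<^esub> \<in> N"
    and "\<And>v w. \<lbrakk>v \<in> N; w \<in> N\<rbrakk> \<Longrightarrow> v \<oplus>\<^bsub>M\<^esub> w \<in> N"
    and sm: "\<And>r v. \<lbrakk>r \<in> carrier R; v \<in> N\<rbrakk> \<Longrightarrow> r \<odot>\<^bsub>M\<^esub> v \<in> N"
  shows "submodule N R M"
proof (intro submodule.intro subgroup.intro submodule_axioms.intro)
  fix v assume "v \<in> N"
  then have "\<ominus>\<^bsub>M\<^esub> v = (\<ominus> \<one>) \<odot>\<^bsub>M\<^esub> v" using assms(1) by (simp add: smult_minus_left subset_iff)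
  then show "inv\<^bsub>add_monoid M\<^esub> v \<in> N"
    using sm[OF _ \<open>v \<in> N\<close>, of "\<ominus> \<one>"] by (simp add: a_inv_def)
qed (use assms in auto)

lemma carrier_submodule: "submodule (carrier M) R M"
  by (rule submodule_criterion) auto

lemma zero_submodule: "submodule {\<zero>\<^bsub>M\<^esub>} R M"
  by (rule submodule_criterion) auto

end

lemma submoduleD:
  assumes "left_module A M" "submodule N A M"
  shows "N \<subseteq> carrier M" "\<zero>\<^bsub>M\<^esub> \<in> N"
    and "\<And>v w. \<lbrakk>v \<in> N; w \<in> N\<rbrakk> \<Longrightarrow> v \<oplus>\<^bsub>M\<^esub> w \<in> N"
    and "\<And>r v. \<lbrakk>r \<in> carrier A; v \<in> N\<rbrakk> \<Longrightarrow> r \<odot>\<^bsub>M\<^esub> v \<in> N"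
    and "\<And>v. v \<in> N \<Longrightarrow> \<ominus>\<^bsub>M\<^esub> v \<in> N"
proof -
  interpret submodule N A M by fact
  show "N \<subseteq> carrier M" "\<zero>\<^bsub>M\<^esub> \<in> N" "\<And>v w. \<lbrakk>v \<in> N; w \<in> N\<rbrakk> \<Longrightarrow> v \<oplus>\<^bsub>M\<^esub> w \<in> N"
    "\<And>r v. \<lbrakk>r \<in> carrier A; v \<in> N\<rbrakk> \<Longrightarrow> r \<odot>\<^bsub>M\<^esub> v \<in> N" "\<And>v. v \<in> N \<Longrightarrow> \<ominus>\<^bsub>M\<^esub> v \<in> N"
    using subset one_closed m_closed m_inv_closed by (auto simp: a_inv_def)
qed

text \<open>Equational axioms survive under a surjection that preserves the operations, and zero and
  inverses are images as well. Applied to the map from \<open>M\<close> onto its cosets, this makes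
  the quotient a module.\<close>

lemma left_module_image:
  assumes "left_module A M" and onto: "f ` carrier M = carrier Q"
    and f_zero: "f \<zero>\<^bsub>M\<^esub> = \<zero>\<^bsub>Q\<^esub>"
    and add: "\<And>v w. \<lbrakk>v \<in> carrier M; w \<in> carrier M\<rbrakk> \<Longrightarrow> f (v \<oplus>\<^bsub>M\<^esub> w) = f v \<oplus>\<^bsub>Q\<^esub> f w"
    and smult: "\<And>r v. \<lbrakk>r \<in> carrier A; v \<in> carrier M\<rbrakk> \<Longrightarrow> f (r \<odot>\<^bsub>M\<^esub> v) = r \<odot>\<^bsub>Q\<^esub> f v"
  shows "left_module A Q"
proof -
  interpret left_module A M by fact
  have el: "\<exists>v\<in>carrier M. x = f v" if "x \<in> carrier Q" for x using that onto by blast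
  have cl: "f v \<in> carrier Q" if "v \<in> carrier M" for v using that onto by blast
  note rw = add[symmetric] smult[symmetric] f_zero[symmetric]
  have ag: "abelian_group Q"
  proof (rule abelian_groupI)
    fix x assume "x \<in> carrier Q"
    then obtain v where v: "v \<in> carrier M" "x = f v" using el by blast
    then have "f (\<ominus>\<^bsub>M\<^esub> v) \<oplus>\<^bsub>Q\<^esub> x = \<zero>\<^bsub>Q\<^esub>" by (simp add: rw M.l_neg)
    then show "\<exists>y\<in>carrier Q. y \<oplus>\<^bsub>Q\<^esub> x = \<zero>\<^bsub>Q\<^esub>" using cl v by blast
  next
    fix x y assume "x \<in> carrier Q" "y \<in> carrier Q"
    then obtain v w where "v \<in> carrier M" "x = f v" "w \<in> carrier M" "y = f w" using el by meson
    then show "x \<oplus>\<^bsub>Q\<^esub> y \<in> carrier Q" "x \<oplus>\<^bsub>Q\<^esub> y = y \<oplus>\<^bsub>Q\<^esub> x"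
      by (simp_all add: rw cl M.a_comm)
  next
    fix x y z assume "x \<in> carrier Q" "y \<in> carrier Q" "z \<in> carrier Q"
    then obtain v w u where "v \<in> carrier M" "x = f v" "w \<in> carrier M" "y = f w"
      "u \<in> carrier M" "z = f u" using el by meson
    then show "x \<oplus>\<^bsub>Q\<^esub> y \<oplus>\<^bsub>Q\<^esub> z = x \<oplus>\<^bsub>Q\<^esub> (y \<oplus>\<^bsub>Q\<^esub> z)" by (simp add: rw M.a_assoc)
  next
    fix x assume "x \<in> carrier Q"
    then obtain v where "v \<in> carrier M" "x = f v" using el by blast
    then show "\<zero>\<^bsub>Q\<^esub> \<oplus>\<^bsub>Q\<^esub> x = x" by (simp add: rw)
  next
    show "\<zero>\<^bsub>Q\<^esub> \<in> carrier Q" using cl[of "\<zero>\<^bsub>M\<^esub>"] f_zero by simp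
  qed
  show ?thesis
  proof (intro left_module.intro R.ring_axioms ag left_module_axioms.intro)
    fix r v assume "r \<in> carrier A" "v \<in> carrier Q"
    moreover from this obtain w where "w \<in> carrier M" "v = f w" using el by blast
    ultimately show "r \<odot>\<^bsub>Q\<^esub> v \<in> carrier Q" by (simp add: rw cl)
  next
    fix r s v assume *: "r \<in> carrier A" "s \<in> carrier A" "v \<in> carrier Q"
    then obtain w where "w \<in> carrier M" "v = f w" using el by blast
    then show "(r \<oplus>\<^bsub>A\<^esub> s) \<odot>\<^bsub>Q\<^esub> v = r \<odot>\<^bsub>Q\<^esub> v \<oplus>\<^bsub>Q\<^esub> s \<odot>\<^bsub>Q\<^esub> v"
      "(r \<otimes>\<^bsub>A\<^esub> s) \<odot>\<^bsub>Q\<^esub> v = r \<odot>\<^bsub>Q\<^esub> (s \<odot>\<^bsub>Q\<^esub> v)"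
      using * by (simp_all add: rw smult_l_distr smult_assoc1)
  next
    fix r v w assume *: "r \<in> carrier A" "v \<in> carrier Q" "w \<in> carrier Q"
    then obtain v' w' where "v' \<in> carrier M" "v = f v'" "w' \<in> carrier M" "w = f w'"
      using el by meson
    then show "r \<odot>\<^bsub>Q\<^esub> (v \<oplus>\<^bsub>Q\<^esub> w) = r \<odot>\<^bsub>Q\<^esub> v \<oplus>\<^bsub>Q\<^esub> r \<odot>\<^bsub>Q\<^esub> w"
      using * by (simp add: rw smult_r_distr)
  next
    fix v assume "v \<in> carrier Q"
    then obtain w where "w \<in> carrier M" "v = f w" using el by blast
    then show "\<one>\<^bsub>A\<^esub> \<odot>\<^bsub>Q\<^esub> v = v" by (simp add: rw)
  qed
qed

lemma left_module_restrict:
  assumes "left_module A M" "submodule N A M"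
  shows "left_module A (M\<lparr>carrier := N\<rparr>)"
proof -
  interpret left_module A M by fact
  note sD = submoduleD[OF assms]
  have cM: "v \<in> carrier M" if "v \<in> N" for v using that sD(1) by blast
  have "abelian_group (M\<lparr>carrier := N\<rparr>)"
  proof (rule abelian_groupI)
    fix x assume "x \<in> carrier (M\<lparr>carrier := N\<rparr>)"
    then show "\<exists>y\<in>carrier (M\<lparr>carrier := N\<rparr>).
        y \<oplus>\<^bsub>M\<lparr>carrier := N\<rparr>\<^esub> x = \<zero>\<^bsub>M\<lparr>carrier := N\<rparr>\<^esub>"
      using sD(5) cM by (auto intro!: bexI[of _ "\<ominus>\<^bsub>M\<^esub> x"] M.l_neg)
  qed (use sD cM in \<open>auto simp: M.a_ac\<close>)
  then show ?thesis
    by (intro left_module.intro R.ring_axioms left_module_axioms.intro)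
      (use sD cM in \<open>auto simp: smult_l_distr smult_r_distr smult_assoc1\<close>)
qed

lemma submodule_restrict_iff:
  assumes "left_module A M" "submodule N A M"
  shows "submodule K A (M\<lparr>carrier := N\<rparr>) \<longleftrightarrow> submodule K A M \<and> K \<subseteq> N"
proof
  interpret left_module A M by fact
  note r = left_module_restrict[OF assms]
  { assume "submodule K A (M\<lparr>carrier := N\<rparr>)"
    from submoduleD[OF r this] show "submodule K A M \<and> K \<subseteq> N"
      using submoduleD(1)[OF assms] by (auto intro!: submodule_criterion) }
  { assume "submodule K A M \<and> K \<subseteq> N"
    then show "submodule K A (M\<lparr>carrier := N\<rparr>)"
      using submoduleD[OF assms(1), of K] by (auto intro!: left_module.submodule_criterion[OF r]) }
qed

lemma simple_module_restrict_iff: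
  assumes "left_module A M" "submodule N A M"
  shows "simple_module A (M\<lparr>carrier := N\<rparr>) \<longleftrightarrow>
    N \<noteq> {\<zero>\<^bsub>M\<^esub>} \<and> (\<forall>K. submodule K A M \<and> K \<subseteq> N \<longrightarrow> K = {\<zero>\<^bsub>M\<^esub>} \<or> K = N)"
  using left_module_restrict[OF assms] submodule_restrict_iff[OF assms]
  by (simp add: simple_module_def)

text \<open>The preimage of an arbitrary submodule \<open>K\<close> is taken, with the kernel as the
  case of zero, because submodules of a quotient have to be pulled back too.\<close>

lemma kernel_submodule:
  assumes "left_module A M" "left_module A L"
    and f: "\<And>v. v \<in> carrier M \<Longrightarrow> f v \<in> carrier L"
    and add: "\<And>v w. \<lbrakk>v \<in> carrier M; w \<in> carrier M\<rbrakk> \<Longrightarrow> f (v \<oplus>\<^bsub>M\<^esub> w) = f v \<oplus>\<^bsub>L\<^esub> f w"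
    and smult: "\<And>r v. \<lbrakk>r \<in> carrier A; v \<in> carrier M\<rbrakk> \<Longrightarrow> f (r \<odot>\<^bsub>M\<^esub> v) = r \<odot>\<^bsub>L\<^esub> f v"
    and K: "submodule K A L"
  shows "submodule {v \<in> carrier M. f v \<in> K} A M"
proof -
  interpret M: left_module A M by fact
  interpret L: left_module A L by fact
  note KD = submoduleD[OF assms(2) K]
  have "f \<zero>\<^bsub>M\<^esub> = \<zero>\<^bsub>L\<^esub>"
    using add[of "\<zero>\<^bsub>M\<^esub>" "\<zero>\<^bsub>M\<^esub>"] f[of "\<zero>\<^bsub>M\<^esub>"] by (simp add: L.M.add.l_cancel_one')
  then show ?thesis
    by (intro M.submodule_criterion) (use KD in \<open>auto simp: add smult\<close>)
qed

lemma image_submodule: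
  assumes "left_module A M" "left_module A L"
    and f: "\<And>v. v \<in> carrier M \<Longrightarrow> f v \<in> carrier L"
    and add: "\<And>v w. \<lbrakk>v \<in> carrier M; w \<in> carrier M\<rbrakk> \<Longrightarrow> f (v \<oplus>\<^bsub>M\<^esub> w) = f v \<oplus>\<^bsub>L\<^esub> f w"
    and smult: "\<And>r v. \<lbrakk>r \<in> carrier A; v \<in> carrier M\<rbrakk> \<Longrightarrow> f (r \<odot>\<^bsub>M\<^esub> v) = r \<odot>\<^bsub>L\<^esub> f v"
  shows "submodule (f ` carrier M) A L"
proof -
  interpret M: left_module A M by fact
  interpret L: left_module A L by fact
  have "f \<zero>\<^bsub>M\<^esub> = \<zero>\<^bsub>L\<^esub>"
    using add[of "\<zero>\<^bsub>M\<^esub>" "\<zero>\<^bsub>M\<^esub>"] f[of "\<zero>\<^bsub>M\<^esub>"] by (simp add: L.M.add.l_cancel_one')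
  then have "\<zero>\<^bsub>L\<^esub> \<in> f ` carrier M" using M.M.zero_closed by (metis imageI)
  then show ?thesis
    by (intro L.submodule_criterion) (use f in \<open>auto simp: add[symmetric] smult[symmetric]\<close>)
qed

section \<open>Quotient modules and the first isomorphism theorem\<close>

context
  fixes A :: "('a, 'k) ring_scheme" and M :: "('a, 'b) module" and N :: "'b set"
  assumes M: "left_module A M" and N: "submodule N A M"
begin

interpretation M: left_module A M by (rule M)

interpretation N: abelian_subgroup N M
  by (rule abelian_subgroupI3)
    (use N M.abelian_group_axioms in \<open>auto intro!: additive_subgroup.intro simp: submodule_def\<close>)

lemma quot_carrier: "carrier (quot_module M N) = (\<lambda>v. N +>\<^bsub>M\<^esub> v) ` carrier M"
  by (auto simp: quot_module_def A_RCOSETS_def')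

lemma quot_zero: "\<zero>\<^bsub>quot_module M N\<^esub> = N"
  by (simp add: quot_module_def)

lemma quot_zero_coset: "N +>\<^bsub>M\<^esub> \<zero>\<^bsub>M\<^esub> = N"
  by (rule N.a_rcos_const[OF submoduleD(2)[OF M N]])

lemma quot_eq_zero_iff: "v \<in> carrier M \<Longrightarrow> N +>\<^bsub>M\<^esub> v = N \<longleftrightarrow> v \<in> N"
  using N.a_rcos_self[of v] N.a_rcos_const[of v] by auto

lemma quot_add:
  "\<lbrakk>v \<in> carrier M; w \<in> carrier M\<rbrakk>
    \<Longrightarrow> (N +>\<^bsub>M\<^esub> v) \<oplus>\<^bsub>quot_module M N\<^esub> (N +>\<^bsub>M\<^esub> w) = N +>\<^bsub>M\<^esub> (v \<oplus>\<^bsub>M\<^esub> w)"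
  by (simp add: quot_module_def N.a_rcos_sum)

text \<open>In \<open>quot_module\<close> the scalar product is a union over all representatives of
  the coset. Two representatives differ by some \<open>n\<close> in \<open>N\<close>, and
  \<open>N\<close> absorbs \<open>r n\<close>, so the union collapses to one coset.\<close>

lemma quot_smult:
  assumes "r \<in> carrier A" "v \<in> carrier M"
  shows "r \<odot>\<^bsub>quot_module M N\<^esub> (N +>\<^bsub>M\<^esub> v) = N +>\<^bsub>M\<^esub> (r \<odot>\<^bsub>M\<^esub> v)"
proof -
  have "N +>\<^bsub>M\<^esub> (r \<odot>\<^bsub>M\<^esub> u) = N +>\<^bsub>M\<^esub> (r \<odot>\<^bsub>M\<^esub> v)" if u: "u \<in> N +>\<^bsub>M\<^esub> v" for u
  proof -
    obtain n where n: "n \<in> N" "u = n \<oplus>\<^bsub>M\<^esub> v" using u by (auto simp: a_r_coset_def')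
    have "n \<in> carrier M" using n(1) submoduleD(1)[OF M N] by blast
    with n assms have "r \<odot>\<^bsub>M\<^esub> u = r \<odot>\<^bsub>M\<^esub> n \<oplus>\<^bsub>M\<^esub> r \<odot>\<^bsub>M\<^esub> v" by (simp add: M.smult_r_distr)
    moreover have "r \<odot>\<^bsub>M\<^esub> n \<in> N" using n(1) assms submoduleD(4)[OF M N] by blast
    ultimately have "r \<odot>\<^bsub>M\<^esub> u \<in> N +>\<^bsub>M\<^esub> (r \<odot>\<^bsub>M\<^esub> v)" unfolding a_r_coset_def' by blast
    then show ?thesis
      using N.a_repr_independence'[of "r \<odot>\<^bsub>M\<^esub> u" "r \<odot>\<^bsub>M\<^esub> v"] assms by simp
  qed
  then have "(\<Union>u\<in>N +>\<^bsub>M\<^esub> v. N +>\<^bsub>M\<^esub> (r \<odot>\<^bsub>M\<^esub> u)) = (\<Union>u\<in>N +>\<^bsub>M\<^esub> v. N +>\<^bsub>M\<^esub> (r \<odot>\<^bsub>M\<^esub> v))"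
    by (rule SUP_cong[OF HOL.refl])
  also have "\<dots> = N +>\<^bsub>M\<^esub> (r \<odot>\<^bsub>M\<^esub> v)" using N.a_rcos_self[OF assms(2)] by blast
  finally show ?thesis by (simp add: quot_module_def)
qed

lemma quot_left_module: "left_module A (quot_module M N)"
  by (rule left_module_image[OF M, where f = "\<lambda>v. N +>\<^bsub>M\<^esub> v"])
    (simp_all add: quot_carrier quot_zero quot_zero_coset quot_add quot_smult)

text \<open>Preimages match the submodules of the quotient with those between \<open>N\<close> and
  the whole module, of which \<open>max\<close> leaves only two.\<close>

lemma simple_quot_module:
  assumes "N \<noteq> carrier M"
    and max: "\<And>K. \<lbrakk>submodule K A M; N \<subseteq> K\<rbrakk> \<Longrightarrow> K = N \<or> K = carrier M"
  shows "simple_module A (quot_module M N)"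
  unfolding simple_module_def
proof (intro conjI allI impI)
  let ?Q = "quot_module M N"
  show "left_module A ?Q" by (rule quot_left_module)
  obtain v where "v \<in> carrier M" "v \<notin> N" using assms(1) submoduleD(1)[OF M N] by blast
  then have "N +>\<^bsub>M\<^esub> v \<in> carrier ?Q" "N +>\<^bsub>M\<^esub> v \<noteq> N"
    by (simp_all add: quot_carrier quot_eq_zero_iff)
  then show "carrier ?Q \<noteq> {\<zero>\<^bsub>?Q\<^esub>}" unfolding quot_zero by blast
  fix K assume K: "submodule K A ?Q"
  note KD = submoduleD[OF quot_left_module K]
  let ?K = "{v \<in> carrier M. N +>\<^bsub>M\<^esub> v \<in> K}"
  have "submodule ?K A M"
    by (rule kernel_submodule[OF M quot_left_module _ _ _ K])
      (simp_all add: quot_carrier quot_add quot_smult)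
  moreover have "N \<subseteq> ?K"
  proof
    fix v assume "v \<in> N"
    then have "v \<in> carrier M" using submoduleD(1)[OF M N] by blast
    with \<open>v \<in> N\<close> have "N +>\<^bsub>M\<^esub> v = N" using quot_eq_zero_iff by blast
    then show "v \<in> ?K" using KD(2) \<open>v \<in> carrier M\<close> by (simp add: quot_zero)
  qed
  ultimately consider "?K = N" | "?K = carrier M" using max by blast
  then show "K = {\<zero>\<^bsub>?Q\<^esub>} \<or> K = carrier ?Q"
  proof cases
    case 1
    have "C = N" if C: "C \<in> K" for C
    proof -
      obtain v where v: "v \<in> carrier M" "C = N +>\<^bsub>M\<^esub> v"
        using subsetD[OF KD(1) C] unfolding quot_carrier by (elim imageE)
      then have "v \<in> ?K" using that by simp
      then show ?thesis unfolding 1 using v quot_eq_zero_iff by simp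
    qed
    then have "K \<subseteq> {\<zero>\<^bsub>?Q\<^esub>}" unfolding quot_zero by blast
    then show ?thesis using KD(2) by blast
  next
    case 2
    then have "carrier ?Q \<subseteq> K" unfolding quot_carrier by blast
    then show ?thesis using KD(1) by blast
  qed
qed

text \<open>First isomorphism theorem, directed from \<open>L\<close> to the quotient because
  \<open>composition_factor\<close> asks for an isomorphism in that direction.\<close>

lemma quot_module_iso:
  assumes L: "left_module A L" and onto: "f ` carrier M = carrier L"
    and add: "\<And>v w. \<lbrakk>v \<in> carrier M; w \<in> carrier M\<rbrakk> \<Longrightarrow> f (v \<oplus>\<^bsub>M\<^esub> w) = f v \<oplus>\<^bsub>L\<^esub> f w"
    and smult: "\<And>r v. \<lbrakk>r \<in> carrier A; v \<in> carrier M\<rbrakk> \<Longrightarrow> f (r \<odot>\<^bsub>M\<^esub> v) = r \<odot>\<^bsub>L\<^esub> f v"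
    and ker: "\<And>v. v \<in> carrier M \<Longrightarrow> f v = \<zero>\<^bsub>L\<^esub> \<longleftrightarrow> v \<in> N"
  shows "module_iso A L (quot_module M N)"
proof -
  interpret L: left_module A L by fact
  have f: "f v \<in> carrier L" if "v \<in> carrier M" for v using that onto by blast
  have fz: "f \<zero>\<^bsub>M\<^esub> = \<zero>\<^bsub>L\<^esub>" using ker submoduleD(2)[OF M N] by simp
  have fi: "f (\<ominus>\<^bsub>M\<^esub> v) = \<ominus>\<^bsub>L\<^esub> f v" if "v \<in> carrier M" for v
  proof -
    have "f (\<ominus>\<^bsub>M\<^esub> v) \<oplus>\<^bsub>L\<^esub> f v = \<zero>\<^bsub>L\<^esub>" using that add[of "\<ominus>\<^bsub>M\<^esub> v" v] fz by (simp add: M.M.l_neg)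
    then show ?thesis using that f by (simp add: L.M.minus_equality)
  qed
  have eq: "N +>\<^bsub>M\<^esub> v = N +>\<^bsub>M\<^esub> w \<longleftrightarrow> f v = f w" if "v \<in> carrier M" "w \<in> carrier M" for v w
  proof -
    have "N +>\<^bsub>M\<^esub> v = N +>\<^bsub>M\<^esub> w \<longleftrightarrow> v \<oplus>\<^bsub>M\<^esub> \<ominus>\<^bsub>M\<^esub> w \<in> N"
      using that N.a_rcos_module N.a_repr_independence' N.a_rcos_self by metis
    also have "\<dots> \<longleftrightarrow> f v \<oplus>\<^bsub>L\<^esub> \<ominus>\<^bsub>L\<^esub> f w = \<zero>\<^bsub>L\<^esub>"
      using that by (simp add: ker[symmetric] add fi)
    also have "\<dots> \<longleftrightarrow> f v = f w"
      using that f L.M.minus_equality[of "f v" "\<ominus>\<^bsub>L\<^esub> f w"] by (auto simp: L.M.r_neg)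
    finally show ?thesis .
  qed
  \<comment> \<open>The inverse of the induced map: any preimage of \<open>x\<close> may be chosen,
    since by \<open>eq\<close> its coset depends on \<open>x\<close> alone.\<close>
  define g where "g x = N +>\<^bsub>M\<^esub> (SOME v. v \<in> carrier M \<and> f v = x)" for x
  have g: "g (f v) = N +>\<^bsub>M\<^esub> v" if "v \<in> carrier M" for v
    unfolding g_def by (rule someI2[of _ v]) (use that eq in auto)
  have el: "\<exists>v\<in>carrier M. x = f v" if "x \<in> carrier L" for x using that onto by blast
  have "bij_betw g (carrier L) (carrier (quot_module M N))"
  proof (rule bij_betw_imageI)
    show "inj_on g (carrier L)"
    proof (rule inj_onI)
      fix x y assume xy: "x \<in> carrier L" "y \<in> carrier L" "g x = g y"
      obtain v w where "v \<in> carrier M" "x = f v" "w \<in> carrier M" "y = f w" using xy el by meson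
      then show "x = y" using xy by (simp add: g eq)
    qed
    show "g ` carrier L = carrier (quot_module M N)"
      unfolding quot_carrier onto[symmetric] image_image using g by simp
  qed
  moreover have "g (x \<oplus>\<^bsub>L\<^esub> y) = g x \<oplus>\<^bsub>quot_module M N\<^esub> g y"
    if xy: "x \<in> carrier L" "y \<in> carrier L" for x y
  proof -
    obtain v w where "v \<in> carrier M" "x = f v" "w \<in> carrier M" "y = f w" using xy el by meson
    then show ?thesis by (simp add: g add[symmetric] quot_add)
  qed
  moreover have "g (r \<odot>\<^bsub>L\<^esub> x) = r \<odot>\<^bsub>quot_module M N\<^esub> g x"
    if rx: "r \<in> carrier A" "x \<in> carrier L" for r x
  proof -
    obtain v where "v \<in> carrier M" "x = f v" using rx el by meson
    then show ?thesis using rx by (simp add: g smult[symmetric] quot_smult)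
  qed
  ultimately show ?thesis unfolding module_iso_def by blast
qed

end

lemma module_iso_sym:
  assumes "left_module A M" "module_iso A M N"
  shows "module_iso A N M"
proof -
  interpret left_module A M by fact
  obtain f where f: "bij_betw f (carrier M) (carrier N)"
    and add: "\<And>v w. \<lbrakk>v \<in> carrier M; w \<in> carrier M\<rbrakk> \<Longrightarrow> f (v \<oplus>\<^bsub>M\<^esub> w) = f v \<oplus>\<^bsub>N\<^esub> f w"
    and sm: "\<And>r v. \<lbrakk>r \<in> carrier A; v \<in> carrier M\<rbrakk> \<Longrightarrow> f (r \<odot>\<^bsub>M\<^esub> v) = r \<odot>\<^bsub>N\<^esub> f v"
    using assms(2) unfolding module_iso_def by blast
  let ?g = "inv_into (carrier M) f"
  have el: "\<exists>v\<in>carrier M. x = f v" if "x \<in> carrier N" for x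
    using f that by (auto simp: bij_betw_def)
  have g: "?g (f v) = v" if "v \<in> carrier M" for v using f that by (simp add: bij_betw_inv_into_left)
  have "?g (x \<oplus>\<^bsub>N\<^esub> y) = ?g x \<oplus>\<^bsub>M\<^esub> ?g y" if xy: "x \<in> carrier N" "y \<in> carrier N" for x y
  proof -
    obtain v w where "v \<in> carrier M" "x = f v" "w \<in> carrier M" "y = f w" using xy el by meson
    then show ?thesis by (simp add: g add[symmetric])
  qed
  moreover have "?g (r \<odot>\<^bsub>N\<^esub> x) = r \<odot>\<^bsub>M\<^esub> ?g x"
    if rx: "r \<in> carrier A" "x \<in> carrier N" for r x
  proof -
    obtain v where "v \<in> carrier M" "x = f v" using rx el by meson
    then show ?thesis using rx by (simp add: g sm[symmetric])
  qed
  ultimately show ?thesis unfolding module_iso_def using bij_betw_inv_into[OF f] by blast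
qed

text \<open>A submodule above the kernel has image zero or \<open>L\<close>. In the first case it
  lies in the kernel; in the second it meets every fibre and, containing the kernel, is
  everything.\<close>

lemma simple_module_kernel:
  fixes M :: "('a, 'b) module"
  assumes "left_module A M" "simple_module A L"
    and onto: "f ` carrier M = carrier L"
    and add: "\<And>v w. \<lbrakk>v \<in> carrier M; w \<in> carrier M\<rbrakk> \<Longrightarrow> f (v \<oplus>\<^bsub>M\<^esub> w) = f v \<oplus>\<^bsub>L\<^esub> f w"
    and smult: "\<And>r v. \<lbrakk>r \<in> carrier A; v \<in> carrier M\<rbrakk> \<Longrightarrow> f (r \<odot>\<^bsub>M\<^esub> v) = r \<odot>\<^bsub>L\<^esub> f v"
  defines "K \<equiv> {v \<in> carrier M. f v = \<zero>\<^bsub>L\<^esub>}"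
  shows "submodule K A M" "module_iso A L (quot_module M K)" "simple_module A (quot_module M K)"
proof -
  have L: "left_module A L" using assms(2) by (simp add: simple_module_def)
  interpret M: left_module A M by fact
  interpret L: left_module A L by fact
  have f: "f v \<in> carrier L" if "v \<in> carrier M" for v using that onto by blast
  have K: "submodule K A M"
    using kernel_submodule[OF assms(1) L f add smult L.zero_submodule] by (simp add: K_def)
  then show "submodule K A M" .
  show "module_iso A L (quot_module M K)"
    by (rule quot_module_iso[OF assms(1) K L onto add smult]) (auto simp: K_def)
  show "simple_module A (quot_module M K)"
  proof (rule simple_quot_module[OF assms(1) K])
    show "K \<noteq> carrier M"
    proof
      assume "K = carrier M"
      then have "f ` carrier M \<subseteq> {\<zero>\<^bsub>L\<^esub>}" by (auto simp: K_def)
      then show False using assms(2) onto L.M.zero_closed by (auto simp: simple_module_def)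
    qed
    fix N assume N: "submodule N A M" "K \<subseteq> N"
    note ND = submoduleD[OF assms(1) N(1)]
    have c: "v \<in> carrier M" if "v \<in> N" for v using that ND(1) by blast
    have "submodule (f ` carrier (M\<lparr>carrier := N\<rparr>)) A L"
      by (rule image_submodule[OF left_module_restrict[OF assms(1) N(1)] L])
        (auto simp: add smult c f)
    then consider "f ` N = {\<zero>\<^bsub>L\<^esub>}" | "f ` N = carrier L"
      using assms(2) by (auto simp: simple_module_def)
    then show "N = K \<or> N = carrier M"
    proof cases
      case 1
      then have "N \<subseteq> K" using c by (auto simp: K_def)
      then show ?thesis using N(2) by blast
    next
      case 2
      have "v \<in> N" if v: "v \<in> carrier M" for v
      proof -
        obtain n where n: "n \<in> N" "f v = f n" using 2 f[OF v] by (metis imageE)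
        have "f (v \<oplus>\<^bsub>M\<^esub> \<ominus>\<^bsub>M\<^esub> n) \<oplus>\<^bsub>L\<^esub> f n = f v"
          using v c[OF n(1)] add[of "v \<oplus>\<^bsub>M\<^esub> \<ominus>\<^bsub>M\<^esub> n" n, symmetric] by (simp add: M.M.a_assoc M.M.l_neg)
        then have "f (v \<oplus>\<^bsub>M\<^esub> \<ominus>\<^bsub>M\<^esub> n) = \<zero>\<^bsub>L\<^esub>"
          using n(2) v c[OF n(1)] f by (simp add: L.M.add.r_cancel_one)
        then have "v \<oplus>\<^bsub>M\<^esub> \<ominus>\<^bsub>M\<^esub> n \<in> N" using N(2) v c[OF n(1)] by (auto simp: K_def)
        then have "v \<oplus>\<^bsub>M\<^esub> \<ominus>\<^bsub>M\<^esub> n \<oplus>\<^bsub>M\<^esub> n \<in> N" using n(1) ND(3) by blast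
        then show ?thesis using v c[OF n(1)] by (simp add: M.M.a_assoc M.M.l_neg)
      qed
      then show ?thesis using ND(1) by blast
    qed
  qed
qed

text \<open>A composition series of a submodule \<open>N\<close>, kept inside \<open>M\<close>.
  Letting the last term vary gives the invariant for building a series from below; the whole carrier
  gives back \<open>composition_series\<close>.\<close>

definition series_upto :: "('a, 'k) ring_scheme \<Rightarrow> ('a, 'b) module \<Rightarrow> 'b set \<Rightarrow> 'b set list \<Rightarrow> bool"
  where "series_upto A M N Ns \<longleftrightarrow>
    Ns \<noteq> [] \<and> hd Ns = {\<zero>\<^bsub>M\<^esub>} \<and> last Ns = N \<and> (\<forall>K\<in>set Ns. submodule K A M)
    \<and> (\<forall>i. Suc i < length Ns \<longrightarrow>
          Ns ! i \<subseteq> Ns ! Suc i \<and> simple_module A (series_factor M Ns i))"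

lemma composition_series_iff: "composition_series A M Ns \<longleftrightarrow> series_upto A M (carrier M) Ns"
  by (simp add: composition_series_def series_upto_def)

text \<open>The second conclusion locates the new factor: \<open>K\<close> ended the old list, so it
  sits at index \<open>length Ns - 1\<close>, and \<open>N\<close> comes right after it. A
  composition factor has to be exhibited with its index.\<close>

lemma series_upto_snoc:
  assumes Ns: "series_upto A M K Ns" and "submodule N A M" "K \<subseteq> N"
    and "simple_module A (quot_module (M\<lparr>carrier := N\<rparr>) K)"
  shows "series_upto A M N (Ns @ [N])"
    "series_factor M (Ns @ [N]) (length Ns - 1) = quot_module (M\<lparr>carrier := N\<rparr>) K"
proof -
  have ne: "Ns \<noteq> []" and last: "Ns ! (length Ns - 1) = K"
    using Ns by (auto simp: series_upto_def last_conv_nth)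
  show *: "series_factor M (Ns @ [N]) (length Ns - 1) = quot_module (M\<lparr>carrier := N\<rparr>) K"
    using ne last by (simp add: series_factor_def nth_append)
  have "(Ns @ [N]) ! i \<subseteq> (Ns @ [N]) ! Suc i \<and> simple_module A (series_factor M (Ns @ [N]) i)"
    if i: "Suc i < length (Ns @ [N])" for i
  proof (cases "Suc i < length Ns")
    case True
    then show ?thesis using Ns by (simp add: series_upto_def series_factor_def nth_append)
  next
    case False
    then have "i = length Ns - 1" using i by simp
    then show ?thesis using * assms(3,4) last ne by (simp add: nth_append)
  qed
  then show "series_upto A M N (Ns @ [N])"
    using Ns assms(2) by (simp add: series_upto_def)
qed

text \<open>A strictly increasing natural-valued measure stands for finite length. Among the proper
  submodules of \<open>N\<close> one has largest measure, as all are bounded by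
  \<open>\<mu> N\<close>, and it is maximal; the series below it comes from induction on the
  measure.\<close>

lemma series_upto_exists:
  fixes \<mu> :: "'b set \<Rightarrow> nat"
  assumes M: "left_module A (M :: ('a, 'b) module)"
    and \<mu>: "\<And>K N. \<lbrakk>submodule K A M; submodule N A M; K \<subset> N\<rbrakk> \<Longrightarrow> \<mu> K < \<mu> N"
    and "submodule N A M"
  shows "\<exists>Ns. series_upto A M N Ns"
  using assms(3)
proof (induction "\<mu> N" arbitrary: N rule: less_induct)
  case less
  interpret left_module A M by fact
  let ?P = "\<lambda>K. submodule K A M \<and> K \<subset> N"
  show ?case
  proof (cases "N = {\<zero>\<^bsub>M\<^esub>}")
    case True
    then show ?thesis using less.prems by (intro exI[of _ "[N]"]) (simp add: series_upto_def)
  next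
    case False
    then have "?P {\<zero>\<^bsub>M\<^esub>}" using zero_submodule submoduleD(2)[OF M less.prems] by auto
    moreover have "\<forall>K. ?P K \<longrightarrow> \<mu> K < \<mu> N" using \<mu> less.prems by blast
    ultimately obtain K where K: "?P K" "\<And>K'. ?P K' \<Longrightarrow> \<mu> K' \<le> \<mu> K"
      using ex_has_greatest_nat[of ?P _ \<mu> "\<mu> N"] by (metis less_imp_le)
    have "simple_module A (quot_module (M\<lparr>carrier := N\<rparr>) K)"
    proof (rule simple_quot_module)
      show "left_module A (M\<lparr>carrier := N\<rparr>)" by (rule left_module_restrict[OF M less.prems])
      show "submodule K A (M\<lparr>carrier := N\<rparr>)"
        using K(1) by (simp add: submodule_restrict_iff[OF M less.prems] less_le)
      show "K \<noteq> carrier (M\<lparr>carrier := N\<rparr>)" using K(1) by auto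
      fix K' assume "submodule K' A (M\<lparr>carrier := N\<rparr>)" "K \<subseteq> K'"
      then show "K' = K \<or> K' = carrier (M\<lparr>carrier := N\<rparr>)"
        using K(1) K(2)[of K'] \<mu>[of K K']
        by (cases "K = K'") (auto simp: submodule_restrict_iff[OF M less.prems] psubset_eq dest: leD)
    qed
    moreover obtain Ns where "series_upto A M K Ns" using less.hyps[of K] K(1) \<mu> less.prems by blast
    ultimately show ?thesis using series_upto_snoc(1) less.prems K(1) by blast
  qed
qed

section \<open>Automorphisms of principal ideal domains\<close>

context domain
begin

lemma ring_aut_closed [intro]: "\<lbrakk>f \<in> ring_iso R R; x \<in> carrier R\<rbrakk> \<Longrightarrow> f x \<in> carrier R"
  by (auto simp: ring_iso_def intro: ring_hom_closed)

lemma ring_aut_mult: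
  "\<lbrakk>f \<in> ring_iso R R; x \<in> carrier R; y \<in> carrier R\<rbrakk> \<Longrightarrow> f (x \<otimes> y) = f x \<otimes> f y"
  by (auto simp: ring_iso_def intro: ring_hom_mult)

lemma ring_aut_add:
  "\<lbrakk>f \<in> ring_iso R R; x \<in> carrier R; y \<in> carrier R\<rbrakk> \<Longrightarrow> f (x \<oplus> y) = f x \<oplus> f y"
  by (auto simp: ring_iso_def intro: ring_hom_add)

lemma ring_aut_one: "f \<in> ring_iso R R \<Longrightarrow> f \<one> = \<one>"
  by (auto simp: ring_iso_def intro: ring_hom_one)

lemma ring_aut_zero: "f \<in> ring_iso R R \<Longrightarrow> f \<zero> = \<zero>"
  using ring_hom_zero[of f R R] ring_axioms by (auto simp: ring_iso_def)

lemma ring_aut_inv: "f \<in> ring_iso R R \<Longrightarrow> inv_into (carrier R) f \<in> ring_iso R R"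
  by (rule ring_iso_set_sym[OF ring_axioms])

lemma ring_aut_inv_left: "\<lbrakk>f \<in> ring_iso R R; x \<in> carrier R\<rbrakk> \<Longrightarrow> inv_into (carrier R) f (f x) = x"
  by (auto simp: ring_iso_def bij_betw_inv_into_left)

lemma ring_aut_inv_right: "\<lbrakk>f \<in> ring_iso R R; x \<in> carrier R\<rbrakk> \<Longrightarrow> f (inv_into (carrier R) f x) = x"
  by (auto simp: ring_iso_def bij_betw_inv_into_right)

lemma ring_aut_eq_iff:
  "\<lbrakk>f \<in> ring_iso R R; x \<in> carrier R; y \<in> carrier R\<rbrakk> \<Longrightarrow> f x = f y \<longleftrightarrow> x = y"
  using ring_aut_inv_left by metis

lemma ring_aut_eq_zero_iff: "\<lbrakk>f \<in> ring_iso R R; x \<in> carrier R\<rbrakk> \<Longrightarrow> f x = \<zero> \<longleftrightarrow> x = \<zero>"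
  using ring_aut_eq_iff[of f x \<zero>] ring_aut_zero[of f] by auto

lemma ring_aut_funpow: "f \<in> ring_iso R R \<Longrightarrow> f ^^ k \<in> ring_iso R R"
proof (induction k)
  case (Suc k)
  then show ?case using ring_iso_set_trans[of "f ^^ k" R R f R] by (simp add: comp_def)
qed (use ring_iso_set_refl in \<open>simp add: id_def[symmetric]\<close>)

lemma ring_aut_divides:
  assumes "f \<in> ring_iso R R" "x \<in> carrier R" "y \<in> carrier R" "x divides y"
  shows "f x divides f y"
proof -
  obtain c where "c \<in> carrier R" "y = x \<otimes> c" using assms(4) by (auto simp: factor_def)
  then show ?thesis using assms by (auto simp: ring_aut_mult factor_def ring_aut_closed)
qed

lemma ring_aut_Units: "\<lbrakk>f \<in> ring_iso R R; x \<in> Units R\<rbrakk> \<Longrightarrow> f x \<in> Units R"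
  unfolding Units_def by (auto simp: ring_aut_closed) (metis ring_aut_mult ring_aut_closed ring_aut_one)

lemma ring_aut_irreducible:
  assumes f: "f \<in> ring_iso R R" and p: "p \<in> carrier R" "ring_irreducible p"
  shows "ring_irreducible (f p)"
proof (rule ring_irreducibleI)
  let ?g = "inv_into (carrier R) f"
  note g = ring_aut_inv[OF f] and irr = ring_irreducibleE[OF p]
  note inv = ring_aut_inv_left[OF f] ring_aut_inv_right[OF f]
  show "f p \<in> carrier R - {\<zero>}" using f p irr(1) by (auto simp: ring_aut_eq_zero_iff)
  show "f p \<notin> Units R" using ring_aut_Units[OF g, of "f p"] irr(4) p inv by auto
  fix a b assume ab: "a \<in> carrier R" "b \<in> carrier R" "f p = a \<otimes> b"
  then have "p = ?g a \<otimes> ?g b" using g p inv(1) by (metis ring_aut_mult)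
  then have "?g a \<in> Units R \<or> ?g b \<in> Units R"
    using irr(5)[of "?g a" "?g b"] ab p g inv by (auto simp: ring_aut_closed)
  then show "a \<in> Units R \<or> b \<in> Units R"
    using ring_aut_Units[OF f] inv ab by metis
qed

section \<open>Comaximal elements: coprimality recorded by Bezout coefficients\<close>

definition comaximal :: "'a \<Rightarrow> 'a \<Rightarrow> bool"
  where "comaximal x y \<longleftrightarrow> (\<exists>u\<in>carrier R. \<exists>v\<in>carrier R. u \<otimes> x \<oplus> v \<otimes> y = \<one>)"

lemma comaximalI: "\<lbrakk>u \<in> carrier R; v \<in> carrier R; u \<otimes> x \<oplus> v \<otimes> y = \<one>\<rbrakk> \<Longrightarrow> comaximal x y"
  by (auto simp: comaximal_def)

lemma comaximal_sym: "\<lbrakk>x \<in> carrier R; y \<in> carrier R; comaximal x y\<rbrakk> \<Longrightarrow> comaximal y x"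
  unfolding comaximal_def by (metis a_comm m_closed)

lemma comaximal_unit: 
  assumes "x \<in> Units R" "y \<in> carrier R"
  shows "comaximal x y"
  using assms by (intro comaximalI[of "inv x" \<zero>]) auto

lemma comaximal_aut:
  assumes f: "f \<in> ring_iso R R" and "x \<in> carrier R" "y \<in> carrier R" "comaximal x y"
  shows "comaximal (f x) (f y)"
proof -
  obtain u v where uv: "u \<in> carrier R" "v \<in> carrier R" "u \<otimes> x \<oplus> v \<otimes> y = \<one>"
    using assms(4) by (auto simp: comaximal_def)
  have "f (u \<otimes> x \<oplus> v \<otimes> y) = \<one>" unfolding uv(3) using f by (rule ring_aut_one)
  then have "f u \<otimes> f x \<oplus> f v \<otimes> f y = \<one>" using uv(1,2) assms by (simp add: ring_aut_mult ring_aut_add)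
  then show ?thesis using uv(1,2) f by (intro comaximalI[of "f u" "f v"]) auto
qed

text \<open>Insert one Bezout identity into the other: 1 = u x (u' y + v' z) + v z.\<close>

lemma comaximal_mult:
  assumes c: "x \<in> carrier R" "y \<in> carrier R" "z \<in> carrier R"
    and "comaximal x z" "comaximal y z"
  shows "comaximal (x \<otimes> y) z"
proof -
  obtain u v u' v' where uv: "u \<in> carrier R" "v \<in> carrier R" "u \<otimes> x \<oplus> v \<otimes> z = \<one>"
    "u' \<in> carrier R" "v' \<in> carrier R" "u' \<otimes> y \<oplus> v' \<otimes> z = \<one>"
    using assms by (auto simp: comaximal_def)
  have "(u \<otimes> u') \<otimes> (x \<otimes> y) \<oplus> (u \<otimes> x \<otimes> v' \<oplus> v) \<otimes> z = u \<otimes> x \<otimes> (u' \<otimes> y \<oplus> v' \<otimes> z) \<oplus> v \<otimes> z"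
    using uv(1,2,4,5) c by (simp add: l_distr r_distr m_ac a_ac)
  also have "\<dots> = \<one>" using uv c by simp
  finally show ?thesis
    using uv c by (intro comaximalI[of "u \<otimes> u'" "u \<otimes> x \<otimes> v' \<oplus> v"]) auto
qed

lemma comaximal_divides:
  assumes "x \<in> carrier R" "y \<in> carrier R" "z \<in> carrier R" "comaximal x z" "y divides x"
  shows "comaximal y z"
proof -
  obtain u v where uv: "u \<in> carrier R" "v \<in> carrier R" "u \<otimes> x \<oplus> v \<otimes> z = \<one>"
    using assms(4) by (auto simp: comaximal_def)
  obtain c where "c \<in> carrier R" "x = y \<otimes> c" using assms(5) by (auto simp: factor_def)
  then show ?thesis using uv assms by (intro comaximalI[of "u \<otimes> c" v]) (auto simp: m_ac)
qed

text \<open>Euclid's lemma: expand y = y (u x + v z), where both summands are multiples of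
  \<open>x\<close>.\<close>

lemma divides_of_comaximal:
  assumes c: "x \<in> carrier R" "y \<in> carrier R" "z \<in> carrier R"
    and "comaximal x z" "x divides y \<otimes> z"
  shows "x divides y"
proof -
  obtain u v where uv: "u \<in> carrier R" "v \<in> carrier R" "u \<otimes> x \<oplus> v \<otimes> z = \<one>"
    using assms(4) by (auto simp: comaximal_def)
  obtain w where w: "w \<in> carrier R" "y \<otimes> z = x \<otimes> w" using assms(5) by (auto simp: factor_def)
  have "y = y \<otimes> (u \<otimes> x \<oplus> v \<otimes> z)" using uv c by simp
  also have "\<dots> = x \<otimes> (y \<otimes> u) \<oplus> v \<otimes> (y \<otimes> z)" using uv(1,2) c by (simp add: r_distr m_ac)
  also have "\<dots> = x \<otimes> (y \<otimes> u \<oplus> v \<otimes> w)" unfolding w(2) using uv(1,2) c w(1) by (simp add: r_distr m_ac)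
  finally show ?thesis using uv(1,2) c w(1) by (auto intro!: dividesI[of "y \<otimes> u \<oplus> v \<otimes> w"])
qed

text \<open>This is q f(q) ... f^(k-1)(q), the factor that accumulates when a generator acts k times
  on $V_p$: y^k r is \<sigma>^k(r) times the product for \<sigma> and q, and x^k r is
  \<sigma>^(-k)(r) times the product for the inverse of \<sigma> and p.\<close>

primrec orbit_prod :: "('a \<Rightarrow> 'a) \<Rightarrow> 'a \<Rightarrow> nat \<Rightarrow> 'a"
where
  "orbit_prod f q 0 = \<one>"
| "orbit_prod f q (Suc k) = orbit_prod f q k \<otimes> (f ^^ k) q"

lemma orbit_prod_closed: "\<lbrakk>f \<in> ring_iso R R; q \<in> carrier R\<rbrakk> \<Longrightarrow> orbit_prod f q k \<in> carrier R"
  by (induction k) (auto dest: ring_aut_funpow)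

lemma orbit_prod_nonzero:
  "\<lbrakk>f \<in> ring_iso R R; q \<in> carrier R; q \<noteq> \<zero>\<rbrakk> \<Longrightarrow> orbit_prod f q k \<noteq> \<zero>"
  by (induction k)
    (auto simp: integral_iff orbit_prod_closed ring_aut_closed[OF ring_aut_funpow] 
      ring_aut_eq_zero_iff[OF ring_aut_funpow])

text \<open>Applying \<open>f ^^ k\<close> to the hypothesis shows that f^k(s) divides f^(k+1)(s)
  f^k(q). Multiplied by the product of length k, this leads from step k to step k + 1.\<close>

lemma divides_orbit_prod:
  assumes f: "f \<in> ring_iso R R" and c: "s \<in> carrier R" "q \<in> carrier R" and "s divides f s \<otimes> q"
  shows "s divides (f ^^ k) s \<otimes> orbit_prod f q k"
proof (induction k)
  case 0
  then show ?case using c by simp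
next
  case (Suc k)
  let ?f = "f ^^ k"
  note fk = ring_aut_funpow[OF f, of k]
  have "?f s divides ?f (f s \<otimes> q)" using assms by (intro ring_aut_divides[OF fk]) auto
  then have "?f s divides (f ^^ Suc k) s \<otimes> ?f q"
    using c f fk by (simp add: ring_aut_mult ring_aut_closed funpow_swap1)
  then obtain d where d: "d \<in> carrier R" "(f ^^ Suc k) s \<otimes> ?f q = ?f s \<otimes> d"
    by (auto simp: factor_def)
  have cl: "(f ^^ Suc k) s \<in> carrier R" "?f q \<in> carrier R" "?f s \<in> carrier R"
    "orbit_prod f q k \<in> carrier R"
    using ring_aut_closed[OF ring_aut_funpow[OF f]] orbit_prod_closed[OF f] c by blast+
  have "(f ^^ Suc k) s \<otimes> orbit_prod f q (Suc k) = (f ^^ Suc k) s \<otimes> ?f q \<otimes> orbit_prod f q k"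
    using cl by (simp only: orbit_prod.simps m_ac m_closed)
  also have "\<dots> = ?f s \<otimes> orbit_prod f q k \<otimes> d"
    unfolding d(2) using cl d(1) by (simp only: m_ac m_closed)
  finally have "?f s \<otimes> orbit_prod f q k divides (f ^^ Suc k) s \<otimes> orbit_prod f q (Suc k)"
    using d(1) by (rule dividesI[rotated])
  then show ?case using divides_trans[OF Suc] c(1) by blast
qed

lemma comaximal_orbit_prod:
  assumes "f \<in> ring_iso R R" "q \<in> carrier R" "z \<in> carrier R"
    and "\<And>j. j < k \<Longrightarrow> comaximal ((f ^^ j) q) z"
  shows "comaximal (orbit_prod f q k) z"
  using assms(4)
proof (induction k)
  case 0
  then show ?case using assms(3) by (auto intro: comaximal_unit)
next
  case (Suc k)
  then show ?case
    using assms(1-3) by (auto intro!: comaximal_mult orbit_prod_closed ring_aut_closed[OF ring_aut_funpow])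
qed

text \<open>Euclid's lemma strips off the factors of index at least \<open>n\<close>, one at a time
  from the end.\<close>

lemma divides_orbit_prod_truncate:
  assumes "f \<in> ring_iso R R" "q \<in> carrier R" "s \<in> carrier R"
    and "\<And>j. j \<ge> n \<Longrightarrow> comaximal s ((f ^^ j) q)" "s divides orbit_prod f q (n + k)"
  shows "s divides orbit_prod f q n"
  using assms(5)
proof (induction k)
  case (Suc k)
  then have "s divides orbit_prod f q (n + k)"
    using divides_of_comaximal[of s "orbit_prod f q (n + k)" "(f ^^ (n + k)) q"] assms(1-4)
    by (auto intro!: orbit_prod_closed ring_aut_closed[OF ring_aut_funpow])
  then show ?case by (rule Suc.IH)
qed simp

end

section \<open>Irreducible factors and maximal ideals in a principal ideal domain\<close>

context principal_domain
begin

text \<open>Induction on the number of irreducible factors. This count belongs to the monoid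
  \<open>mult_of R\<close> of nonzero elements, so proper divisibility is moved there before the
  induction hypothesis applies.\<close>

lemma irreducible_induct [consumes 2, case_names unit mult]:
  assumes "b \<in> carrier R" "b \<noteq> \<zero>"
    and unit: "\<And>u. u \<in> Units R \<Longrightarrow> P u"
    and mult: "\<And>p b. \<lbrakk>p \<in> carrier R; ring_irreducible p; b \<in> carrier R; b \<noteq> \<zero>; P b\<rbrakk> \<Longrightarrow> P (p \<otimes> b)"
  shows "P b"
  using assms(1,2)
proof (induction "factorcount (mult_of R) b" arbitrary: b rule: less_induct)
  case less
  show ?case
  proof (cases "b \<in> Units R")
    case False
    then obtain p where p: "p \<in> carrier R" "ring_irreducible p" "p divides b"
      using exists_irreducible_divisor less.prems by (metis Diff_iff singletonD)
    then obtain c where c: "c \<in> carrier R" "b = p \<otimes> c" by (auto simp: factor_def)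
    note irr = ring_irreducibleE[OF p(1,2)]
    have c0: "c \<noteq> \<zero>" using c less.prems p(1) by auto
    \<comment> \<open>Otherwise cancelling \<open>c\<close> in c = p c d would make \<open>p\<close>
      a unit.\<close>
    have "\<not> b divides c"
    proof
      assume "b divides c"
      then obtain d where d: "d \<in> carrier R" "c = p \<otimes> c \<otimes> d" using c(2) by (auto simp: factor_def)
      then have "c \<otimes> (p \<otimes> d) = c \<otimes> \<one>" using p(1) c(1) by (simp add: m_ac)
      then have "p \<otimes> d = \<one>" using c(1) c0 p(1) d(1) m_lcancel by (metis m_closed one_closed)
      then have "p \<in> Units R" using p(1) d(1) m_comm by (auto simp: Units_def)
      then show False using irr(4) by blast
    qed
    moreover have "c divides b" unfolding c(2) using c(1) p(1) by (intro dividesI[of p]) (auto simp: m_comm)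
    ultimately have "properfactor R c b" by (simp add: properfactor_def)
    then have "properfactor (mult_of R) c b"
      using c c0 less.prems properfactor_imp_properfactor_mult by auto
    then have "factorcount (mult_of R) c < factorcount (mult_of R) b"
      using c c0 less.prems by (intro mult_of.properfactor_fcount) auto
    then show ?thesis using less.hyps[OF _ c(1) c0] mult p c c0 by blast
  qed (rule unit)
qed

text \<open>The ideal I + (r) is strictly larger than \<open>I\<close>, hence the whole ring, and
  contains 1.\<close>

lemma maximalideal_comaximal:
  assumes "maximalideal I R" "r \<in> carrier R" "r \<notin> I"
  shows "\<exists>m\<in>I. \<exists>u\<in>carrier R. m \<oplus> u \<otimes> r = \<one>"
proof -
  interpret I: maximalideal I R by fact
  have "ideal (I <+>\<^bsub>R\<^esub> PIdl r) R" using I.is_ideal cgenideal_ideal[OF assms(2)] by (rule add_ideals)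
  moreover have "I \<subseteq> I <+>\<^bsub>R\<^esub> PIdl r"
  proof
    fix m assume "m \<in> I"
    moreover have "\<zero> \<in> PIdl r" using assms(2) by (auto simp: cgenideal_def intro!: exI[of _ \<zero>])
    moreover have "m = m \<oplus> \<zero>" using \<open>m \<in> I\<close> I.a_Hcarr by simp
    ultimately show "m \<in> I <+>\<^bsub>R\<^esub> PIdl r" unfolding set_add_def' by blast
  qed
  moreover have "I <+>\<^bsub>R\<^esub> PIdl r \<subseteq> carrier R" using calculation(1) by (simp add: ideal.Icarr subsetI)
  ultimately have "I <+>\<^bsub>R\<^esub> PIdl r = I \<or> I <+>\<^bsub>R\<^esub> PIdl r = carrier R" by (rule I.I_maximal)
  moreover have "r \<in> I <+>\<^bsub>R\<^esub> PIdl r"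
  proof -
    have "r = \<zero> \<oplus> r" using assms(2) by simp
    then show ?thesis using I.zero_closed cgenideal_self[OF assms(2)] unfolding set_add_def' by blast
  qed
  ultimately have "\<one> \<in> I <+>\<^bsub>R\<^esub> PIdl r" using assms(3) by auto
  then obtain m x where "m \<in> I" "x \<in> PIdl r" "\<one> = m \<oplus> x" unfolding set_add_def' by blast
  moreover from this obtain u where "u \<in> carrier R" "x = u \<otimes> r" by (auto simp: cgenideal_def)
  ultimately show ?thesis by metis
qed

text \<open>A generator of a maximal ideal is prime, hence irreducible, once it is nonzero; the zero
  ideal is maximal only in a field.\<close>

lemma maximalideal_iff_irreducible:
  assumes "\<not> field R"
  shows "maximalideal I R \<longleftrightarrow> (\<exists>p\<in>carrier R. ring_irreducible p \<and> I = PIdl p)"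
proof
  assume I: "maximalideal I R"
  then interpret maximalideal I R .
  obtain p where p: "p \<in> carrier R" "I = PIdl p" using exists_gen[OF is_ideal] by blast
  have "p \<noteq> \<zero>"
  proof
    assume "p = \<zero>"
    then have "I = {\<zero>}" using p cgenideal_eq_genideal[of \<zero>] genideal_zero by simp
    then show False using I zeromaximalideal_eq_field assms by auto
  qed
  moreover have "primeideal I R" by (rule maximalideal_prime[OF I])
  ultimately have "ring_prime p" using primeideal_iff_prime p by simp
  then have "ring_irreducible p" using primeness_condition[OF p(1)] by blast
  then show "\<exists>p\<in>carrier R. ring_irreducible p \<and> I = PIdl p" using p by blast
qed (use irreducible_imp_maximalideal in blast)

lemma comaximal_irreducible:
  assumes "p \<in> carrier R" "ring_irreducible p" "r \<in> carrier R" "\<not> p divides r"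
  shows "comaximal p r"
proof -
  have "r \<notin> PIdl p"
    using assms by (auto simp: cgenideal_def factor_def m_comm)
  then obtain m u where "m \<in> PIdl p" "u \<in> carrier R" "m \<oplus> u \<otimes> r = \<one>"
    using maximalideal_comaximal irreducible_imp_maximalideal assms by meson
  then show ?thesis by (auto simp: cgenideal_def intro: comaximalI)
qed

text \<open>A maximal ideal containing p b is prime, so it contains \<open>b\<close>, or it contains
  \<open>p\<close> and then equals (p): each irreducible factor contributes at most one
  ideal.\<close>

lemma finite_maximal_ideals:
  assumes "\<not> field R" "b \<in> carrier R" "b \<noteq> \<zero>"
  shows "finite {I. maximalideal I R \<and> b \<in> I}"
  using assms(2,3)
proof (induction b rule: irreducible_induct)
  case (unit u)
  have "u \<notin> I" if I: "maximalideal I R" for I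
  proof
    interpret maximalideal I R by (rule I)
    assume "u \<in> I"
    then have "inv u \<otimes> u \<in> I" using unit I_l_closed by blast
    then show False using unit one_imp_carrier I_notcarr by simp
  qed
  then have "{I. maximalideal I R \<and> u \<in> I} = {}" by blast
  then show ?case by (metis finite.emptyI)
next
  case (mult p b)
  have "{I. maximalideal I R \<and> p \<otimes> b \<in> I} \<subseteq> insert (PIdl p) {I. maximalideal I R \<and> b \<in> I}"
  proof (rule subsetI, rule insertCI)
    fix I assume "I \<in> {I. maximalideal I R \<and> p \<otimes> b \<in> I}" "I \<notin> {I. maximalideal I R \<and> b \<in> I}"
    then have I: "maximalideal I R" "p \<otimes> b \<in> I" "b \<notin> I" by auto
    interpret maximalideal I R by (rule I(1))
    interpret P: primeideal I R using I(1) by (rule maximalideal_prime)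
    have "p \<in> I" using P.I_prime I mult by blast
    then have "PIdl p \<subseteq> I" by (rule cgenideal_minimal[OF is_ideal])
    moreover have "maximalideal (PIdl p) R" using irreducible_imp_maximalideal mult by blast
    ultimately show "I = PIdl p"
      using maximalideal.I_maximal[of "PIdl p" R I] is_ideal I_notcarr a_subset by blast
  qed
  then show ?case using mult(5) finite_subset by blast
qed

end

section \<open>Infinite orbits and eventual comaximality\<close>

locale gwa_data = principal_domain R for R :: "('r, 'm) ring_scheme" (structure) +
  fixes \<sigma> :: "'r \<Rightarrow> 'r" and a :: 'r
  assumes not_field: "\<not> field R"
    and sigma: "\<sigma> \<in> ring_iso R R"
    and a_closed [simp]: "a \<in> carrier R" and a_nonzero: "a \<noteq> \<zero>"
    and infinite_orbits: "\<forall>C\<in>Defs.Irr R. infinite (Irr_orbit R \<sigma> C)"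
begin

abbreviation \<tau> :: "'r \<Rightarrow> 'r" where "\<tau> \<equiv> inv_into (carrier R) \<sigma>"

lemma tau: "\<tau> \<in> ring_iso R R"
  using sigma by (rule ring_aut_inv)

lemma sigma_closed [simp]: "r \<in> carrier R \<Longrightarrow> \<sigma> r \<in> carrier R"
  and tau_closed [simp]: "r \<in> carrier R \<Longrightarrow> \<tau> r \<in> carrier R"
  and sigma_funpow_closed [simp]: "r \<in> carrier R \<Longrightarrow> (\<sigma> ^^ k) r \<in> carrier R"
  and tau_funpow_closed [simp]: "r \<in> carrier R \<Longrightarrow> (\<tau> ^^ k) r \<in> carrier R"
  using ring_aut_closed sigma tau ring_aut_funpow by blast+

lemma sigma_tau [simp]: "r \<in> carrier R \<Longrightarrow> \<sigma> (\<tau> r) = r"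
  and tau_sigma [simp]: "r \<in> carrier R \<Longrightarrow> \<tau> (\<sigma> r) = r"
  using sigma by (simp_all add: ring_aut_inv_left ring_aut_inv_right)

lemma tau_funpow_sigma [simp]: "r \<in> carrier R \<Longrightarrow> (\<tau> ^^ k) ((\<sigma> ^^ k) r) = r"
  by (induction k arbitrary: r) (simp_all add: funpow_swap1)

lemma sigma_funpow_tau [simp]: "r \<in> carrier R \<Longrightarrow> (\<sigma> ^^ k) ((\<tau> ^^ k) r) = r"
  by (induction k arbitrary: r) (simp_all add: funpow_swap1)

lemma ring_aut_associated:
  "\<lbrakk>f \<in> ring_iso R R; x \<in> carrier R; y \<in> carrier R; x \<sim> y\<rbrakk> \<Longrightarrow> f x \<sim> f y"
  by (auto simp: associated_def ring_aut_divides)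

lemma comaximal_of_not_associated:
  assumes p: "p \<in> carrier R" "ring_irreducible p" and r: "r \<in> carrier R" "ring_irreducible r"
    and "\<not> p \<sim> r"
  shows "comaximal p r"
proof (rule comaximal_irreducible[OF p r(1)])
  show "\<not> p divides r"
  proof
    assume "p divides r"
    then obtain c where c: "c \<in> carrier R" "r = p \<otimes> c" by (auto simp: factor_def)
    then have "c \<in> Units R"
      using ring_irreducibleE(5)[OF r p(1) c] ring_irreducibleE(4)[OF p] by auto
    then have "r \<sim> p" using c(2) p(1) by (intro associatedI2[of c]) auto
    then show False using assms(5) p(1) r(1) by (simp add: associated_sym)
  qed
qed

text \<open>If the n-th power of \<sigma> fixed the class C of \<open>p\<close>, the sets C,
  \<sigma>(C), ..., \<sigma>^(n-1)(C) would be mapped among themselves by \<sigma> and its inverse,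
  so the whole orbit of C would lie in this finite family.\<close>

lemma sigma_funpow_not_associated:
  assumes p: "p \<in> carrier R" "ring_irreducible p" and "n > 0"
  shows "\<not> (\<sigma> ^^ n) p \<sim> p"
proof
  assume per: "(\<sigma> ^^ n) p \<sim> p"
  define C where "C = assocs R p"
  have C: "C = {y \<in> carrier R. y \<sim> p}"
    by (auto simp: C_def eq_closure_of_def elem_def)
  let ?S = "carrier R" and ?s = "restrict \<sigma> (carrier R)"
  let ?G = "BijGroup (carrier R)"
  define F where "F = (\<lambda>j. (\<sigma> ^^ j) ` C) ` {..<n}"
  note sn = ring_aut_funpow[OF sigma, of n] and tn = ring_aut_funpow[OF tau, of n]
  have Cn: "(\<sigma> ^^ n) ` C = C"
  proof (intro equalityI subsetI)
    fix x assume "x \<in> (\<sigma> ^^ n) ` C"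
    then obtain y where y: "y \<in> carrier R" "y \<sim> p" "x = (\<sigma> ^^ n) y" by (auto simp: C)
    then have "x \<sim> (\<sigma> ^^ n) p" using ring_aut_associated[OF sn] p(1) by blast
    then show "x \<in> C" using per associated_trans p y by (simp add: C)
  next
    fix x assume "x \<in> C"
    then have x: "x \<in> carrier R" "x \<sim> p" by (auto simp: C)
    then have "x \<sim> (\<sigma> ^^ n) p"
      using per p(1) by (meson associated_trans associated_sym sigma_funpow_closed)
    then have "(\<tau> ^^ n) x \<sim> p" using ring_aut_associated[OF tn, of x "(\<sigma> ^^ n) p"] x p(1) by simp
    then have "(\<tau> ^^ n) x \<in> C" using x by (simp add: C)
    then show "x \<in> (\<sigma> ^^ n) ` C" using x(1) by (metis imageI sigma_funpow_tau)
  qed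
  have FS: "D \<subseteq> ?S" if "D \<in> F" for D using that by (auto simp: F_def C)
  have F\<sigma>: "\<sigma> ` D \<in> F" if D: "D \<in> F" for D
  proof -
    obtain j where j: "j < n" "D = (\<sigma> ^^ j) ` C" using D by (auto simp: F_def)
    then have eq: "\<sigma> ` D = (\<sigma> ^^ Suc j) ` C" by (auto simp: image_image)
    show ?thesis
    proof (cases "Suc j = n")
      case True
      then have "\<sigma> ` D = (\<sigma> ^^ 0) ` C" using eq Cn by simp
      then show ?thesis using assms(3) unfolding F_def by blast
    next
      case False
      then show ?thesis using eq j(1) unfolding F_def by (metis imageI lessThan_iff Suc_lessI)
    qed
  qed
  have F\<tau>: "\<tau> ` D \<in> F" if D: "D \<in> F" for D
  proof -
    obtain j where "j < n" "D = (\<sigma> ^^ j) ` C" using D by (auto simp: F_def)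
    then obtain m where m: "m < n" "D = (\<sigma> ^^ Suc m) ` C"
    proof (cases j)
      case 0
      obtain k where "n = Suc k" using assms(3) by (cases n) auto
      then show thesis using that[of k] Cn 0 \<open>D = _\<close> by simp
    next
      case (Suc k)
      then show thesis using that[of k] \<open>j < n\<close> \<open>D = _\<close> by simp
    qed
    have "\<tau> ` D = (\<lambda>x. \<tau> (\<sigma> ((\<sigma> ^^ m) x))) ` C" unfolding m(2) by (simp add: image_image)
    also have "\<dots> = (\<sigma> ^^ m) ` C" by (rule image_cong) (auto simp: C)
    finally show ?thesis using m(1) unfolding F_def by blast
  qed
  have sBij: "?s \<in> Bij ?S"
    using sigma by (auto simp: Bij_def ring_iso_def bij_betw_cong[of ?S ?s \<sigma>])
  \<comment> \<open>Membership in \<open>Bij\<close> is carried through the induction because the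
    product of \<open>BijGroup\<close> is composition only between such maps. Restricting \<sigma>
    to the carrier does not change the images of members of \<open>F\<close>, which are subsets of
    the carrier.\<close>
  have "g \<in> Bij ?S \<and> (\<forall>D\<in>F. g ` D \<in> F)" if "g \<in> generate ?G {?s}" for g
    using that
  proof (induction rule: generate.induct)
    case one
    have "(\<lambda>x\<in>?S. x) ` D = D" if "D \<in> F" for D
      using FS[OF that] by (auto simp: image_def subset_iff)
    moreover have "\<one>\<^bsub>?G\<^esub> = (\<lambda>x\<in>?S. x)" by (simp add: BijGroup_def)
    ultimately show ?case using id_Bij[of ?S] by metis
  next
    case (incl h)
    have "?s ` D = \<sigma> ` D" if "D \<in> F" for D
      using FS[OF that] by (intro image_cong) auto
    then show ?case using incl F\<sigma> sBij by (metis singletonD)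
  next
    case (inv h)
    have "inv\<^bsub>?G\<^esub> ?s = (\<lambda>x\<in>?S. inv_into ?S ?s x)" by (rule inv_BijGroup[OF sBij])
    moreover have "inv_into ?S ?s x = \<tau> x" if "x \<in> ?S" for x
      using that sBij by (intro inv_into_f_eq) (auto simp: Bij_def bij_betw_def)
    ultimately have "(inv\<^bsub>?G\<^esub> ?s) ` D = \<tau> ` D" if "D \<in> F" for D
      using FS[OF that] by (intro image_cong) auto
    moreover have "inv\<^bsub>?G\<^esub> ?s \<in> Bij ?S" using inv_BijGroup[OF sBij] restrict_inv_into_Bij[OF sBij] by simp
    ultimately show ?case using inv F\<tau> by (metis singletonD)
  next
    case (eng g h)
    then have "g \<otimes>\<^bsub>?G\<^esub> h = compose ?S g h" by (simp add: BijGroup_def)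
    moreover have "compose ?S g h ` D = g ` (h ` D)" if "D \<in> F" for D
      using FS[OF that] by (auto simp: compose_def image_image subset_iff intro!: image_cong)
    ultimately show ?case using eng compose_Bij by metis
  qed
  moreover have "C \<in> F" using assms(3) unfolding F_def by (intro image_eqI[of _ _ 0]) auto
  ultimately have "Irr_orbit R \<sigma> C \<subseteq> F"
    by (auto simp: Irr_orbit_def Group_Action.orbit_def aut_group_def)
  moreover have "finite F" by (simp add: F_def)
  moreover have "C \<in> Defs.Irr R" using p by (auto simp: Defs.Irr_def C_def)
  ultimately show False using infinite_orbits finite_subset by blast
qed

text \<open>At most one translate of \<open>p\<close> can be an associate of \<open>r\<close>: two
  of them would make a positive power of \<sigma> fix the class of \<open>p\<close>. All later
  translates are comaximal with \<open>r\<close>.\<close>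

lemma eventually_comaximal_irreducible:
  assumes p: "p \<in> carrier R" "ring_irreducible p" and r: "r \<in> carrier R" "ring_irreducible r"
  shows "\<exists>N. \<forall>k\<ge>N. comaximal ((\<sigma> ^^ k) p) r"
proof -
  have irr: "ring_irreducible ((\<sigma> ^^ k) p)" for k
    using ring_aut_irreducible[OF ring_aut_funpow[OF sigma] p] .
  have co: "comaximal ((\<sigma> ^^ k) p) r" if "\<not> (\<sigma> ^^ k) p \<sim> r" for k
    using comaximal_of_not_associated[OF _ irr r that] p(1) by simp
  show ?thesis
  proof (cases "\<exists>m. (\<sigma> ^^ m) p \<sim> r")
    case True
    then obtain m where m: "(\<sigma> ^^ m) p \<sim> r" by blast
    have "\<not> (\<sigma> ^^ k) p \<sim> r" if "k \<ge> Suc m" for k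
    proof
      assume "(\<sigma> ^^ k) p \<sim> r"
      then have "(\<sigma> ^^ k) p \<sim> (\<sigma> ^^ m) p"
        using m p r by (meson associated_trans associated_sym sigma_funpow_closed)
      moreover have "(\<sigma> ^^ k) p = (\<sigma> ^^ m) ((\<sigma> ^^ (k - m)) p)"
        using that by (simp add: funpow_add[unfolded comp_def, THEN fun_cong, symmetric])
      \<comment> \<open>The m-th power of \<open>\<tau>\<close> moves the smaller translate back to
        \<open>p\<close> itself.\<close>
      ultimately have "(\<sigma> ^^ (k - m)) p \<sim> p"
        using ring_aut_associated[OF ring_aut_funpow[OF tau, of m], of "(\<sigma> ^^ k) p" "(\<sigma> ^^ m) p"] p by simp
      then show False using sigma_funpow_not_associated[OF p, of "k - m"] that by simp
    qed
    then show ?thesis using co by blast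
  qed (use co in blast)
qed

text \<open>The last form is the first one at index n + 1, moved by the n-th power of
  \<open>\<tau>\<close>, and so includes n = 0. It serves to cancel \<open>\<sigma> p\<close> on
  vectors killed by a translate of \<open>p\<close>.\<close>

lemma comaximal_translates:
  assumes p: "p \<in> carrier R" "ring_irreducible p"
  shows "n > 0 \<Longrightarrow> comaximal ((\<sigma> ^^ n) p) p"
    and "n > 0 \<Longrightarrow> comaximal p ((\<tau> ^^ n) p)"
    and "comaximal (\<sigma> p) ((\<tau> ^^ n) p)"
proof -
  have *: "comaximal ((\<sigma> ^^ n) p) p" if "n > 0" for n
    using comaximal_of_not_associated[OF _ _ p, of "(\<sigma> ^^ n) p"] that p
      sigma_funpow_not_associated[OF p] ring_aut_irreducible[OF ring_aut_funpow[OF sigma]] by simp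
  then show "n > 0 \<Longrightarrow> comaximal ((\<sigma> ^^ n) p) p" .
  show "n > 0 \<Longrightarrow> comaximal p ((\<tau> ^^ n) p)"
    using comaximal_aut[OF ring_aut_funpow[OF tau, of n] _ p(1) *[of n]] p(1) by simp
  have "comaximal ((\<tau> ^^ n) ((\<sigma> ^^ Suc n) p)) ((\<tau> ^^ n) p)"
    using p by (intro comaximal_aut[OF ring_aut_funpow[OF tau]] *) simp_all
  then show "comaximal (\<sigma> p) ((\<tau> ^^ n) p)" using p by (simp add: funpow_swap1)
qed

text \<open>Comaximal irreducible elements generate different ideals, since an element comaximal
  with itself is a unit. This provides the infinitely many weights that a finite support cannot
  accommodate.\<close>

lemma inj_translates:
  assumes p: "p \<in> carrier R" "ring_irreducible p"
  shows "inj (\<lambda>n. PIdl ((\<sigma> ^^ n) p))" "inj (\<lambda>n. PIdl ((\<tau> ^^ n) p))"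
proof -
  have neq: "PIdl x \<noteq> PIdl y" if x: "x \<in> carrier R" "ring_irreducible x" "y \<in> carrier R" "comaximal x y" for x y
  proof
    assume "PIdl x = PIdl y"
    then have "x divides y" using x to_contain_is_to_divide[of x y] by simp
    moreover have "comaximal y x" using x comaximal_sym by blast
    ultimately have "comaximal x x" using comaximal_divides[of y x x] x by blast
    then obtain u v where uv: "u \<in> carrier R" "v \<in> carrier R" "u \<otimes> x \<oplus> v \<otimes> x = \<one>"
      by (auto simp: comaximal_def)
    then have "\<one> = x \<otimes> (u \<oplus> v)" using x by (simp add: r_distr m_comm)
    then have "x divides \<one>" using uv by (intro dividesI[of "u \<oplus> v"]) auto
    then have "x \<in> Units R" using x(1) divides_one by blast
    then show False using ring_irreducibleE(4)[OF x(1,2)] by blast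
  qed
  have irr: "ring_irreducible ((\<sigma> ^^ n) p)" "ring_irreducible ((\<tau> ^^ n) p)" for n
    using ring_aut_irreducible[OF ring_aut_funpow p] sigma tau by auto
  show "inj (\<lambda>n. PIdl ((\<sigma> ^^ n) p))"
  proof (rule linorder_injI)
    fix i j :: nat assume "i < j"
    then have "comaximal ((\<sigma> ^^ i) ((\<sigma> ^^ (j - i)) p)) ((\<sigma> ^^ i) p)"
      using p by (intro comaximal_aut[OF ring_aut_funpow[OF sigma]] comaximal_translates) simp_all
    moreover have "(\<sigma> ^^ i) ((\<sigma> ^^ (j - i)) p) = (\<sigma> ^^ j) p"
      using \<open>i < j\<close> by (simp add: funpow_add[unfolded comp_def, THEN fun_cong, symmetric])
    ultimately show "PIdl ((\<sigma> ^^ i) p) \<noteq> PIdl ((\<sigma> ^^ j) p)" using neq irr p by (metis sigma_funpow_closed)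
  qed
  show "inj (\<lambda>n. PIdl ((\<tau> ^^ n) p))"
  proof (rule linorder_injI)
    fix i j :: nat assume "i < j"
    then have "comaximal ((\<tau> ^^ i) p) ((\<tau> ^^ i) ((\<tau> ^^ (j - i)) p))"
      using p by (intro comaximal_aut[OF ring_aut_funpow[OF tau]] comaximal_translates) simp_all
    moreover have "(\<tau> ^^ i) ((\<tau> ^^ (j - i)) p) = (\<tau> ^^ j) p"
      using \<open>i < j\<close> by (simp add: funpow_add[unfolded comp_def, THEN fun_cong, symmetric])
    ultimately show "PIdl ((\<tau> ^^ i) p) \<noteq> PIdl ((\<tau> ^^ j) p)" using neq irr p by (metis tau_funpow_closed)
  qed
qed

text \<open>Induction on the factorization of \<open>b\<close>, and inside it on that of
  \<open>c\<close>, down to two irreducible elements. Comaximality is multiplicative on both sides,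
  and the larger of two thresholds serves for a product.\<close>

lemma eventually_comaximal:
  assumes "b \<in> carrier R" "b \<noteq> \<zero>" "c \<in> carrier R" "c \<noteq> \<zero>"
  shows "\<exists>N. \<forall>k\<ge>N. comaximal ((\<sigma> ^^ k) b) c"
  using assms(1,2)
proof (induction b rule: irreducible_induct)
  case (unit u)
  then have "comaximal ((\<sigma> ^^ k) u) c" for k
    using comaximal_unit[OF ring_aut_Units[OF ring_aut_funpow[OF sigma]] assms(3)] by blast
  then show ?case by blast
next
  case (mult p b)
  have "\<exists>N. \<forall>k\<ge>N. comaximal ((\<sigma> ^^ k) p) c"
    using assms(3,4)
  proof (induction c rule: irreducible_induct)
    case (unit u)
    then have "comaximal ((\<sigma> ^^ k) p) u" for k
      using comaximal_sym[OF _ _ comaximal_unit] mult(1) by (simp add: Units_closed)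
    then show ?case by blast
  next
    case (mult r c)
    obtain N1 N2 where N: "\<forall>k\<ge>N1. comaximal ((\<sigma> ^^ k) p) r" "\<forall>k\<ge>N2. comaximal ((\<sigma> ^^ k) p) c"
      using mult eventually_comaximal_irreducible \<open>p \<in> carrier R\<close> \<open>ring_irreducible p\<close> by blast
    have "comaximal ((\<sigma> ^^ k) p) (r \<otimes> c)" if "k \<ge> max N1 N2" for k
    proof -
      let ?p = "(\<sigma> ^^ k) p"
      have p: "?p \<in> carrier R" using \<open>p \<in> carrier R\<close> by simp
      have "comaximal r ?p" "comaximal c ?p"
        using N that mult p comaximal_sym[of ?p] by auto
      then show ?thesis using mult p comaximal_mult[of r c ?p] comaximal_sym[of "r \<otimes> c" ?p] by simp
    qed
    then show ?case by blast
  qed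
  then obtain N1 N2 where N: "\<forall>k\<ge>N1. comaximal ((\<sigma> ^^ k) p) c" "\<forall>k\<ge>N2. comaximal ((\<sigma> ^^ k) b) c"
    using mult by blast
  have "comaximal ((\<sigma> ^^ k) (p \<otimes> b)) c" if "k \<ge> max N1 N2" for k
    using N that mult assms(3) comaximal_mult[of "(\<sigma> ^^ k) p" "(\<sigma> ^^ k) b" c]
    by (simp add: ring_aut_mult[OF ring_aut_funpow[OF sigma]])
  then show ?case by blast
qed

text \<open>
  Iterating the two divisibilities and using that \<open>s\<close> is comaximal with its far translates,
  \<open>s\<close> divides a product of translates of \<open>p\<close> as well as one of translates of \<open>q\<close>. Far
  translates of \<open>p\<close> and \<open>q\<close> being comaximal, the second product can be cut off at an index
  independent of \<open>s\<close>.
\<close>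

lemma uniform_divisor_bound:
  assumes p: "p \<in> carrier R" "p \<noteq> \<zero>" and q: "q \<in> carrier R" "q \<noteq> \<zero>"
  shows "\<exists>d\<in>carrier R. d \<noteq> \<zero> \<and> (\<forall>s\<in>carrier R. s \<noteq> \<zero> \<longrightarrow>
    s divides \<tau> s \<otimes> p \<longrightarrow> s divides \<sigma> s \<otimes> q \<longrightarrow> s divides d)"
proof -
  obtain N where N: "comaximal ((\<sigma> ^^ k) q) p" if "k \<ge> N" for k
    using eventually_comaximal[OF q p] by blast
  let ?Q = "orbit_prod \<sigma> q" and ?P = "orbit_prod \<tau> p"
  have cl: "?Q k \<in> carrier R" "?P k \<in> carrier R" for k
    using orbit_prod_closed sigma tau p q by blast+
  have "s divides ?Q N"
    if s: "s \<in> carrier R" "s \<noteq> \<zero>" "s divides \<tau> s \<otimes> p" "s divides \<sigma> s \<otimes> q" for s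
  proof -
    obtain K where K: "comaximal ((\<sigma> ^^ k) s) s" if "k \<ge> K" for k
      using eventually_comaximal[OF s(1,2) s(1,2)] by blast
    \<comment> \<open>At least \<open>K\<close>, so that \<open>s\<close> is comaximal with its k-th
      translates, and at least \<open>N\<close>, so that the product can be cut back to length
      \<open>N\<close>. The dependence on \<open>s\<close> through \<open>K\<close> disappears with
      the cut.\<close>
    define k where "k = N + K"
    have co: "comaximal ((\<sigma> ^^ k) s) s" by (rule K) (simp add: k_def)
    have "s divides ?Q k \<otimes> (\<sigma> ^^ k) s"
      using divides_orbit_prod[OF sigma s(1) q(1) s(4), of k] m_comm[OF cl(1)[of k], of "(\<sigma> ^^ k) s"] s(1)
      by (simp only: sigma_funpow_closed tau_funpow_closed)
    then have "s divides ?Q k"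
      by (rule divides_of_comaximal[OF s(1) cl(1) sigma_funpow_closed[OF s(1)]
            comaximal_sym[OF sigma_funpow_closed[OF s(1)] s(1) co]])
    have "comaximal s ((\<tau> ^^ k) s)"
      using comaximal_aut[OF ring_aut_funpow[OF tau, of k] _ _ co] s(1) by simp
    moreover have "s divides ?P k \<otimes> (\<tau> ^^ k) s"
      using divides_orbit_prod[OF tau s(1) p(1) s(3), of k] m_comm[OF cl(2)[of k], of "(\<tau> ^^ k) s"] s(1)
      by (simp only: sigma_funpow_closed tau_funpow_closed)
    ultimately have sP: "s divides ?P k"
      using divides_of_comaximal[OF s(1) cl(2)[of k] tau_funpow_closed[OF s(1)]] by blast
    \<comment> \<open>The argument passes through \<open>?P k\<close>, which \<open>s\<close>
      divides: its factors are \<sigma>^(-i)(p), and these are comaximal with \<sigma>^j(q) because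
      \<open>p\<close> is comaximal with \<sigma>^(i+j)(q), where i + j is at least N.\<close>
    have "comaximal s ((\<sigma> ^^ j) q)" if j: "j \<ge> N" for j
    proof (rule comaximal_divides[OF _ _ _ comaximal_orbit_prod[OF tau p(1)] sP])
      fix i
      have "comaximal ((\<tau> ^^ i) ((\<sigma> ^^ (i + j)) q)) ((\<tau> ^^ i) p)"
        using N[of "i + j"] j p q by (intro comaximal_aut[OF ring_aut_funpow[OF tau]]) auto
      then show "comaximal ((\<tau> ^^ i) p) ((\<sigma> ^^ j) q)"
        using p q comaximal_sym[of "(\<sigma> ^^ j) q" "(\<tau> ^^ i) p"] by (simp add: funpow_add)
    qed (use s(1) q(1) cl in auto)
    then show ?thesis
      using divides_orbit_prod_truncate[OF sigma q(1) s(1), of N K] \<open>s divides ?Q k\<close>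
      by (simp add: k_def)
  qed
  then show ?thesis using cl orbit_prod_nonzero[OF sigma q] by blast
qed

end

section \<open>Modules over the generalized Weyl algebra\<close>

context gwa_data
begin

abbreviation "coef r \<equiv> gwa_class R \<sigma> a (GCoef r)"
abbreviation "xgen \<equiv> gwa_class R \<sigma> a GX"
abbreviation "ygen \<equiv> gwa_class R \<sigma> a GY"

lemma gwa_carrier: "carrier (gwa R \<sigma> a) = gwa_class R \<sigma> a ` gwa_terms R"
  by (simp add: gwa_def)

lemma coef_closed [simp]: "r \<in> carrier R \<Longrightarrow> coef r \<in> carrier (gwa R \<sigma> a)"
  and xgen_closed [simp]: "xgen \<in> carrier (gwa R \<sigma> a)"
  and ygen_closed [simp]: "ygen \<in> carrier (gwa R \<sigma> a)"
  by (simp_all add: gwa_carrier gwa_terms_intros)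

text \<open>Both sides are the additive inverse of the class of \<open>t\<close>. Written as a
  product with -1, negation needs no case of its own in \<open>gwa_induct\<close>.\<close>

lemma gwa_class_GNeg:
  assumes "t \<in> gwa_terms R"
  shows "gwa_class R \<sigma> a (GNeg t) = coef (\<ominus> \<one>) \<otimes>\<^bsub>gwa R \<sigma> a\<^esub> gwa_class R \<sigma> a t"
proof -
  interpret A: ring "gwa R \<sigma> a" by (rule gwa_ring[OF ring_axioms])
  let ?t = "gwa_class R \<sigma> a t"
  have t: "?t \<in> carrier (gwa R \<sigma> a)" "gwa_class R \<sigma> a (GNeg t) \<in> carrier (gwa R \<sigma> a)"
    using assms by (simp_all add: gwa_carrier gwa_terms_intros)
  have one: "coef \<one> = \<one>\<^bsub>gwa R \<sigma> a\<^esub>" and zero: "coef \<zero> = \<zero>\<^bsub>gwa R \<sigma> a\<^esub>" by (simp_all add: gwa_def)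
  have "coef (\<ominus> \<one>) \<oplus>\<^bsub>gwa R \<sigma> a\<^esub> coef \<one> = coef (\<ominus> \<one> \<oplus> \<one>)"
    using gwa_cong.Coef_add[of "\<ominus> \<one>" R \<one> \<sigma> a, THEN gwa_class_eqI]
    by (simp add: gwa_add_class gwa_terms_intros)
  then have "coef (\<ominus> \<one>) \<otimes>\<^bsub>gwa R \<sigma> a\<^esub> ?t \<oplus>\<^bsub>gwa R \<sigma> a\<^esub> ?t = \<zero>\<^bsub>gwa R \<sigma> a\<^esub>"
    using A.l_distr[of "coef (\<ominus> \<one>)" "coef \<one>" ?t] t by (simp add: l_neg zero one)
  then have "\<ominus>\<^bsub>gwa R \<sigma> a\<^esub> ?t = coef (\<ominus> \<one>) \<otimes>\<^bsub>gwa R \<sigma> a\<^esub> ?t"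
    using t by (intro A.minus_equality) simp_all
  moreover have "gwa_class R \<sigma> a (GNeg t) \<oplus>\<^bsub>gwa R \<sigma> a\<^esub> ?t = \<zero>\<^bsub>gwa R \<sigma> a\<^esub>"
    using gwa_cong.Add_Neg[OF assms, of \<sigma> a, THEN gwa_class_eqI] assms
    by (simp add: gwa_add_class gwa_terms_intros zero)
  then have "\<ominus>\<^bsub>gwa R \<sigma> a\<^esub> ?t = gwa_class R \<sigma> a (GNeg t)"
    using t by (intro A.minus_equality) simp_all
  ultimately show ?thesis by simp
qed

lemma gwa_induct [consumes 1, case_names coef xgen ygen add mult]:
  assumes x: "x \<in> carrier (gwa R \<sigma> a)"
    and coef: "\<And>r. r \<in> carrier R \<Longrightarrow> P (coef r)" and xgen: "P xgen" and ygen: "P ygen"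
    and add: "\<And>x y. \<lbrakk>x \<in> carrier (gwa R \<sigma> a); y \<in> carrier (gwa R \<sigma> a); P x; P y\<rbrakk>
      \<Longrightarrow> P (x \<oplus>\<^bsub>gwa R \<sigma> a\<^esub> y)"
    and mult: "\<And>x y. \<lbrakk>x \<in> carrier (gwa R \<sigma> a); y \<in> carrier (gwa R \<sigma> a); P x; P y\<rbrakk>
      \<Longrightarrow> P (x \<otimes>\<^bsub>gwa R \<sigma> a\<^esub> y)"
  shows "P x"
proof -
  have "P (gwa_class R \<sigma> a t)" if "t \<in> gwa_terms R" for t
    using that
  proof (induction t)
    case (GCoef r)
    then show ?case by (intro coef) (simp add: gwa_terms_def)
  next
    case (GAdd s t)
    then have st: "s \<in> gwa_terms R" "t \<in> gwa_terms R" by (auto simp: gwa_terms_def)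
    then show ?case
      using add[of "gwa_class R \<sigma> a s" "gwa_class R \<sigma> a t"] GAdd.IH
      by (simp add: gwa_add_class gwa_carrier)
  next
    case (GNeg t)
    then have t: "t \<in> gwa_terms R" by (auto simp: gwa_terms_def)
    then show ?case
      unfolding gwa_class_GNeg[OF t] using GNeg.IH by (intro mult coef) (simp_all add: gwa_carrier gwa_terms_intros)
  next
    case (GMul s t)
    then have st: "s \<in> gwa_terms R" "t \<in> gwa_terms R" by (auto simp: gwa_terms_def)
    then show ?case
      using mult[of "gwa_class R \<sigma> a s" "gwa_class R \<sigma> a t"] GMul.IH
      by (simp add: gwa_mult_class gwa_carrier)
  qed (use xgen ygen in auto)
  then show ?thesis using x by (auto simp: gwa_carrier)
qed

end

locale gwa_module = gwa_data R \<sigma> a + M: left_module "gwa R \<sigma> a" M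
  for R :: "('r, 'm) ring_scheme" (structure) and \<sigma> a
    and M :: "('r gwa_term set, 'v) module"
begin

abbreviation "scal r v \<equiv> coef r \<odot>\<^bsub>M\<^esub> v"
abbreviation "xact v \<equiv> xgen \<odot>\<^bsub>M\<^esub> v"
abbreviation "yact v \<equiv> ygen \<odot>\<^bsub>M\<^esub> v"

lemma scal_one [simp]: "v \<in> carrier M \<Longrightarrow> scal \<one> v = v"
  using M.smult_one[of v] by (simp add: gwa_def)

lemma scal_zero_left [simp]: "v \<in> carrier M \<Longrightarrow> scal \<zero> v = \<zero>\<^bsub>M\<^esub>"
  using M.smult_zero_left[of v] by (simp add: gwa_def)

lemma scal_add_left:
  assumes "r \<in> carrier R" "s \<in> carrier R" "v \<in> carrier M"
  shows "scal (r \<oplus> s) v = scal r v \<oplus>\<^bsub>M\<^esub> scal s v"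
  using M.smult_l_distr[of "coef r" "coef s" v] assms
    gwa_cong.Coef_add[of r R s \<sigma> a, THEN gwa_class_eqI]
  by (simp add: gwa_add_class gwa_terms_intros)

lemma scal_scal:
  assumes "r \<in> carrier R" "s \<in> carrier R" "v \<in> carrier M"
  shows "scal r (scal s v) = scal (r \<otimes> s) v"
  using M.smult_assoc1[of "coef r" "coef s" v] assms
    gwa_cong.Coef_mult[of r R s \<sigma> a, THEN gwa_class_eqI]
  by (simp add: gwa_mult_class gwa_terms_intros)

lemma scal_commute:
  "\<lbrakk>r \<in> carrier R; s \<in> carrier R; v \<in> carrier M\<rbrakk> \<Longrightarrow> scal r (scal s v) = scal s (scal r v)"
  by (simp add: scal_scal m_comm)

lemma sigma_funcset: "\<sigma> \<in> carrier R \<rightarrow> carrier R"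
  by simp

text \<open>The defining relation read at \<open>\<tau> r\<close>. Hence x sends vectors killed by p
  to vectors killed by \<open>\<tau> p\<close>, just as y sends them to vectors killed by
  \<open>\<sigma> p\<close>: the generators shift weights.\<close>

lemma xact_scal:
  assumes "r \<in> carrier R" "v \<in> carrier M"
  shows "xact (scal r v) = scal (\<tau> r) (xact v)"
  using gwa_relations(1)[OF sigma_funcset, of "\<tau> r" a] assms
    M.smult_assoc1[of xgen "coef r" v] M.smult_assoc1[of "coef (\<tau> r)" xgen v] by simp

lemma yact_scal:
  assumes "r \<in> carrier R" "v \<in> carrier M"
  shows "yact (scal r v) = scal (\<sigma> r) (yact v)"
  using gwa_relations(2)[OF sigma_funcset, of r a] assms
    M.smult_assoc1[of ygen "coef r" v] M.smult_assoc1[of "coef (\<sigma> r)" ygen v] by simp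

lemma xact_yact: "v \<in> carrier M \<Longrightarrow> xact (yact v) = scal a v"
  using gwa_relations(3)[OF sigma_funcset, of \<zero> a] M.smult_assoc1[of xgen ygen v] by simp

lemma yact_xact: "v \<in> carrier M \<Longrightarrow> yact (xact v) = scal (\<sigma> a) v"
  using gwa_relations(4)[OF sigma_funcset, of \<zero> a] M.smult_assoc1[of ygen xgen v] by simp

lemma gwa_submoduleI:
  assumes N: "N \<subseteq> carrier M" "\<zero>\<^bsub>M\<^esub> \<in> N"
    and add: "\<And>v w. \<lbrakk>v \<in> N; w \<in> N\<rbrakk> \<Longrightarrow> v \<oplus>\<^bsub>M\<^esub> w \<in> N"
    and gens: "\<And>r v. \<lbrakk>r \<in> carrier R; v \<in> N\<rbrakk> \<Longrightarrow> scal r v \<in> N"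
      "\<And>v. v \<in> N \<Longrightarrow> xact v \<in> N" "\<And>v. v \<in> N \<Longrightarrow> yact v \<in> N"
  shows "submodule N (gwa R \<sigma> a) M"
proof (rule M.submodule_criterion[OF N add])
  fix x v assume "x \<in> carrier (gwa R \<sigma> a)" "v \<in> N"
  then show "x \<odot>\<^bsub>M\<^esub> v \<in> N"
  proof (induction x arbitrary: v rule: gwa_induct)
    case (add x y)
    then have "v \<in> carrier M" using N by blast
    then show ?case using add assms(3) by (simp add: M.smult_l_distr)
  next
    case (mult x y)
    then have "v \<in> carrier M" using N by blast
    then show ?case using mult by (simp add: M.smult_assoc1)
  qed (use gens in auto)
qed

text \<open>The algebra elements whose action commutes with \<open>f\<close> are closed under sums
  and products, so the coefficients and the two generators decide.\<close>

lemma gwa_linearI: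
  assumes "left_module (gwa R \<sigma> a) L"
    and f: "\<And>v. v \<in> carrier M \<Longrightarrow> f v \<in> carrier L"
    and add: "\<And>v w. \<lbrakk>v \<in> carrier M; w \<in> carrier M\<rbrakk> \<Longrightarrow> f (v \<oplus>\<^bsub>M\<^esub> w) = f v \<oplus>\<^bsub>L\<^esub> f w"
    and gens: "\<And>r v. \<lbrakk>r \<in> carrier R; v \<in> carrier M\<rbrakk> \<Longrightarrow> f (scal r v) = coef r \<odot>\<^bsub>L\<^esub> f v"
      "\<And>v. v \<in> carrier M \<Longrightarrow> f (xact v) = xgen \<odot>\<^bsub>L\<^esub> f v"
      "\<And>v. v \<in> carrier M \<Longrightarrow> f (yact v) = ygen \<odot>\<^bsub>L\<^esub> f v"
    and "x \<in> carrier (gwa R \<sigma> a)" "v \<in> carrier M"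
  shows "f (x \<odot>\<^bsub>M\<^esub> v) = x \<odot>\<^bsub>L\<^esub> f v"
proof -
  interpret L: left_module "gwa R \<sigma> a" L by fact
  show ?thesis using assms(7,8)
  proof (induction x arbitrary: v rule: gwa_induct)
    case (add x y)
    then show ?case using f assms(3) by (simp add: M.smult_l_distr L.smult_l_distr)
  next
    case (mult x y)
    then show ?case using f by (simp add: M.smult_assoc1 L.smult_assoc1)
  qed (use gens in auto)
qed

lemma scal_divisor_zero:
  assumes "r \<in> carrier R" "s \<in> carrier R" "v \<in> carrier M" "scal r v = \<zero>\<^bsub>M\<^esub>"
  shows "scal (s \<otimes> r) v = \<zero>\<^bsub>M\<^esub>"
  using assms by (simp add: scal_scal[symmetric])

text \<open>Apply 1 = x r + y s to \<open>v\<close>.\<close>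

lemma eq_zero_of_comaximal:
  assumes "r \<in> carrier R" "s \<in> carrier R" "v \<in> carrier M" "comaximal r s"
    and "scal r v = \<zero>\<^bsub>M\<^esub>" "scal s v = \<zero>\<^bsub>M\<^esub>"
  shows "v = \<zero>\<^bsub>M\<^esub>"
proof -
  obtain x y where xy: "x \<in> carrier R" "y \<in> carrier R" "x \<otimes> r \<oplus> y \<otimes> s = \<one>"
    using assms(4) by (auto simp: comaximal_def)
  have "v = scal (x \<otimes> r \<oplus> y \<otimes> s) v" using xy assms by simp
  also have "\<dots> = \<zero>\<^bsub>M\<^esub>" using xy(1,2) assms by (simp add: scal_add_left scal_divisor_zero)
  finally show ?thesis .
qed

section \<open>Weight spaces and their independence\<close>

abbreviation "wspace \<equiv> weight_space R \<sigma> a M"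

lemma wspace_PIdl:
  assumes "p \<in> carrier R"
  shows "wspace (PIdl p) = {v \<in> carrier M. scal p v = \<zero>\<^bsub>M\<^esub>}"
  using assms cgenideal_self[OF assms] by (auto simp: weight_space_def cgenideal_def scal_divisor_zero)

lemma Max_ideals_iff:
  "I \<in> Max_ideals R \<longleftrightarrow> (\<exists>p\<in>carrier R. ring_irreducible p \<and> I = PIdl p)"
  using maximalideal_iff_irreducible[OF not_field] by (simp add: Max_ideals_def)

lemma wspace_closed: "v \<in> wspace I \<Longrightarrow> v \<in> carrier M"
  by (simp add: weight_space_def)

lemma wspace_zero [simp]: "I \<in> Max_ideals R \<Longrightarrow> \<zero>\<^bsub>M\<^esub> \<in> wspace I"
  by (auto simp: Max_ideals_iff wspace_PIdl)

lemma wspace_add: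
  "\<lbrakk>I \<in> Max_ideals R; v \<in> wspace I; w \<in> wspace I\<rbrakk> \<Longrightarrow> v \<oplus>\<^bsub>M\<^esub> w \<in> wspace I"
  by (auto simp: Max_ideals_iff wspace_PIdl M.smult_r_distr)

lemma wspace_scal:
  "\<lbrakk>I \<in> Max_ideals R; v \<in> wspace I; r \<in> carrier R\<rbrakk> \<Longrightarrow> scal r v \<in> wspace I"
  by (auto simp: Max_ideals_iff wspace_PIdl scal_commute[of _ r])

text \<open>The weight ideal is generated by an irreducible p; elements outside it are comaximal
  with p and therefore act injectively on the weight space.\<close>

lemma wspace_eq_zero:
  assumes "I \<in> Max_ideals R" "v \<in> wspace I" "r \<in> carrier R" "r \<notin> I" "scal r v = \<zero>\<^bsub>M\<^esub>"
  shows "v = \<zero>\<^bsub>M\<^esub>"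
proof -
  obtain p where p: "p \<in> carrier R" "ring_irreducible p" "I = PIdl p"
    using assms(1) by (auto simp: Max_ideals_iff)
  have "\<not> p divides r"
    using assms(3,4) p by (auto simp: cgenideal_def factor_def m_comm)
  then have "comaximal p r" using comaximal_irreducible p assms by blast
  then show ?thesis using eq_zero_of_comaximal[of p r v] assms p by (simp add: wspace_PIdl)
qed

text \<open>Take a product of elements of each \<open>J\<close> lying outside \<open>I\<close>;
  primeness of \<open>I\<close> keeps the product outside. It kills the weight spaces at all
  \<open>J\<close> and acts injectively on the one at \<open>I\<close>, which makes it a substitute
  for a projection.\<close>

lemma separating_element:
  assumes "finite F" "F \<subseteq> Max_ideals R" "I \<in> Max_ideals R" "I \<notin> F"
  shows "\<exists>e\<in>carrier R. e \<notin> I \<and> (\<forall>J\<in>F. e \<in> J)"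
  using assms
proof (induction F rule: finite_induct)
  case empty
  then interpret maximalideal I R by (simp add: Max_ideals_def)
  show ?case using I_notcarr one_imp_carrier by auto
next
  case (insert J F)
  then obtain e where e: "e \<in> carrier R" "e \<notin> I" "\<forall>J\<in>F. e \<in> J" by auto
  interpret I: maximalideal I R using insert by (simp add: Max_ideals_def)
  interpret J: maximalideal J R using insert by (simp add: Max_ideals_def)
  interpret P: primeideal I R using I.maximalideal_axioms by (rule maximalideal_prime)
  have "\<not> J \<subseteq> I" using J.I_maximal[OF I.is_ideal] I.a_subset I.I_notcarr insert by auto
  then obtain x where x: "x \<in> J" "x \<notin> I" by blast
  then have "e \<otimes> x \<notin> I" using P.I_prime e J.a_Hcarr by blast
  moreover have "e \<otimes> x \<in> K" if K: "K \<in> insert J F" for K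
  proof -
    interpret K: maximalideal K R using K insert.prems by (auto simp: Max_ideals_def)
    show ?thesis using K e x J.a_Hcarr J.I_l_closed K.I_r_closed by auto
  qed
  ultimately show ?case using e x J.a_Hcarr by blast
qed

lemma scal_finsum_eq:
  assumes F: "finite F" "F \<subseteq> Max_ideals R" "I \<in> F" and w: "\<And>J. J \<in> F \<Longrightarrow> w J \<in> wspace J"
    and e: "e \<in> carrier R" "\<And>J. \<lbrakk>J \<in> F; J \<noteq> I\<rbrakk> \<Longrightarrow> e \<in> J"
  shows "scal e (finsum M w F) = scal e (w I)"
proof -
  have z: "scal e (finsum M w G) = \<zero>\<^bsub>M\<^esub>" if "finite G" "G \<subseteq> F - {I}" for G
    using that
  proof (induction G rule: finite_induct)
    case (insert J G)
    then have "scal e (w J) = \<zero>\<^bsub>M\<^esub>" using w[of J] e(2)[of J] by (auto simp: weight_space_def)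
    moreover have "w \<in> G \<rightarrow> carrier M" "w J \<in> carrier M"
      using insert w by (auto simp: weight_space_def)
    ultimately show ?case
      using insert e(1) by (simp add: M.M.finsum_insert M.smult_r_distr M.M.finsum_closed)
  qed (use e in simp)
  have c: "w \<in> F \<rightarrow> carrier M" using w by (auto simp: weight_space_def)
  have "finsum M w F = w I \<oplus>\<^bsub>M\<^esub> finsum M w (F - {I})"
    using F c M.M.finsum_insert[of "F - {I}" I w] by (auto simp: insert_absorb)
  moreover have "w I \<in> carrier M" "finsum M w (F - {I}) \<in> carrier M"
    using c F by (auto intro!: M.M.finsum_closed)
  ultimately show ?thesis using z[of "F - {I}"] F e by (simp add: M.smult_r_distr)
qed

text \<open>An element separating \<open>I\<close> from the other members of \<open>G\<close> kills
  all summands but the one at \<open>I\<close>, on which it acts injectively.\<close>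

lemma weight_decomposition_unique:
  assumes G: "finite G" "G \<subseteq> Max_ideals R" "I \<in> G"
    and w: "\<And>J. J \<in> G \<Longrightarrow> w J \<in> wspace J" "\<And>J. J \<in> G \<Longrightarrow> w' J \<in> wspace J"
    and eq: "finsum M w G = finsum M w' G"
  shows "w I = w' I"
proof -
  obtain e where e: "e \<in> carrier R" "e \<notin> I" "\<forall>J\<in>G - {I}. e \<in> J"
    using separating_element[of "G - {I}" I] G by auto
  have I: "I \<in> Max_ideals R" using G by blast
  have c: "w I \<in> carrier M" "w' I \<in> carrier M" using w G wspace_closed by blast+
  have "scal e (w I) = scal e (w' I)"
    using scal_finsum_eq[OF G w(1) e(1)] scal_finsum_eq[OF G w(2) e(1)] e(3) eq by auto
  then have e0: "scal e (w I \<oplus>\<^bsub>M\<^esub> \<ominus>\<^bsub>M\<^esub> w' I) = \<zero>\<^bsub>M\<^esub>"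
    using c e by (simp add: M.smult_r_distr M.smult_minus_right M.M.r_neg)
  \<comment> \<open>Written with the scalar -1, the negative stays in the weight space, whose
    closure is known for scalars and sums.\<close>
  have mi: "\<ominus>\<^bsub>M\<^esub> w' I = scal (\<ominus> \<one>) (w' I)"
  proof (rule M.M.minus_equality)
    have "scal (\<ominus> \<one>) (w' I) \<oplus>\<^bsub>M\<^esub> w' I = scal (\<ominus> \<one> \<oplus> \<one>) (w' I)"
      using c by (simp add: scal_add_left del: l_neg)
    also have "\<dots> = \<zero>\<^bsub>M\<^esub>" using c by (simp add: l_neg)
    finally show "scal (\<ominus> \<one>) (w' I) \<oplus>\<^bsub>M\<^esub> w' I = \<zero>\<^bsub>M\<^esub>" .
  qed (use c in auto)
  have "w I \<oplus>\<^bsub>M\<^esub> \<ominus>\<^bsub>M\<^esub> w' I \<in> wspace I"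
    unfolding mi using w G I by (intro wspace_add wspace_scal) auto
  then have "w I \<oplus>\<^bsub>M\<^esub> \<ominus>\<^bsub>M\<^esub> w' I = \<zero>\<^bsub>M\<^esub>" using wspace_eq_zero[OF I _ e(1,2) e0] by blast
  then have "\<ominus>\<^bsub>M\<^esub> (\<ominus>\<^bsub>M\<^esub> w' I) = w I" using c by (intro M.M.minus_equality) auto
  then show ?thesis using c(2) by (simp only: M.M.minus_minus)
qed

lemma finsum_support:
  assumes "finite G" "G \<subseteq> Max_ideals R" "{J \<in> Max_ideals R. w J \<noteq> \<zero>\<^bsub>M\<^esub>} \<subseteq> G"
    and "\<And>J. J \<in> G \<Longrightarrow> w J \<in> carrier M"
  shows "finsum M w {J \<in> Max_ideals R. w J \<noteq> \<zero>\<^bsub>M\<^esub>} = finsum M w G"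
  using assms by (intro M.M.add.finprod_mono_neutral_cong_left) auto

text \<open>Only existence has to be supplied: weight spaces are independent, and two decompositions
  can be compared on a finite set containing both supports.\<close>

lemma weight_moduleI:
  assumes F: "finite F" "F \<subseteq> Max_ideals R"
    and ex: "\<And>v. v \<in> carrier M \<Longrightarrow> \<exists>w. (\<forall>J\<in>F. w J \<in> wspace J) \<and> v = finsum M w F"
  shows "weight_module R \<sigma> a M"
  unfolding weight_module_def
proof (intro conjI ballI)
  show "left_module (gwa R \<sigma> a) M" by unfold_locales
  fix v assume "v \<in> carrier M"
  then obtain u where u: "\<forall>J\<in>F. u J \<in> wspace J" "v = finsum M u F" using ex by blast
  let ?S = "\<lambda>w. {J \<in> Max_ideals R. w J \<noteq> \<zero>\<^bsub>M\<^esub>}"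
  \<comment> \<open>The family is extended by zero outside \<open>F\<close> and made extensional, as
    the product over all maximal ideals requires.\<close>
  let ?w = "\<lambda>J\<in>Max_ideals R. if J \<in> F then u J else \<zero>\<^bsub>M\<^esub>"
  show "\<exists>!w. w \<in> (\<Pi>\<^sub>E J\<in>Max_ideals R. wspace J) \<and> finite (?S w) \<and> v = finsum M w (?S w)"
  proof (rule ex1I[of _ ?w], intro conjI)
    have sub: "?S ?w \<subseteq> F" by auto
    show "?w \<in> (\<Pi>\<^sub>E J\<in>Max_ideals R. wspace J)" using u by auto
    show "finite (?S ?w)" using sub F finite_subset by blast
    have "finsum M ?w (?S ?w) = finsum M ?w F"
      using F sub u wspace_closed by (intro finsum_support) auto
    also have "\<dots> = finsum M u F"
      using F u wspace_closed by (intro M.M.finsum_cong') auto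
    finally show "v = finsum M ?w (?S ?w)" using u by simp
  next
    fix w assume w: "w \<in> (\<Pi>\<^sub>E J\<in>Max_ideals R. wspace J) \<and> finite (?S w) \<and> v = finsum M w (?S w)"
    show "w = ?w"
    proof (rule PiE_ext)
      show "w \<in> (\<Pi>\<^sub>E J\<in>Max_ideals R. wspace J)" using w by simp
      show "?w \<in> (\<Pi>\<^sub>E J\<in>Max_ideals R. wspace J)" using u by auto
      fix I assume I: "I \<in> Max_ideals R"
      define G where "G = insert I (F \<union> ?S w)"
      have G: "finite G" "G \<subseteq> Max_ideals R" "I \<in> G" using F w I by (auto simp: G_def)
      have ws: "w J \<in> wspace J" "?w J \<in> wspace J" if "J \<in> G" for J
        using that G(2) u w by (auto simp: PiE_def Pi_def)
      have "v = finsum M w G"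
        using w finsum_support[OF G(1,2), of w] wspace_closed ws by (auto simp: G_def)
      moreover have "v = finsum M ?w G"
      proof -
        have uc: "u J \<in> carrier M" if "J \<in> F" for J using that u wspace_closed by blast
        have "finsum M ?w G = finsum M u F"
        proof (rule M.M.add.finprod_mono_neutral_cong_right)
          show "finite G" "F \<subseteq> G" using G(1) by (auto simp: G_def)
          show "?w J = \<zero>\<^bsub>M\<^esub>" if "J \<in> G - F" for J using that G(2) by auto
          show "?w J = u J" if "J \<in> F" for J using that F(2) by auto
          show "?w \<in> G \<rightarrow> carrier M" using G(2) uc by auto
        qed
        then show ?thesis using u by simp
      qed
      ultimately show "w I = ?w I"
        using weight_decomposition_unique[OF G, of w ?w] ws by simp
    qed
  qed
qed

text \<open>Strip irreducible factors off \<open>r\<close>: for r = p b, either \<open>b\<close>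
  already kills \<open>v\<close>, or b v is a nonzero vector killed by \<open>p\<close>.\<close>

lemma torsion_weight_vector:
  assumes "r \<in> carrier R" "r \<noteq> \<zero>" "v \<in> carrier M" "v \<noteq> \<zero>\<^bsub>M\<^esub>" "scal r v = \<zero>\<^bsub>M\<^esub>"
  shows "\<exists>p\<in>carrier R. ring_irreducible p \<and> (\<exists>u\<in>carrier M. u \<noteq> \<zero>\<^bsub>M\<^esub> \<and> scal p u = \<zero>\<^bsub>M\<^esub>)"
  using assms
proof (induction r rule: irreducible_induct)
  case (unit r)
  then have "v = scal (inv r \<otimes> r) v" by simp
  then show ?case using unit by (simp only: scal_divisor_zero Units_inv_closed Units_closed)
next
  case (mult p b)
  show ?case
  proof (cases "scal b v = \<zero>\<^bsub>M\<^esub>")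
    case False
    have "scal p (scal b v) = \<zero>\<^bsub>M\<^esub>" using mult by (simp add: scal_scal)
    then show ?thesis using False mult by (intro bexI[of _ p] conjI bexI[of _ "scal b v"]) auto
  qed (use mult in blast)
qed

lemma simple_torsion_weight_module:
  assumes simple: "simple_module (gwa R \<sigma> a) M" and r: "r \<in> carrier R" "r \<noteq> \<zero>"
    and tors: "\<And>v. v \<in> carrier M \<Longrightarrow> scal r v = \<zero>\<^bsub>M\<^esub>"
  shows "weight_module R \<sigma> a M \<and> finite (weight_support R \<sigma> a M)"
proof
  define F where "F = {I. maximalideal I R \<and> r \<in> I}"
  have F: "finite F" "F \<subseteq> Max_ideals R"
    using finite_maximal_ideals[OF not_field r] by (auto simp: F_def Max_ideals_def)
  have zero: "v = \<zero>\<^bsub>M\<^esub>" if "I \<in> Max_ideals R" "I \<notin> F" "v \<in> wspace I" for I v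
    using that wspace_eq_zero[of I v r] r tors wspace_closed by (auto simp: F_def Max_ideals_def)
  then have "weight_support R \<sigma> a M \<subseteq> F"
    by (auto simp: weight_support_def)
  then show "finite (weight_support R \<sigma> a M)" using F finite_subset by blast
  define W where "W = {v. \<exists>w. (\<forall>J\<in>F. w J \<in> wspace J) \<and> v = finsum M w F}"
  have W: "W \<subseteq> carrier M" using wspace_closed by (auto simp: W_def intro!: M.M.finsum_closed)
  have W0: "\<zero>\<^bsub>M\<^esub> \<in> W"
    unfolding W_def using F by (auto intro!: exI[of _ "\<lambda>_. \<zero>\<^bsub>M\<^esub>"] simp: M.M.finsum_zero)
  have Wadd: "v \<oplus>\<^bsub>M\<^esub> v' \<in> W" if v: "v \<in> W" "v' \<in> W" for v v'
  proof -
    obtain w w' where w: "\<forall>J\<in>F. w J \<in> wspace J" "v = finsum M w F"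
      "\<forall>J\<in>F. w' J \<in> wspace J" "v' = finsum M w' F" using v by (auto simp: W_def)
    then have "w \<in> F \<rightarrow> carrier M" "w' \<in> F \<rightarrow> carrier M" using wspace_closed by blast+
    then have "v \<oplus>\<^bsub>M\<^esub> v' = finsum M (\<lambda>J. w J \<oplus>\<^bsub>M\<^esub> w' J) F"
      using w by (simp add: M.M.finsum_addf)
    then show ?thesis
      unfolding W_def using w F wspace_add by (auto intro!: exI[of _ "\<lambda>J. w J \<oplus>\<^bsub>M\<^esub> w' J"])
  qed
  \<comment> \<open>\<open>F\<close> need not be stable under \<sigma>, so a generator may move a
    weight vector out of \<open>F\<close>. The result is then zero, as \<open>r\<close> acts on such
    a weight space both as zero and injectively.\<close>
  have Wws: "v \<in> W" if I: "I \<in> Max_ideals R" "v \<in> wspace I" for I v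
  proof (cases "I \<in> F")
    case True
    have "v = finsum M (\<lambda>J. if I = J then v else \<zero>\<^bsub>M\<^esub>) F"
      using True F wspace_closed[OF I(2)] M.M.finsum_singleton[of I F "\<lambda>_. v"] by simp
    then show ?thesis
      unfolding W_def using F I by (auto intro!: exI[of _ "\<lambda>J. if I = J then v else \<zero>\<^bsub>M\<^esub>"])
  next
    case False
    then show ?thesis using zero I W0 by blast
  qed
  have Wmap: "x \<odot>\<^bsub>M\<^esub> v \<in> W"
    if x: "x \<in> carrier (gwa R \<sigma> a)" "\<And>I v. \<lbrakk>I \<in> F; v \<in> wspace I\<rbrakk> \<Longrightarrow> x \<odot>\<^bsub>M\<^esub> v \<in> W" and v: "v \<in> W" for x v
  proof -
    obtain w where w: "\<forall>J\<in>F. w J \<in> wspace J" "v = finsum M w F" using v by (auto simp: W_def)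
    have "x \<odot>\<^bsub>M\<^esub> finsum M w G \<in> W" if "finite G" "G \<subseteq> F" for G
      using that
    proof (induction G rule: finite_induct)
      case (insert J G)
      then have "w \<in> G \<rightarrow> carrier M" "w J \<in> carrier M" using w wspace_closed by auto
      moreover have "x \<odot>\<^bsub>M\<^esub> w J \<in> W" using x(2) w(1) insert.prems by blast
      ultimately show ?case
        using insert x(1) Wadd by (simp add: M.M.finsum_insert M.smult_r_distr M.M.finsum_closed)
    qed (use W0 x in simp)
    then show ?thesis using F w by simp
  qed
  have irr: "ring_irreducible (\<sigma> p)" "ring_irreducible (\<tau> p)" if "p \<in> carrier R" "ring_irreducible p" for p
    using that sigma tau ring_aut_irreducible by blast+
  have "submodule W (gwa R \<sigma> a) M"
  proof (rule gwa_submoduleI[OF W W0 Wadd])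
    fix s v assume s: "s \<in> carrier R" "v \<in> W"
    show "scal s v \<in> W"
      by (rule Wmap) (use s F Wws wspace_scal in auto)
  next
    fix v assume v: "v \<in> W"
    show "xact v \<in> W"
    proof (rule Wmap[OF _ _ v])
      fix I u assume I: "I \<in> F" "u \<in> wspace I"
      then obtain p where p: "p \<in> carrier R" "ring_irreducible p" "I = PIdl p" using F Max_ideals_iff by blast
      then have "xact u \<in> wspace (PIdl (\<tau> p))"
        using I xact_scal[of p u] by (simp add: wspace_PIdl)
      moreover have "PIdl (\<tau> p) \<in> Max_ideals R"
        unfolding Max_ideals_iff using p irr tau_closed by blast
      ultimately show "xact u \<in> W" by (rule Wws[rotated])
    qed simp
    show "yact v \<in> W"
    proof (rule Wmap[OF _ _ v])
      fix I u assume I: "I \<in> F" "u \<in> wspace I"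
      then obtain p where p: "p \<in> carrier R" "ring_irreducible p" "I = PIdl p" using F Max_ideals_iff by blast
      then have "yact u \<in> wspace (PIdl (\<sigma> p))"
        using I yact_scal[of p u] by (simp add: wspace_PIdl)
      moreover have "PIdl (\<sigma> p) \<in> Max_ideals R"
        unfolding Max_ideals_iff using p irr sigma_closed by blast
      ultimately show "yact u \<in> W" by (rule Wws[rotated])
    qed simp
  qed
  moreover have "W \<noteq> {\<zero>\<^bsub>M\<^esub>}"
  proof -
    have "carrier M \<noteq> {\<zero>\<^bsub>M\<^esub>}" using simple by (simp add: simple_module_def)
    then obtain v where "v \<in> carrier M" "v \<noteq> \<zero>\<^bsub>M\<^esub>" using M.M.zero_closed by blast
    then obtain p u where "p \<in> carrier R" "ring_irreducible p" "u \<in> carrier M" "u \<noteq> \<zero>\<^bsub>M\<^esub>" "scal p u = \<zero>\<^bsub>M\<^esub>"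
      using torsion_weight_vector[OF r] tors by blast
    moreover from this have "u \<in> W" using Wws[of "PIdl p" u] by (auto simp: Max_ideals_iff wspace_PIdl)
    ultimately show ?thesis by blast
  qed
  ultimately have "W = carrier M" using simple by (auto simp: simple_module_def)
  then show "weight_module R \<sigma> a M"
    by (intro weight_moduleI[OF F]) (auto simp: W_def)
qed

end

section \<open>The modules attached to divisors\<close>

locale gwa_divisor = gwa_data R \<sigma> a for R :: "('r, 'm) ring_scheme" (structure) and \<sigma> a +
  fixes p c :: 'r
  assumes p_closed [simp]: "p \<in> carrier R" and c_closed [simp]: "c \<in> carrier R"
    and a_eq: "a = p \<otimes> c"
begin

abbreviation V :: "('r gwa_term set, 'r) module" where "V \<equiv> div_module R \<sigma> a p"

abbreviation q :: 'r where "q \<equiv> \<sigma> c"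

lemmas V_action = div_module_left_module(2)[OF domain_axioms sigma a_closed a_nonzero p_closed c_closed a_eq]

lemma V_left_module: "left_module (gwa R \<sigma> a) V"
  by (rule div_module_left_module(3)[OF domain_axioms sigma a_closed a_nonzero p_closed c_closed a_eq])

sublocale V: gwa_module R \<sigma> a V
  by (intro gwa_module.intro gwa_data_axioms V_left_module)

lemma V_simps [simp]:
  "carrier V = carrier R" "\<zero>\<^bsub>V\<^esub> = \<zero>" "v \<oplus>\<^bsub>V\<^esub> w = v \<oplus> w"
  by (simp_all add: div_module_def)

lemma V_scal [simp]: "\<lbrakk>r \<in> carrier R; v \<in> carrier R\<rbrakk> \<Longrightarrow> coef r \<odot>\<^bsub>V\<^esub> v = r \<otimes> v"
  and V_xact [simp]: "v \<in> carrier R \<Longrightarrow> xgen \<odot>\<^bsub>V\<^esub> v = \<tau> v \<otimes> p"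
  and V_yact [simp]: "v \<in> carrier R \<Longrightarrow> ygen \<odot>\<^bsub>V\<^esub> v = \<sigma> v \<otimes> q"
  by (simp_all add: V_action gwa_terms_intros)

lemma p_nonzero: "p \<noteq> \<zero>" and q_nonzero: "q \<noteq> \<zero>"
  using a_nonzero a_eq by (auto simp: ring_aut_eq_zero_iff[OF sigma])

lemma V_submodule_ideal:
  assumes N: "submodule N (gwa R \<sigma> a) V"
  shows "ideal N R"
proof (rule idealI[OF ring_axioms])
  note ND = submoduleD[OF V_left_module N]
  have sub: "N \<subseteq> carrier R" using ND(1) by simp
  have sc: "r \<otimes> v \<in> N" if "r \<in> carrier R" "v \<in> N" for r v
    using ND(4)[of "coef r" v] that sub by (simp add: subset_iff)
  show "subgroup N (add_monoid R)"
  proof (rule subgroup.intro)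
    show "N \<subseteq> carrier (add_monoid R)" using sub by simp
    show "x \<otimes>\<^bsub>add_monoid R\<^esub> y \<in> N" if "x \<in> N" "y \<in> N" for x y using ND(3)[OF that] by simp
    show "\<one>\<^bsub>add_monoid R\<^esub> \<in> N" using ND(2) by simp
    fix x assume x: "x \<in> N"
    then have "\<ominus> x = \<ominus> \<one> \<otimes> x" using sub by (simp add: l_minus subset_iff)
    then show "inv\<^bsub>add_monoid R\<^esub> x \<in> N" using sc[OF _ x, of "\<ominus> \<one>"] by (simp add: a_inv_def)
  qed
  show "x \<otimes> v \<in> N" "v \<otimes> x \<in> N" if "v \<in> N" "x \<in> carrier R" for v x
    using sc[OF that(2,1)] that sub by (auto simp: m_comm subset_iff)
qed

lemma V_submodule_generator:
  assumes N: "submodule N (gwa R \<sigma> a) V"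
  shows "\<exists>s\<in>carrier R. N = PIdl s \<and> s divides \<tau> s \<otimes> p \<and> s divides \<sigma> s \<otimes> q"
proof -
  note ND = submoduleD[OF V_left_module N]
  obtain s where s: "s \<in> carrier R" "N = PIdl s" using exists_gen[OF V_submodule_ideal[OF N]] by blast
  then have "s \<in> N" using cgenideal_self by blast
  have dv: "s divides t" if "t \<in> N" for t
    using that s by (auto simp: cgenideal_def factor_def m_comm)
  have "\<tau> s \<otimes> p \<in> N" "\<sigma> s \<otimes> q \<in> N"
    using ND(4)[OF xgen_closed \<open>s \<in> N\<close>] ND(4)[OF ygen_closed \<open>s \<in> N\<close>] s by simp_all
  then show ?thesis using s dv by blast
qed

lemma PIdl_eq_zero_iff: "s \<in> carrier R \<Longrightarrow> PIdl s = {\<zero>} \<longleftrightarrow> s = \<zero>"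
  using cgenideal_self[of s] genideal_zero cgenideal_eq_genideal[of \<zero>] by auto

lemma PIdl_mem_iff: "s \<in> carrier R \<Longrightarrow> t \<in> PIdl s \<longleftrightarrow> t \<in> carrier R \<and> s divides t"
  by (auto simp: cgenideal_def factor_def m_comm)

lemma V_common_element:
  "\<exists>d\<in>carrier R. d \<noteq> \<zero> \<and> (\<forall>N. submodule N (gwa R \<sigma> a) V \<longrightarrow> N \<noteq> {\<zero>} \<longrightarrow> d \<in> N)"
proof -
  obtain d where d: "d \<in> carrier R" "d \<noteq> \<zero>"
    "\<And>s. \<lbrakk>s \<in> carrier R; s \<noteq> \<zero>; s divides \<tau> s \<otimes> p; s divides \<sigma> s \<otimes> q\<rbrakk> \<Longrightarrow> s divides d"
    using uniform_divisor_bound[OF p_closed p_nonzero sigma_closed[OF c_closed] q_nonzero] by blast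
  have "d \<in> N" if N: "submodule N (gwa R \<sigma> a) V" "N \<noteq> {\<zero>}" for N
  proof -
    obtain s where s: "s \<in> carrier R" "N = PIdl s" "s divides \<tau> s \<otimes> p" "s divides \<sigma> s \<otimes> q"
      using V_submodule_generator[OF N(1)] by blast
    then have "s \<noteq> \<zero>" using N(2) PIdl_eq_zero_iff by blast
    then show ?thesis using d s by (simp add: PIdl_mem_iff)
  qed
  then show ?thesis using d(1,2) by blast
qed

text \<open>Inclusion of submodules reverses divisibility of generators, so the number of
  irreducible factors of a generator drops when the submodule grows. The common element
  \<open>d\<close> bounds this number, which turns it into an increasing measure.\<close>

lemma V_series_upto:
  assumes "submodule N (gwa R \<sigma> a) V"
  shows "\<exists>Ns. series_upto (gwa R \<sigma> a) V N Ns"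
proof -
  obtain d where d: "d \<in> carrier R" "d \<noteq> \<zero>"
    "\<And>N. \<lbrakk>submodule N (gwa R \<sigma> a) V; N \<noteq> {\<zero>}\<rbrakk> \<Longrightarrow> d \<in> N" using V_common_element by blast
  define gen where "gen N = (SOME s. s \<in> carrier R \<and> N = PIdl s)" for N
  have gen: "gen N \<in> carrier R \<and> N = PIdl (gen N)" if "submodule N (gwa R \<sigma> a) V" for N
    unfolding gen_def by (rule someI_ex) (use V_submodule_generator[OF that] in blast)
  let ?fc = "factorcount (mult_of R)"
  \<comment> \<open>Every generator of a nonzero submodule divides \<open>d\<close>, so the
    truncated subtraction is exact and, thanks to \<open>Suc\<close>, positive; this leaves 0 for
    the zero submodule.\<close>
  define \<mu> where "\<mu> N = (if N = {\<zero>} then 0 else Suc (?fc d) - ?fc (gen N))" for N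
  have fc: "?fc x < ?fc y"
    if "x \<in> carrier R" "y \<in> carrier R" "y \<noteq> \<zero>" "x divides y" "\<not> y divides x" for x y
  proof -
    have "x \<noteq> \<zero>" using that(3,4) zero_divides by blast
    moreover have "properfactor R x y" using that by (simp add: properfactor_def)
    ultimately show ?thesis
      using that properfactor_imp_properfactor_mult[of y x] by (intro mult_of.properfactor_fcount) auto
  qed
  have fcd: "?fc (gen N) \<le> ?fc d" if N: "submodule N (gwa R \<sigma> a) V" "N \<noteq> {\<zero>}" for N
  proof -
    have g: "gen N \<in> carrier R" "N = PIdl (gen N)" using gen[OF N(1)] by blast+
    have "d \<in> PIdl (gen N)" using d(3)[OF N] unfolding g(2)[symmetric] .
    then have g3: "gen N divides d" using PIdl_mem_iff[OF g(1)] by blast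
    have g4: "gen N \<noteq> \<zero>" using N(2) PIdl_eq_zero_iff[OF g(1)] unfolding g(2)[symmetric] by blast
    have "gen N divides\<^bsub>mult_of R\<^esub> d"
      by (rule divides_imp_divides_mult[OF g(1) _ g3]) (use d in simp)
    then show ?thesis using g(1) g4 d by (intro mult_of.divides_fcount) auto
  qed
  show ?thesis
  proof (rule series_upto_exists[OF V_left_module _ assms, where \<mu> = \<mu>])
    fix K N assume K: "submodule K (gwa R \<sigma> a) V" and N: "submodule N (gwa R \<sigma> a) V" and KN: "K \<subset> N"
    have "\<zero> \<in> K" using submoduleD(2)[OF V_left_module K] by simp
    then have N0: "N \<noteq> {\<zero>}" using KN by auto
    show "\<mu> K < \<mu> N"
    proof (cases "K = {\<zero>}")
      case True
      then show ?thesis using N0 fcd[OF N N0] by (simp add: \<mu>_def)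
    next
      case False
      note gK = gen[OF K] and gN = gen[OF N]
      have "PIdl (gen K) \<subset> PIdl (gen N)" using KN gK gN by simp
      then have "gen N divides gen K" "\<not> gen K divides gen N"
        using gK gN to_contain_is_to_divide[of "gen N" "gen K"]
          to_contain_is_to_divide[of "gen K" "gen N"] by blast+
      moreover have "gen K \<noteq> \<zero>" using False gK PIdl_eq_zero_iff[of "gen K"] by auto
      ultimately have "?fc (gen N) < ?fc (gen K)" using fc gK gN by blast
      then show ?thesis using fcd[OF K False] N0 False by (simp add: \<mu>_def)
    qed
  qed
qed

section \<open>The smallest nonzero submodule and the socle\<close>

definition S0 :: "'r set"
  where "S0 = \<Inter>{N. submodule N (gwa R \<sigma> a) V \<and> N \<noteq> {\<zero>}}"

lemma S0_subset: "\<lbrakk>submodule N (gwa R \<sigma> a) V; N \<noteq> {\<zero>}\<rbrakk> \<Longrightarrow> S0 \<subseteq> N"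
  by (auto simp: S0_def)

lemma V_not_zero: "carrier R \<noteq> {\<zero>}"
  using one_closed one_not_zero by blast

lemma S0_submodule: "submodule S0 (gwa R \<sigma> a) V"
proof (rule V.M.submodule_criterion)
  note D = submoduleD[OF V_left_module]
  show "S0 \<subseteq> carrier V" using S0_subset[OF V.M.carrier_submodule] V_not_zero by simp
  show "\<zero>\<^bsub>V\<^esub> \<in> S0" unfolding S0_def using D(2) by blast
  show "v \<oplus>\<^bsub>V\<^esub> w \<in> S0" if "v \<in> S0" "w \<in> S0" for v w
    using that D(3) unfolding S0_def by blast
  show "r \<odot>\<^bsub>V\<^esub> v \<in> S0" if "r \<in> carrier (gwa R \<sigma> a)" "v \<in> S0" for r v
    using that D(4) unfolding S0_def by blast
qed

lemma S0_nonzero: "S0 \<noteq> {\<zero>}"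
proof -
  obtain d where "d \<noteq> \<zero>" "d \<in> S0" using V_common_element unfolding S0_def by blast
  then show ?thesis by blast
qed

lemma S0_simple: "simple_module (gwa R \<sigma> a) (V\<lparr>carrier := S0\<rparr>)"
  using S0_nonzero S0_subset by (auto simp: simple_module_restrict_iff[OF V_left_module S0_submodule])

text \<open>Every simple submodule contains the nonzero submodule \<open>S0\<close> and hence equals
  it, so the sum of all simple submodules has a single term.\<close>

lemma socle_V: "socle (gwa R \<sigma> a) V = V\<lparr>carrier := S0\<rparr>"
proof -
  have "N = S0" if "submodule N (gwa R \<sigma> a) V" "simple_module (gwa R \<sigma> a) (V\<lparr>carrier := N\<rparr>)" for N
    using that S0_subset[of N] S0_nonzero S0_submodule
    by (auto simp: simple_module_restrict_iff[OF V_left_module])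
  then have "{N. submodule N (gwa R \<sigma> a) V \<and> simple_module (gwa R \<sigma> a) (V\<lparr>carrier := N\<rparr>)} = {S0}"
    using S0_submodule S0_simple by blast
  moreover have "generate (add_monoid V) S0 = S0"
  proof (rule V.M.M.add.generateI[symmetric])
    show "subgroup S0 (add_monoid V)" using S0_submodule by (simp add: submodule_def)
  qed auto
  ultimately show ?thesis by (simp add: socle_def)
qed

text \<open>The submodule generated by \<open>s\<close> is isomorphic to \<open>V\<^sub>p\<^sub>'\<close> where \<open>p' s = \<sigma>\<^sup>-\<^sup>1(s) p\<close>.\<close>

lemma S0_iso: "\<exists>p'\<in>carrier R. p' divides a \<and> module_iso (gwa R \<sigma> a) (V\<lparr>carrier := S0\<rparr>) (div_module R \<sigma> a p')"
proof -
  obtain s where s: "s \<in> carrier R" "S0 = PIdl s" "s divides \<tau> s \<otimes> p" "s divides \<sigma> s \<otimes> q"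
    using V_submodule_generator[OF S0_submodule] by blast
  then have s0: "s \<noteq> \<zero>" using S0_nonzero PIdl_eq_zero_iff by blast
  obtain p' where p': "p' \<in> carrier R" "\<tau> s \<otimes> p = p' \<otimes> s" using s(1,3) by (auto simp: factor_def m_comm)
  obtain q' where q': "q' \<in> carrier R" "\<sigma> s \<otimes> q = q' \<otimes> s" using s(1,4) by (auto simp: factor_def m_comm)
  \<comment> \<open>Moving the relation for y back by \<open>\<tau>\<close> yields s c = \<tau>(q')
    \<tau>(s). Together with p' s = \<tau>(s) p and cancellation of \<open>s\<close> it gives a = p'
    \<tau>(q'), so \<open>\<tau> q'\<close> is the cofactor of \<open>p'\<close>.\<close>
  have "\<tau> (\<sigma> s \<otimes> \<sigma> c) = \<tau> (q' \<otimes> s)" using q'(2) by simp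
  then have tq: "s \<otimes> c = \<tau> q' \<otimes> \<tau> s" using s(1) q'(1) by (simp add: ring_aut_mult[OF tau])
  have "s \<otimes> (p' \<otimes> \<tau> q') = \<tau> q' \<otimes> (p' \<otimes> s)" using s(1) p'(1) q'(1) by (simp add: m_ac)
  also have "\<dots> = (\<tau> q' \<otimes> \<tau> s) \<otimes> p" unfolding p'(2)[symmetric] using s(1) q'(1) by (simp add: m_assoc)
  also have "\<dots> = s \<otimes> a" unfolding tq[symmetric] a_eq using s(1) by (simp add: m_ac)
  finally have eq: "a = p' \<otimes> \<tau> q'" using s(1) s0 p'(1) q'(1) m_lcancel by (metis m_closed tau_closed a_closed)
  interpret D: gwa_divisor R \<sigma> a p' "\<tau> q'"
    by unfold_locales (use p' q' eq in auto)
  let ?L = "V\<lparr>carrier := S0\<rparr>"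
  \<comment> \<open>Sends 1 to \<open>s\<close>; the constants \<open>p'\<close> and
    \<open>q'\<close> were chosen to make this map compatible with x and y.\<close>
  let ?f = "\<lambda>r. r \<otimes> s"
  have L: "left_module (gwa R \<sigma> a) ?L" by (rule left_module_restrict[OF V_left_module S0_submodule])
  have onto: "?f ` carrier R = S0" unfolding s(2) by (auto simp: cgenideal_def)
  have "inj_on ?f (carrier R)" using s(1) s0 by (intro inj_onI) (simp add: m_rcancel)
  then have "bij_betw ?f (carrier D.V) (carrier ?L)" using onto by (simp add: bij_betw_def)
  moreover have "?f (v \<oplus>\<^bsub>D.V\<^esub> w) = ?f v \<oplus>\<^bsub>?L\<^esub> ?f w" if "v \<in> carrier D.V" "w \<in> carrier D.V" for v w
    using that s(1) by (simp add: l_distr)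
  moreover have "?f (x \<odot>\<^bsub>D.V\<^esub> v) = x \<odot>\<^bsub>?L\<^esub> ?f v"
    if "x \<in> carrier (gwa R \<sigma> a)" "v \<in> carrier D.V" for x v
  proof (rule D.V.gwa_linearI[OF L _ _ _ _ _ that])
    show "?f v \<in> carrier ?L" if "v \<in> carrier D.V" for v using onto that by auto
    show "?f (v \<oplus>\<^bsub>D.V\<^esub> w) = ?f v \<oplus>\<^bsub>?L\<^esub> ?f w" if "v \<in> carrier D.V" "w \<in> carrier D.V" for v w
      using that s(1) by (simp add: l_distr)
    show "?f (coef r \<odot>\<^bsub>D.V\<^esub> v) = coef r \<odot>\<^bsub>?L\<^esub> ?f v" if "r \<in> carrier R" "v \<in> carrier D.V" for r v
      using that s(1) by (simp add: m_assoc)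
    fix v assume v: "v \<in> carrier D.V"
    have "\<tau> v \<otimes> p' \<otimes> s = \<tau> v \<otimes> (\<tau> s \<otimes> p)" using v s(1) p' by (simp add: m_assoc)
    then show "?f (xgen \<odot>\<^bsub>D.V\<^esub> v) = xgen \<odot>\<^bsub>?L\<^esub> ?f v"
      using v s(1) by (simp add: ring_aut_mult[OF tau] m_assoc)
    have "\<sigma> v \<otimes> q' \<otimes> s = \<sigma> v \<otimes> (\<sigma> s \<otimes> q)" using v s(1) q' by (simp add: m_assoc)
    then show "?f (ygen \<odot>\<^bsub>D.V\<^esub> v) = ygen \<odot>\<^bsub>?L\<^esub> ?f v"
      using v s(1) q'(1) by (simp add: ring_aut_mult[OF sigma] m_assoc)
  qed
  ultimately have "module_iso (gwa R \<sigma> a) D.V ?L" unfolding module_iso_def by blast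
  then have "module_iso (gwa R \<sigma> a) ?L D.V" by (rule module_iso_sym[OF D.V_left_module])
  moreover have "p' divides a" using eq q'(1) by (intro dividesI[of "\<tau> q'"]) auto
  ultimately show ?thesis using p'(1) by blast
qed

lemma S0_not_weight_module: "\<not> weight_module R \<sigma> a (V\<lparr>carrier := S0\<rparr>)"
proof
  let ?S = "V\<lparr>carrier := S0\<rparr>"
  assume wm: "weight_module R \<sigma> a ?S"
  interpret S: gwa_module R \<sigma> a ?S
    by (intro gwa_module.intro gwa_data_axioms left_module_restrict[OF V_left_module S0_submodule])
  have sub: "S0 \<subseteq> carrier R" using submoduleD(1)[OF V_left_module S0_submodule] by simp
  have zero: "v = \<zero>" if I: "I \<in> Max_ideals R" "v \<in> weight_space R \<sigma> a ?S I" for I v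
  proof -
    obtain r where r: "r \<in> carrier R" "ring_irreducible r" "I = PIdl r" using I(1) S.Max_ideals_iff by blast
    then have "v \<in> carrier R" "r \<otimes> v = \<zero>" using I(2) sub by (auto simp: S.wspace_PIdl subset_iff)
    then show ?thesis using r ring_irreducibleE(1)[OF r(1,2)] integral by blast
  qed
  obtain v where v: "v \<in> S0" "v \<noteq> \<zero>"
    using S0_nonzero submoduleD(2)[OF V_left_module S0_submodule] by auto
  then obtain w where w: "w \<in> (\<Pi>\<^sub>E J\<in>Max_ideals R. weight_space R \<sigma> a ?S J)"
    "v = finsum ?S w {J \<in> Max_ideals R. w J \<noteq> \<zero>\<^bsub>?S\<^esub>}"
    using wm unfolding weight_module_def by (auto dest!: bspec[of _ _ v])
  have "{J \<in> Max_ideals R. w J \<noteq> \<zero>\<^bsub>?S\<^esub>} = {}" using w(1) zero by (auto dest!: PiE_mem)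
  then show False using w(2) v(2) by (simp only: S.M.M.finsum_empty) simp
qed

text \<open>The first nonzero term contains \<open>S0\<close> and, being simple, equals it, which
  places the socle at index 0. The lower term of any later factor is an ideal containing
  \<open>d\<close>, so \<open>d\<close> annihilates the factor.\<close>

lemma series_factor_properties:
  assumes Ns: "composition_series (gwa R \<sigma> a) V Ns"
  shows "Suc 0 < length Ns" "module_iso (gwa R \<sigma> a) (series_factor V Ns 0) (V\<lparr>carrier := S0\<rparr>)"
    and "\<And>j. \<lbrakk>Suc j < length Ns; j \<noteq> 0\<rbrakk> \<Longrightarrow> simple_module (gwa R \<sigma> a) (series_factor V Ns j)
      \<and> weight_module R \<sigma> a (series_factor V Ns j)
      \<and> finite (weight_support R \<sigma> a (series_factor V Ns j))"
proof -
  let ?A = "gwa R \<sigma> a"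
  have ne: "Ns \<noteq> []" and h: "Ns ! 0 = {\<zero>}" and l: "last Ns = carrier R"
    and subm: "\<And>i. i < length Ns \<Longrightarrow> submodule (Ns ! i) ?A V"
    and step: "\<And>i. Suc i < length Ns \<Longrightarrow> Ns ! i \<subseteq> Ns ! Suc i \<and> simple_module ?A (series_factor V Ns i)"
    using Ns by (auto simp: composition_series_def hd_conv_nth)
  have "length Ns \<noteq> 1" using h l V_not_zero ne by (auto simp: last_conv_nth)
  then show len: "Suc 0 < length Ns" using ne by (cases Ns) auto
  define N1 where "N1 = Ns ! Suc 0"
  have N1: "submodule N1 ?A V" unfolding N1_def by (rule subm[OF len])
  let ?M = "V\<lparr>carrier := N1\<rparr>"
  have M: "left_module ?A ?M" by (rule left_module_restrict[OF V_left_module N1])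
  have sf: "series_factor V Ns 0 = quot_module ?M {\<zero>}" by (simp add: series_factor_def h N1_def)
  have Z: "submodule {\<zero>} ?A ?M" using left_module.zero_submodule[OF M] by simp
  have simple: "simple_module ?A (quot_module ?M {\<zero>})" using step[OF len] sf by simp
  have N1sub: "N1 \<subseteq> carrier R" using submoduleD(1)[OF V_left_module N1] by simp
  \<comment> \<open>Cosets of the zero submodule are singletons, so the quotient by it is
    \<open>N1\<close> with each vector wrapped in a set.\<close>
  have coset: "{\<zero>} +>\<^bsub>?M\<^esub> v = {v}" if "v \<in> N1" for v
    using that N1sub by (auto simp: a_r_coset_def')
  have N1_nz: "N1 \<noteq> {\<zero>}"
    using simple quot_carrier[OF M Z] quot_zero[OF M Z] coset by (auto simp: simple_module_def)
  have "S0 = N1"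
  proof -
    have S: "submodule S0 ?A ?M"
      using S0_subset[OF N1 N1_nz] S0_submodule by (simp add: submodule_restrict_iff[OF V_left_module N1])
    have c: "v \<in> N1" if "v \<in> S0" for v using that S0_subset[OF N1 N1_nz] by blast
    have "submodule ((\<lambda>v. {\<zero>} +>\<^bsub>?M\<^esub> v) ` carrier (?M\<lparr>carrier := S0\<rparr>)) ?A (quot_module ?M {\<zero>})"
      by (rule image_submodule[OF left_module_restrict[OF M S] quot_left_module[OF M Z]])
        (use c quot_add[OF M Z] quot_smult[OF M Z] in \<open>auto simp: quot_carrier[OF M Z]\<close>)
    then have "submodule ((\<lambda>v. {v}) ` S0) ?A (quot_module ?M {\<zero>})" using c coset by simp
    moreover have "(\<lambda>v. {v}) ` S0 \<noteq> {{\<zero>}}" using S0_nonzero by auto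
    moreover have "carrier (quot_module ?M {\<zero>}) = (\<lambda>v. {v}) ` N1"
      using coset by (simp add: quot_carrier[OF M Z])
    ultimately have "(\<lambda>v. {v}) ` S0 = (\<lambda>v. {v}) ` N1"
      using simple unfolding simple_module_def quot_zero[OF M Z] by metis
    then show ?thesis by (simp add: inj_image_eq_iff)
  qed
  moreover have "module_iso ?A ?M (quot_module ?M {\<zero>})"
    by (rule quot_module_iso[OF M Z M, of id]) auto
  then have "module_iso ?A (quot_module ?M {\<zero>}) ?M" by (rule module_iso_sym[OF M])
  ultimately show "module_iso ?A (series_factor V Ns 0) (V\<lparr>carrier := S0\<rparr>)" using sf by simp
  fix j assume j: "Suc j < length Ns" "j \<noteq> 0"
  have mono: "N1 \<subseteq> Ns ! k" if "0 < k" "k < length Ns" for k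
    using that
  proof (induction k)
    case (Suc k)
    then show ?case using step[of k] by (cases "k = 0") (auto simp: N1_def)
  qed simp
  obtain d where d: "d \<in> carrier R" "d \<noteq> \<zero>"
    "\<And>N. \<lbrakk>submodule N ?A V; N \<noteq> {\<zero>}\<rbrakk> \<Longrightarrow> d \<in> N" using V_common_element by blast
  let ?N = "Ns ! j" and ?N' = "Ns ! Suc j"
  have N: "submodule ?N ?A V" "?N \<subseteq> ?N'" and N': "submodule ?N' ?A V" using subm step j by auto
  have "?N \<noteq> {\<zero>}" using mono[of j] j N1_nz submoduleD(2)[OF V_left_module N1] by auto
  then have dN: "d \<in> ?N" using d N by blast
  let ?K = "V\<lparr>carrier := ?N'\<rparr>" and ?Q = "quot_module (V\<lparr>carrier := ?N'\<rparr>) ?N"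
  have K: "left_module ?A ?K" by (rule left_module_restrict[OF V_left_module N'])
  have NK: "submodule ?N ?A ?K" using N by (simp add: submodule_restrict_iff[OF V_left_module N'])
  have sQ: "simple_module ?A ?Q" using step[OF j(1)] by (simp add: series_factor_def)
  interpret Q: gwa_module R \<sigma> a ?Q
    by (intro gwa_module.intro gwa_data_axioms quot_left_module[OF K NK])
  have "coef d \<odot>\<^bsub>?Q\<^esub> C = \<zero>\<^bsub>?Q\<^esub>" if C: "C \<in> carrier ?Q" for C
  proof -
    obtain v where v: "v \<in> carrier ?K" "C = ?N +>\<^bsub>?K\<^esub> v"
      using C unfolding quot_carrier[OF K NK] by (elim imageE)
    have vR: "v \<in> carrier R" using v(1) submoduleD(1)[OF V_left_module N'] by auto
    \<comment> \<open>In $V_p$ the product d v is also \<open>v\<close> acting on \<open>d\<close>,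
      and \<open>d\<close> lies in the submodule \<open>?N\<close>.\<close>
    have "coef v \<odot>\<^bsub>V\<^esub> d \<in> ?N" using submoduleD(4)[OF V_left_module N(1) _ dN] vR by simp
    then have "d \<otimes> v \<in> ?N" using vR d(1) by (simp add: m_comm)
    moreover have "coef d \<odot>\<^bsub>?Q\<^esub> C = ?N +>\<^bsub>?K\<^esub> (coef d \<odot>\<^bsub>?K\<^esub> v)"
      unfolding v(2) by (rule quot_smult[OF K NK _ v(1)]) (use d in simp)
    moreover have "coef d \<odot>\<^bsub>?K\<^esub> v = d \<otimes> v" using d(1) vR by simp
    moreover have "?N +>\<^bsub>?K\<^esub> (d \<otimes> v) = ?N"
      using quot_eq_zero_iff[OF K NK, of "d \<otimes> v"] calculation(1) N(2) by auto
    ultimately show ?thesis by (simp add: quot_zero[OF K NK])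
  qed
  then show "simple_module ?A (series_factor V Ns j) \<and> weight_module R \<sigma> a (series_factor V Ns j)
      \<and> finite (weight_support R \<sigma> a (series_factor V Ns j))"
    using Q.simple_torsion_weight_module[OF sQ d(1,2)] sQ by (simp add: series_factor_def)
qed

end

section \<open>Simple weight modules with finite support\<close>

context gwa_module
begin

text \<open>On vectors killed by \<open>s\<close>, the Bezout coefficient of \<open>r\<close>
  inverts the action of \<open>r\<close>.\<close>

lemma eq_of_comaximal:
  assumes "r \<in> carrier R" "s \<in> carrier R" "v \<in> carrier M" "w \<in> carrier M" "comaximal r s"
    and "scal s v = \<zero>\<^bsub>M\<^esub>" "scal s w = \<zero>\<^bsub>M\<^esub>" "scal r v = scal r w"
  shows "v = w"
proof -
  obtain x y where xy: "x \<in> carrier R" "y \<in> carrier R" "x \<otimes> r \<oplus> y \<otimes> s = \<one>"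
    using assms(5) by (auto simp: comaximal_def)
  have *: "u = scal x (scal r u)" if "u \<in> carrier M" "scal s u = \<zero>\<^bsub>M\<^esub>" for u
  proof -
    have "u = scal (x \<otimes> r \<oplus> y \<otimes> s) u" using xy(3) that by simp
    also have "\<dots> = scal x (scal r u)"
      using xy(1,2) assms(1,2) that by (simp add: scal_add_left scal_scal[symmetric])
    finally show ?thesis .
  qed
  show ?thesis using *[OF assms(3,6)] *[OF assms(4,7)] assms(8) by simp
qed

lemma weight_module_weight_vector:
  assumes "weight_module R \<sigma> a M" "carrier M \<noteq> {\<zero>\<^bsub>M\<^esub>}"
  shows "\<exists>p\<in>carrier R. ring_irreducible p \<and> (\<exists>v\<in>carrier M. v \<noteq> \<zero>\<^bsub>M\<^esub> \<and> scal p v = \<zero>\<^bsub>M\<^esub>)"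
proof -
  obtain u where u: "u \<in> carrier M" "u \<noteq> \<zero>\<^bsub>M\<^esub>" using assms(2) M.M.zero_closed by blast
  then obtain w where w: "w \<in> (\<Pi>\<^sub>E J\<in>Max_ideals R. wspace J)"
    "u = finsum M w {J \<in> Max_ideals R. w J \<noteq> \<zero>\<^bsub>M\<^esub>}"
    using assms(1) unfolding weight_module_def by blast
  have "{J \<in> Max_ideals R. w J \<noteq> \<zero>\<^bsub>M\<^esub>} \<noteq> {}"
    using w(2) u(2) by (metis M.M.finsum_empty)
  then obtain I where I: "I \<in> Max_ideals R" "w I \<noteq> \<zero>\<^bsub>M\<^esub>" by blast
  then obtain p where p: "p \<in> carrier R" "ring_irreducible p" "I = PIdl p" using Max_ideals_iff by blast
  have "w I \<in> wspace (PIdl p)" using w(1) I(1) p(3) by (auto dest: PiE_mem)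
  then show ?thesis using p I(2) by (auto simp: wspace_PIdl)
qed

text \<open>If no \<open>v n\<close> vanished, the support would contain infinitely many maximal
  ideals.\<close>

lemma finite_support_vanishing:
  assumes fin: "finite (weight_support R \<sigma> a M)"
    and f: "\<And>n. f n \<in> carrier R" "\<And>n. ring_irreducible (f n)" "inj (\<lambda>n :: nat. PIdl (f n))"
    and v: "\<And>n. v n \<in> carrier M" "\<And>n. scal (f n) (v n) = \<zero>\<^bsub>M\<^esub>"
  shows "\<exists>n. v n = \<zero>\<^bsub>M\<^esub>"
proof (rule ccontr)
  assume "\<not> ?thesis"
  then have "PIdl (f n) \<in> weight_support R \<sigma> a M" for n
    unfolding weight_support_def using f(1,2) v Max_ideals_iff wspace_PIdl[OF f(1)] by blast
  then have "range (\<lambda>n. PIdl (f n)) \<subseteq> weight_support R \<sigma> a M" by blast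
  then have "finite (range (\<lambda>n. PIdl (f n)))" using fin finite_subset by blast
  then show False using f(3) finite_imageD by blast
qed

text \<open>
  Applying \<open>y\<close> repeatedly to a weight vector runs through infinitely many weights, so finiteness
  of the support forces it to stop.
\<close>

lemma lowest_weight_vector:
  assumes wm: "weight_module R \<sigma> a M" "carrier M \<noteq> {\<zero>\<^bsub>M\<^esub>}"
    and fin: "finite (weight_support R \<sigma> a M)"
  shows "\<exists>p\<in>carrier R. ring_irreducible p \<and>
    (\<exists>v\<in>carrier M. v \<noteq> \<zero>\<^bsub>M\<^esub> \<and> scal p v = \<zero>\<^bsub>M\<^esub> \<and> yact v = \<zero>\<^bsub>M\<^esub>)"
proof -
  obtain p u where p: "p \<in> carrier R" "ring_irreducible p"
    and u: "u \<in> carrier M" "u \<noteq> \<zero>\<^bsub>M\<^esub>" "scal p u = \<zero>\<^bsub>M\<^esub>"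
    using weight_module_weight_vector[OF wm] by blast
  let ?v = "\<lambda>n. (yact ^^ n) u" and ?f = "\<lambda>n. (\<sigma> ^^ n) p"
  have f: "?f n \<in> carrier R" "ring_irreducible (?f n)" for n
    using p ring_aut_irreducible[OF ring_aut_funpow[OF sigma] p] by auto
  have v: "?v n \<in> carrier M \<and> scal (?f n) (?v n) = \<zero>\<^bsub>M\<^esub>" for n
  proof (induction n)
    case (Suc n)
    have "scal (\<sigma> (?f n)) (yact (?v n)) = \<zero>\<^bsub>M\<^esub>"
      using Suc yact_scal[OF f(1)[of n], of "?v n"] by simp
    then show ?case using Suc by simp
  qed (use u in simp)
  have "\<exists>n. ?v n = \<zero>\<^bsub>M\<^esub>"
    by (rule finite_support_vanishing[OF fin f inj_translates(1)[OF p]]) (use v in blast)+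
  \<comment> \<open>The vector just before the first zero one is killed by y; it exists because the
    initial vector is nonzero.\<close>
  then obtain n where n: "?v n = \<zero>\<^bsub>M\<^esub>" "\<And>k. k < n \<Longrightarrow> ?v k \<noteq> \<zero>\<^bsub>M\<^esub>"
    using exists_least_iff[of "\<lambda>n. ?v n = \<zero>\<^bsub>M\<^esub>"] by blast
  then obtain m where m: "n = Suc m" using u(2) by (cases n) auto
  have "yact (?v m) = \<zero>\<^bsub>M\<^esub>" using n(1) m by simp
  then show ?thesis using n(2)[of m] m v[of m] f[of m] by blast
qed

text \<open>
  Starting from a weight vector \<open>v\<close> killed by \<open>p\<close> and \<open>y\<close>, put \<open>w\<^sub>0 = v\<close> and
  \<open>w\<^sub>j\<^sub>+\<^sub>1 = p\<^sup>-\<^sup>1 x w\<^sub>j\<close>, which makes sense since \<open>p\<close> acts invertibly on the vectors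
  killed by \<open>\<tau>\<^sup>j\<^sup>+\<^sup>1 p\<close>. Then \<open>y w\<^sub>j\<^sub>+\<^sub>1 = q w\<^sub>j\<close>, and the sum \<open>w\<close> of all
  \<open>w\<^sub>j\<close> satisfies the relations \<open>x w = p w\<close> and \<open>y w = q w\<close> of the generator \<open>1\<close> of \<open>V\<^sub>p\<close>.
\<close>

lemma cyclic_vector:
  assumes p: "p \<in> carrier R" "ring_irreducible p" and c: "c \<in> carrier R" "a = p \<otimes> c"
    and v: "v \<in> carrier M" "v \<noteq> \<zero>\<^bsub>M\<^esub>" "scal p v = \<zero>\<^bsub>M\<^esub>" "yact v = \<zero>\<^bsub>M\<^esub>"
    and fin: "finite (weight_support R \<sigma> a M)"
  shows "\<exists>w\<in>carrier M. w \<noteq> \<zero>\<^bsub>M\<^esub> \<and> xact w = scal p w \<and> yact w = scal (\<sigma> c) w"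
proof -
  let ?t = "\<lambda>n. (\<tau> ^^ n) p"
  \<comment> \<open>The coefficient \<open>u n\<close> obtained here plays the role of the inverse
    of \<open>p\<close> on vectors killed by the translate of index n + 1.\<close>
  have "\<exists>u\<in>carrier R. \<exists>z\<in>carrier R. u \<otimes> p \<oplus> z \<otimes> ?t (Suc n) = \<one>" for n
    using comaximal_translates(2)[OF p, of "Suc n"] by (simp add: comaximal_def)
  then obtain u z where u: "\<And>n. u n \<in> carrier R" and z: "\<And>n. z n \<in> carrier R"
    and uz: "\<And>n. u n \<otimes> p \<oplus> z n \<otimes> ?t (Suc n) = \<one>" by metis
  define w where "w = rec_nat v (\<lambda>n x. scal (u n) (xact x))"
  have w_simps: "w 0 = v" "w (Suc n) = scal (u n) (xact (w n))" for n by (simp_all add: w_def)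
  have wc: "w n \<in> carrier M" for n by (induction n) (use v u in \<open>auto simp: w_simps\<close>)
  have wt: "scal (?t n) (w n) = \<zero>\<^bsub>M\<^esub>" for n
  proof (induction n)
    case (Suc n)
    have "scal (\<tau> (?t n)) (xact (w n)) = \<zero>\<^bsub>M\<^esub>" using xact_scal[of "?t n" "w n"] Suc wc p by simp
    then show ?case using u wc p scal_commute[of "\<tau> (?t n)" "u n" "xact (w n)"] by (simp add: w_simps)
  qed (use v in \<open>simp add: w_simps\<close>)
  have xw: "xact (w n) = scal p (w (Suc n))" for n
  proof -
    have t: "scal (?t (Suc n)) (xact (w n)) = \<zero>\<^bsub>M\<^esub>" using xact_scal[of "?t n" "w n"] wt wc p by simp
    have "xact (w n) = scal (u n \<otimes> p \<oplus> z n \<otimes> ?t (Suc n)) (xact (w n))" unfolding uz using wc by simp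
    also have "\<dots> = scal (u n) (scal p (xact (w n)))"
      using t u z p wc tau_funpow_closed[OF p(1), of "Suc n"]
      by (simp del: funpow.simps add: scal_add_left scal_scal[symmetric])
    also have "\<dots> = scal p (w (Suc n))" using u p wc scal_commute by (simp add: w_simps)
    finally show ?thesis .
  qed
  \<comment> \<open>Both sides are killed by \<open>?t n\<close>, so \<open>\<sigma> p\<close> may
    be cancelled. Multiplied by it, the left side becomes y p w_(n+1) = y x w_n, which is
    \<sigma>(a) w_n.\<close>
  have yw: "yact (w (Suc n)) = scal (\<sigma> c) (w n)" for n
  proof (rule eq_of_comaximal[OF _ _ _ _ comaximal_translates(3)[OF p]])
    show "scal (?t n) (yact (w (Suc n))) = \<zero>\<^bsub>M\<^esub>"
      using yact_scal[of "?t (Suc n)" "w (Suc n)"] wt[of "Suc n"] wc p by simp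
    show "scal (?t n) (scal (\<sigma> c) (w n)) = \<zero>\<^bsub>M\<^esub>"
      using scal_commute[of "?t n" "\<sigma> c" "w n"] wt wc p(1) c(1) by simp
    have "scal (\<sigma> p) (yact (w (Suc n))) = yact (xact (w n))"
      using yact_scal[OF p(1) wc, of "Suc n"] xw by simp
    also have "\<dots> = scal (\<sigma> p) (scal (\<sigma> c) (w n))"
      using wc p c(1) by (simp add: yact_xact scal_scal ring_aut_mult[OF sigma p(1) c(1), folded c(2)])
    finally show "scal (\<sigma> p) (yact (w (Suc n))) = scal (\<sigma> p) (scal (\<sigma> c) (w n))" .
  qed (use p c(1) wc in auto)
  \<comment> \<open>Partial sums w_0 + ... + w_n. The shift of indices between s_n and s_(n+1) is
    harmless in the two relations below because p w_0 = 0 and y w_0 = 0.\<close>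
  define s where "s = rec_nat v (\<lambda>n x. x \<oplus>\<^bsub>M\<^esub> w (Suc n))"
  have s_simps: "s 0 = v" "s (Suc n) = s n \<oplus>\<^bsub>M\<^esub> w (Suc n)" for n by (simp_all add: s_def)
  have sc: "s n \<in> carrier M" for n by (induction n) (use v wc in \<open>auto simp: s_simps\<close>)
  have xs: "xact (s n) = scal p (s (Suc n))" for n
  proof (induction n)
    case 0
    then show ?case using xw[of 0] v wc[of "Suc 0"] p by (simp add: s_simps w_simps(1) M.smult_r_distr)
  next
    case (Suc n)
    have "xact (s (Suc n)) = xact (s n) \<oplus>\<^bsub>M\<^esub> xact (w (Suc n))" using sc wc by (simp add: s_simps M.smult_r_distr)
    also have "\<dots> = scal p (s (Suc n) \<oplus>\<^bsub>M\<^esub> w (Suc (Suc n)))"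
      unfolding Suc xw using sc[of "Suc n"] wc p by (simp add: M.smult_r_distr)
    finally show ?case by (simp add: s_simps(2)[of "Suc n"])
  qed
  have ys: "yact (s (Suc n)) = scal (\<sigma> c) (s n)" for n
  proof (induction n)
    case 0
    then show ?case using yw[of 0] v wc c(1) by (simp add: s_simps w_simps(1) M.smult_r_distr)
  next
    case (Suc n)
    have "yact (s (Suc (Suc n))) = yact (s (Suc n)) \<oplus>\<^bsub>M\<^esub> yact (w (Suc (Suc n)))"
      using sc[of "Suc n"] wc by (simp add: s_simps(2)[of "Suc n"] M.smult_r_distr)
    also have "\<dots> = scal (\<sigma> c) (s n \<oplus>\<^bsub>M\<^esub> w (Suc n))"
      unfolding Suc yw using sc wc c(1) by (simp add: M.smult_r_distr)
    finally show ?case by (simp add: s_simps(2)[of n])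
  qed
  \<comment> \<open>\<open>e\<close> is the product of the translates of \<open>p\<close> of index 1
    to n. It kills every w_j with 0 < j in the sum, while on w_0 = v it acts injectively, being
    comaximal with \<open>p\<close>; hence no partial sum vanishes.\<close>
  have e: "\<exists>e\<in>carrier R. comaximal e p \<and> scal e (s n) = scal e v" for n
  proof (induction n)
    case 0
    then show ?case using comaximal_unit[OF Units_one_closed p(1)] by (auto simp: s_simps)
  next
    case (Suc n)
    then obtain e where e: "e \<in> carrier R" "comaximal e p" "scal e (s n) = scal e v" by blast
    let ?e = "?t (Suc n) \<otimes> e"
    have t: "?t (Suc n) \<in> carrier R" "comaximal (?t (Suc n)) p"
      using p comaximal_sym[OF _ _ comaximal_translates(2)[OF p, of "Suc n"]] by simp_all
    have "scal ?e (w (Suc n)) = scal e (scal (?t (Suc n)) (w (Suc n)))"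
      using t(1) e(1) wc[of "Suc n"] by (simp only: scal_scal m_comm)
    then have "scal ?e (w (Suc n)) = \<zero>\<^bsub>M\<^esub>" using wt[of "Suc n"] e(1) by simp
    moreover have "scal ?e (s n) = scal ?e v" if "x = ?t (Suc n)" for x
      using t(1) e sc v(1) by (simp add: scal_scal[symmetric] del: funpow.simps)
    ultimately have "scal ?e (s (Suc n)) = scal ?e v"
      using t(1) e(1) sc wc v(1) by (simp add: s_simps M.smult_r_distr del: funpow.simps)
    moreover have "comaximal ?e p" using comaximal_mult t e p(1) by blast
    ultimately show ?case using t(1) e(1) by blast
  qed
  have s0: "s n \<noteq> \<zero>\<^bsub>M\<^esub>" for n
  proof
    assume "s n = \<zero>\<^bsub>M\<^esub>"
    then obtain e where "e \<in> carrier R" "comaximal e p" "scal e v = \<zero>\<^bsub>M\<^esub>" using e[of n] by force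
    then show False using eq_zero_of_comaximal[of e p v] p v by blast
  qed
  have "\<exists>n. w n = \<zero>\<^bsub>M\<^esub>"
    by (rule finite_support_vanishing[OF fin _ _ inj_translates(2)[OF p]])
      (use p wc wt ring_aut_irreducible[OF ring_aut_funpow[OF tau] p] in auto)
  then obtain n where n: "w n = \<zero>\<^bsub>M\<^esub>" by blast
  then obtain m where "n = Suc m" using v(2) w_simps(1) by (cases n) auto
  \<comment> \<open>Once w_(m+1) = 0, two consecutive partial sums agree, and the relations between
    them become relations for a single vector.\<close>
  then have "s (Suc m) = s m" using n sc by (simp add: s_simps)
  then show ?thesis using xs[of m] ys[of m] sc[of m] s0[of m] by (intro bexI[of _ "s m"]) auto
qed

text \<open>The kernel of the map from $V_p$ is a maximal submodule. A series of the kernel,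
  prolonged by the whole module, is a composition series whose top factor is the given
  module.\<close>

lemma simple_weight_module_composition_factor:
  assumes simple: "simple_module (gwa R \<sigma> a) M" and wm: "weight_module R \<sigma> a M"
    and fin: "finite (weight_support R \<sigma> a M)"
  shows "\<exists>p\<in>carrier R. p divides a \<and> composition_factor (gwa R \<sigma> a) (div_module R \<sigma> a p) M"
proof -
  have nz: "carrier M \<noteq> {\<zero>\<^bsub>M\<^esub>}" using simple by (simp add: simple_module_def)
  obtain p v where p: "p \<in> carrier R" "ring_irreducible p"
    and v: "v \<in> carrier M" "v \<noteq> \<zero>\<^bsub>M\<^esub>" "scal p v = \<zero>\<^bsub>M\<^esub>" "yact v = \<zero>\<^bsub>M\<^esub>"
    using lowest_weight_vector[OF wm nz fin] by blast
  have "scal a v = \<zero>\<^bsub>M\<^esub>" using xact_yact[OF v(1)] v(4) by simp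
  then have dvd: "p divides a"
    using comaximal_irreducible[OF p a_closed] eq_zero_of_comaximal[OF p(1) a_closed v(1)] v by blast
  then obtain c where c: "c \<in> carrier R" "a = p \<otimes> c" by (auto simp: factor_def)
  obtain w where w: "w \<in> carrier M" "w \<noteq> \<zero>\<^bsub>M\<^esub>" "xact w = scal p w" "yact w = scal (\<sigma> c) w"
    using cyclic_vector[OF p c v fin] by blast
  interpret D: gwa_divisor R \<sigma> a p c by unfold_locales (use p c in auto)
  let ?f = "\<lambda>r. scal r w"
  have fc: "?f r \<in> carrier M" if "r \<in> carrier D.V" for r using that w(1) by simp
  have fadd: "?f (r \<oplus>\<^bsub>D.V\<^esub> s) = ?f r \<oplus>\<^bsub>M\<^esub> ?f s" if "r \<in> carrier D.V" "s \<in> carrier D.V" for r s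
    using that w(1) by (simp add: scal_add_left)
  have lin: "?f (x \<odot>\<^bsub>D.V\<^esub> r) = x \<odot>\<^bsub>M\<^esub> ?f r" if "x \<in> carrier (gwa R \<sigma> a)" "r \<in> carrier D.V" for x r
  proof (rule D.V.gwa_linearI[OF M.left_module_axioms fc fadd _ _ _ that])
    show "?f (coef r \<odot>\<^bsub>D.V\<^esub> s) = scal r (?f s)" if "r \<in> carrier R" "s \<in> carrier D.V" for r s
      using that w(1) by (simp add: scal_scal)
    show "?f (xgen \<odot>\<^bsub>D.V\<^esub> r) = xact (?f r)" if "r \<in> carrier D.V" for r
      using that w(1) p by (simp add: xact_scal w(3) scal_scal)
    show "?f (ygen \<odot>\<^bsub>D.V\<^esub> r) = yact (?f r)" if "r \<in> carrier D.V" for r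
      using that w(1) c(1) by (simp add: yact_scal w(4) scal_scal)
  qed
  have "submodule (?f ` carrier D.V) (gwa R \<sigma> a) M"
    by (rule image_submodule[OF D.V_left_module M.left_module_axioms fc fadd lin])
  moreover have "w \<in> ?f ` carrier D.V" using w(1) by (intro image_eqI[of _ _ \<one>]) auto
  ultimately have onto: "?f ` carrier D.V = carrier M"
    using simple w(2) unfolding simple_module_def by blast
  define K where "K = {r \<in> carrier D.V. ?f r = \<zero>\<^bsub>M\<^esub>}"
  note ker = simple_module_kernel[OF D.V_left_module simple onto fadd lin, folded K_def]
  obtain Ns where Ns: "series_upto (gwa R \<sigma> a) D.V K Ns" using D.V_series_upto[OF ker(1)] by blast
  have "K \<subseteq> carrier D.V" by (auto simp: K_def)
  note snoc = series_upto_snoc[OF Ns D.V.M.carrier_submodule this]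
  have V_eq: "D.V\<lparr>carrier := carrier D.V\<rparr> = D.V" by simp
  have "composition_series (gwa R \<sigma> a) D.V (Ns @ [carrier D.V])"
    "series_factor D.V (Ns @ [carrier D.V]) (length Ns - 1) = quot_module D.V K"
    using snoc[unfolded V_eq, OF ker(3)] unfolding composition_series_iff by blast+
  moreover have "Suc (length Ns - 1) < length (Ns @ [carrier D.V])"
    using Ns by (simp add: series_upto_def)
  ultimately have "composition_factor (gwa R \<sigma> a) D.V M"
    unfolding composition_factor_def using ker(2) by metis
  then show ?thesis using p(1) dvd by blast
qed

end

text \<open>Part (a) also records that a series exists, so that the statement about all series is
  not vacuous, and that the socle is not a weight module with finite support, so that the exception
  is genuine.\<close>

theorem theorem3p14:
  fixes R :: "('r, 'm) ring_scheme" and \<sigma> :: "'r \<Rightarrow> 'r" and a :: 'r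
  assumes "principal_domain R" and "\<not> field R"
    and "\<sigma> \<in> ring_iso R R"
    and "a \<in> carrier R" and "a \<noteq> \<zero>\<^bsub>R\<^esub>"
    and "\<forall>C\<in>Irr R. infinite (Irr_orbit R \<sigma> C)"
  shows "(\<forall>p\<in>carrier R. p divides\<^bsub>R\<^esub> a \<longrightarrow>
      (let A = gwa R \<sigma> a; V = div_module R \<sigma> a p; S = socle A V in
        left_module A V
      \<and> (\<exists>Ns. composition_series A V Ns)
      \<and> simple_module A S
      \<and> (\<exists>p'\<in>carrier R. p' divides\<^bsub>R\<^esub> a \<and> module_iso A S (div_module R \<sigma> a p'))
      \<and> \<not> (weight_module R \<sigma> a S \<and> finite (weight_support R \<sigma> a S))
      \<and> (\<forall>Ns. composition_series A V Ns \<longrightarrow>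
           (\<exists>i. Suc i < length Ns \<and> module_iso A (series_factor V Ns i) S
             \<and> (\<forall>j. Suc j < length Ns \<and> j \<noteq> i \<longrightarrow>
                  simple_module A (series_factor V Ns j)
                \<and> weight_module R \<sigma> a (series_factor V Ns j)
                \<and> finite (weight_support R \<sigma> a (series_factor V Ns j)))))))
    \<and> (\<forall>L :: ('r gwa_term set, 'v) module.
        simple_module (gwa R \<sigma> a) L \<and> weight_module R \<sigma> a L
          \<and> finite (weight_support R \<sigma> a L) \<longrightarrow>
        (\<exists>p\<in>carrier R. p divides\<^bsub>R\<^esub> a
          \<and> composition_factor (gwa R \<sigma> a) (div_module R \<sigma> a p) L))"
proof -
  interpret gwa_data R \<sigma> a
    by (intro gwa_data.intro gwa_data_axioms.intro assms)
  show ?thesis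
  proof (intro conjI ballI impI allI)
    fix p assume p: "p \<in> carrier R" "p divides\<^bsub>R\<^esub> a"
    then obtain c where "c \<in> carrier R" "a = p \<otimes>\<^bsub>R\<^esub> c" by (auto simp: factor_def)
    then interpret D: gwa_divisor R \<sigma> a p c by unfold_locales (use p in auto)
    have "\<exists>Ns. composition_series (gwa R \<sigma> a) D.V Ns"
      using D.V_series_upto[OF D.V.M.carrier_submodule] by (simp only: composition_series_iff)
    then show "let A = gwa R \<sigma> a; V = div_module R \<sigma> a p; S = socle A V in
        left_module A V
      \<and> (\<exists>Ns. composition_series A V Ns)
      \<and> simple_module A S
      \<and> (\<exists>p'\<in>carrier R. p' divides\<^bsub>R\<^esub> a \<and> module_iso A S (div_module R \<sigma> a p'))
      \<and> \<not> (weight_module R \<sigma> a S \<and> finite (weight_support R \<sigma> a S))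
      \<and> (\<forall>Ns. composition_series A V Ns \<longrightarrow>
           (\<exists>i. Suc i < length Ns \<and> module_iso A (series_factor V Ns i) S
             \<and> (\<forall>j. Suc j < length Ns \<and> j \<noteq> i \<longrightarrow>
                  simple_module A (series_factor V Ns j)
                \<and> weight_module R \<sigma> a (series_factor V Ns j)
                \<and> finite (weight_support R \<sigma> a (series_factor V Ns j)))))"
      unfolding Let_def D.socle_V
      using D.V_left_module D.S0_simple D.S0_iso D.S0_not_weight_module D.series_factor_properties
      by (intro conjI allI impI exI[of _ 0]) blast+
  next
    fix L :: "('r gwa_term set, 'v) module"
    assume L: "simple_module (gwa R \<sigma> a) L \<and> weight_module R \<sigma> a L \<and> finite (weight_support R \<sigma> a L)"
    then interpret L: gwa_module R \<sigma> a L
      by (intro gwa_module.intro gwa_data_axioms) (simp add: simple_module_def)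
    show "\<exists>p\<in>carrier R. p divides\<^bsub>R\<^esub> a
          \<and> composition_factor (gwa R \<sigma> a) (div_module R \<sigma> a p) L"
      using L.simple_weight_module_composition_factor L by blast
  qed
qed

end
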